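(* We have $\dim H^2(U,V)=1$ and $t$ acts on it as the multiplication by $\epsilon ^{l_1}(\epsilon ^{\prime})^{l_2}$.
   Context: Let $F$ be a real quadratic field with ring of integers $\mathcal O_F=\mathbf Z+\mathbf Z\omega$, let $\epsilon$ be the fundamental unit of $F$, and for $x\in F$ let $x'$ denote its Galois conjugate. Let $\Gamma={\rm PSL}(2,\mathcal O_F)$, $U=\{\begin{pmatrix} \pm1 & 0\\ u & \pm1\end{pmatrix} : u\in\mathcal O_F\}/\{\pm 1_2\}$ and $t=\begin{pmatrix} \epsilon^{-1} & 0\\ 0 & \epsilon\end{pmatrix}$, which normalizes $U$. Let $l_1\ge l_2\ge 0$ be integers with $l_1\equiv l_2 \bmod 2$. For $l\ge0$ let $\rho_l$ be the symmetric tensor representation of ${\rm GL}(2,\mathbf C)$ of degree $l$ on $\mathbf C^{l+1}$. Let $V=V_1\otimes V_2$ with $V_i=\mathbf C^{l_i+1}$, on which $\gamma\in\Gamma$ acts by $\rho_{l_1}(\gamma)\otimes\rho_{l_2}(\gamma')$, $\gamma'$ being the Galois conjugate matrix. The action of $t$ on $H^q(U,V)$ is induced by sending a cocycle $f$ to $(n_1,\dots,n_q)\mapsto t^{-1}f(tn_1t^{-1},\dots,tn_qt^{-1})$. *)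

theory Defs
  imports
    "Jordan_Normal_Form.VS_Connect"
    "HOL-Algebra.Embedded_Algebras"
    "HOL-Computational_Algebra.Polynomial"
begin

section \<open>Real quadratic fields\<close>

text \<open>
  A real quadratic field is given together with one of its two real embeddings, i.e. as a subfield
  of the reals of degree 2 over the rationals. The other embedding is the Galois conjugation,
  followed by the inclusion.
\<close>

definition real_quadratic_field :: "real set \<Rightarrow> bool" where
  "real_quadratic_field F \<longleftrightarrow>
     subfield F (class_ring :: real ring) \<and> ring.dimension (class_ring :: real ring) 2 \<rat> F"

definition galois_conj :: "real set \<Rightarrow> real \<Rightarrow> real" where
  "galois_conj F = (THE \<sigma>. \<sigma> \<in> extensional F
     \<and> \<sigma> \<in> ring_iso (class_ring\<lparr>carrier := F\<rparr>) (class_ring\<lparr>carrier := F\<rparr>)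
     \<and> (\<exists>x\<in>F. \<sigma> x \<noteq> x))"

definition ring_of_integers :: "real set \<Rightarrow> real set" where
  "ring_of_integers F = {x \<in> F. algebraic_int x}"

definition integer_units :: "real set \<Rightarrow> real set" where
  "integer_units F = {x \<in> ring_of_integers F. \<exists>y\<in>ring_of_integers F. x * y = 1}"

definition fundamental_unit :: "real set \<Rightarrow> real \<Rightarrow> bool" where
  "fundamental_unit F \<epsilon> \<longleftrightarrow> \<epsilon> \<in> integer_units F \<and> \<epsilon> > 1
     \<and> (\<forall>x\<in>integer_units F. \<exists>k::int. x = \<epsilon> powi k \<or> x = - (\<epsilon> powi k))"


section \<open>The groups\<close>

definition mat2 :: "'a \<Rightarrow> 'a \<Rightarrow> 'a \<Rightarrow> 'a \<Rightarrow> 'a mat" where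
  "mat2 a b c d = mat_of_rows_list 2 [[a, b], [c, d]]"

definition SL2 :: "'a::comm_ring_1 set \<Rightarrow> 'a mat monoid" where
  "SL2 A = \<lparr>carrier = {g \<in> carrier_mat 2 2. elements_mat g \<subseteq> A \<and> det g = 1},
            mult = (*), one = 1\<^sub>m 2\<rparr>"

definition pm_one :: "'a::comm_ring_1 mat set" where
  "pm_one = {1\<^sub>m 2, - 1\<^sub>m 2}"

definition PSL2 :: "'a::comm_ring_1 set \<Rightarrow> 'a mat set monoid" where
  "PSL2 A = SL2 A Mod pm_one"

definition proj_class :: "'a::comm_ring_1 set \<Rightarrow> 'a mat \<Rightarrow> 'a mat set" where
  "proj_class A g = pm_one #>\<^bsub>SL2 A\<^esub> g"

text \<open>The two diagonal signs agree because the determinant is 1.\<close>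

definition lower_unipotents :: "'a::comm_ring_1 set \<Rightarrow> 'a mat set set" where
  "lower_unipotents A = {proj_class A (mat2 s 0 u s) | s u. s \<in> {1, -1} \<and> u \<in> A}"


section \<open>The representation\<close>

text \<open>
  The symmetric tensor representation on \<open>\<complex>\<^bsup>l+1\<^esup>\<close>, in the coordinates in which the symmetric
  tensor \<open>w \<otimes> \<dots> \<otimes> w\<close> for \<open>w = (u, v)\<close> is
  \<open>(u\<^bsup>l\<^esup>, u\<^bsup>l-1\<^esup> v, \<dots>, v\<^bsup>l\<^esup>)\<close>. Row \<open>i\<close> of the matrix of \<open>g = (a b; c d)\<close> consists of the
  coefficients of \<open>(a u + b v)\<^bsup>l-i\<^esup> (c u + d v)\<^bsup>i\<^esup>\<close>, dehomogenised by \<open>u = 1\<close>; see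
  \<open>sym_rep_sym_power\<close> below.
\<close>

definition sym_rep :: "nat \<Rightarrow> complex mat \<Rightarrow> complex mat" where
  "sym_rep l g = mat (l + 1) (l + 1) (\<lambda>(i, j).
     Polynomial.coeff ([:g $$ (0, 0), g $$ (0, 1):] ^ (l - i) * [:g $$ (1, 0), g $$ (1, 1):] ^ i) j)"

definition sym_power :: "nat \<Rightarrow> complex vec \<Rightarrow> complex vec" where
  "sym_power l w = vec (l + 1) (\<lambda>j. (w $ 0) ^ (l - j) * (w $ 1) ^ j)"

lemma homogenise_mult_linear:
  fixes p :: "complex poly"
  assumes "degree p \<le> m"
  shows "(\<Sum>j\<le>Suc m. Polynomial.coeff ([:a, b:] * p) j * (u ^ (Suc m - j) * v ^ j))
       = (a * u + b * v) * (\<Sum>j\<le>m. Polynomial.coeff p j * (u ^ (m - j) * v ^ j))"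
proof -
  have c0: "Polynomial.coeff p (Suc m) = 0"
    using assms by (simp add: coeff_eq_0)
  have A: "(\<Sum>j\<le>Suc m. a * Polynomial.coeff p j * (u ^ (Suc m - j) * v ^ j))
         = a * u * (\<Sum>j\<le>m. Polynomial.coeff p j * (u ^ (m - j) * v ^ j))"
    by (simp add: c0 sum_distrib_left Suc_diff_le mult_ac)
  have B: "(\<Sum>j\<le>Suc m. b * Polynomial.coeff (pCons 0 p) j * (u ^ (Suc m - j) * v ^ j))
         = b * v * (\<Sum>j\<le>m. Polynomial.coeff p j * (u ^ (m - j) * v ^ j))"
    by (subst sum.atMost_Suc_shift) (simp add: sum_distrib_left mult_ac)
  have "Polynomial.coeff ([:a, b:] * p) j = a * Polynomial.coeff p j + b * Polynomial.coeff (pCons 0 p) j" for j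
    by (cases j) simp_all
  then have "(\<Sum>j\<le>Suc m. Polynomial.coeff ([:a, b:] * p) j * (u ^ (Suc m - j) * v ^ j))
    = (\<Sum>j\<le>Suc m. a * Polynomial.coeff p j * (u ^ (Suc m - j) * v ^ j))
    + (\<Sum>j\<le>Suc m. b * Polynomial.coeff (pCons 0 p) j * (u ^ (Suc m - j) * v ^ j))"
    by (simp only: distrib_right sum.distrib)
  then show ?thesis
    by (simp only: A B distrib_right)
qed

lemma degree_linear_power_mult:
  fixes p :: "complex poly"
  assumes "degree p \<le> m"
  shows "degree ([:a, b:] ^ k * p) \<le> k + m"
proof -
  have "degree ([:a, b:] ^ k) \<le> degree [:a, b:] * k"
    by (rule degree_power_le)
  also have "\<dots> \<le> k" by simp
  finally show ?thesis
    using degree_mult_le[of "[:a, b:] ^ k" p] assms by linarith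
qed

lemma homogenise_mult_linear_power:
  fixes p :: "complex poly"
  assumes "degree p \<le> m"
  shows "(\<Sum>j\<le>k + m. Polynomial.coeff ([:a, b:] ^ k * p) j * (u ^ (k + m - j) * v ^ j))
       = (a * u + b * v) ^ k * (\<Sum>j\<le>m. Polynomial.coeff p j * (u ^ (m - j) * v ^ j))"
proof (induction k)
  case (Suc k)
  show ?case
    using homogenise_mult_linear[OF degree_linear_power_mult[OF assms], of a b a b k u v] Suc.IH
    by (simp only: power_Suc mult.assoc add_Suc)
qed simp

lemma sym_rep_sym_power:
  assumes "g \<in> carrier_mat 2 2" "w \<in> carrier_vec 2"
  shows "sym_rep l g *\<^sub>v sym_power l w = sym_power l (g *\<^sub>v w)"
proof (rule eq_vecI)
  fix i assume "i < dim_vec (sym_power l (g *\<^sub>v w))"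
  then have i: "i \<le> l" by (simp add: sym_power_def)
  let ?p = "[:g $$ (1, 0), g $$ (1, 1):]" and ?q = "[:g $$ (0, 0), g $$ (0, 1):]"
  let ?u = "w $ 0" and ?v = "w $ 1"
  have d: "degree (?p ^ i * 1) \<le> i"
    using degree_linear_power_mult[of 1 0] by simp
  have gw: "(g *\<^sub>v w) $ 0 = g $$ (0, 0) * ?u + g $$ (0, 1) * ?v"
           "(g *\<^sub>v w) $ 1 = g $$ (1, 0) * ?u + g $$ (1, 1) * ?v"
    using assms by (auto simp: scalar_prod_def numeral_2_eq_2)
  have "(sym_rep l g *\<^sub>v sym_power l w) $ i
      = (\<Sum>j\<le>l. Polynomial.coeff (?q ^ (l - i) * ?p ^ i) j * (?u ^ (l - j) * ?v ^ j))"
    using i by (simp add: sym_rep_def sym_power_def scalar_prod_def row_def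
        atLeast0LessThan lessThan_Suc_atMost del: sum.lessThan_Suc)
  also have "\<dots> = (g $$ (0, 0) * ?u + g $$ (0, 1) * ?v) ^ (l - i)
                 * (g $$ (1, 0) * ?u + g $$ (1, 1) * ?v) ^ i"
    using homogenise_mult_linear_power[OF d, where k = "l - i" and u = ?u and v = ?v]
      homogenise_mult_linear_power[where p = 1 and m = 0 and k = i and u = ?u and v = ?v] i
    by simp
  also have "\<dots> = sym_power l (g *\<^sub>v w) $ i"
    using i by (simp add: sym_power_def gw del: One_nat_def)
  finally show "(sym_rep l g *\<^sub>v sym_power l w) $ i = sym_power l (g *\<^sub>v w) $ i" .
qed (simp add: sym_rep_def sym_power_def)

text \<open>
  The tensor product \<open>\<complex>\<^sup>m \<otimes> \<complex>\<^sup>n\<close> is the space of \<open>m \<times> n\<close> matrices, the matrix entry \<open>(i, j)\<close>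
  being the coordinate along \<open>e\<^sub>i \<otimes> e\<^sub>j\<close>, and \<open>A \<otimes> B\<close> acts by \<open>X \<mapsto> A X B\<^sup>T\<close>.
\<close>

definition tensor_vec :: "complex vec \<Rightarrow> complex vec \<Rightarrow> complex mat" where
  "tensor_vec x y = mat (dim_vec x) (dim_vec y) (\<lambda>(i, j). x $ i * y $ j)"

definition tensor_op :: "complex mat \<Rightarrow> complex mat \<Rightarrow> complex mat \<Rightarrow> complex mat" where
  "tensor_op A B X = A * X * transpose_mat B"

lemma tensor_op_tensor_vec:
  assumes "A \<in> carrier_mat m m" "B \<in> carrier_mat n n" "x \<in> carrier_vec m" "y \<in> carrier_vec n"
  shows "tensor_op A B (tensor_vec x y) = tensor_vec (A *\<^sub>v x) (B *\<^sub>v y)"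
proof (rule eq_matI)
  fix i j
  assume "i < dim_row (tensor_vec (A *\<^sub>v x) (B *\<^sub>v y))" "j < dim_col (tensor_vec (A *\<^sub>v x) (B *\<^sub>v y))"
  then have ij: "i < m" "j < n"
    using assms by (auto simp: tensor_vec_def)
  have "tensor_op A B (tensor_vec x y) $$ (i, j)
      = (\<Sum>k = 0..<n. (\<Sum>h = 0..<m. A $$ (i, h) * (x $ h * y $ k)) * B $$ (j, k))"
    using assms ij by (simp add: tensor_op_def tensor_vec_def scalar_prod_def)
  also have "\<dots> = (\<Sum>h = 0..<m. A $$ (i, h) * x $ h) * (\<Sum>k = 0..<n. B $$ (j, k) * y $ k)"
    unfolding sum_distrib_right by (subst sum.swap) (simp add: sum_distrib_left mult_ac)
  also have "\<dots> = tensor_vec (A *\<^sub>v x) (B *\<^sub>v y) $$ (i, j)"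
    using assms ij by (simp add: tensor_vec_def scalar_prod_def)
  finally show "tensor_op A B (tensor_vec x y) $$ (i, j) = tensor_vec (A *\<^sub>v x) (B *\<^sub>v y) $$ (i, j)" .
qed (use assms in \<open>auto simp: tensor_op_def tensor_vec_def\<close>)

definition rep_space :: "nat \<Rightarrow> nat \<Rightarrow> (complex, complex mat) module" where
  "rep_space l1 l2 = module_mat TYPE(complex) (l1 + 1) (l2 + 1)"

definition SL2_act :: "real set \<Rightarrow> nat \<Rightarrow> nat \<Rightarrow> real mat \<Rightarrow> complex mat \<Rightarrow> complex mat" where
  "SL2_act F l1 l2 g = tensor_op
     (sym_rep l1 (map_mat complex_of_real g))
     (sym_rep l2 (map_mat complex_of_real (map_mat (galois_conj F) g)))"

text \<open>
  An element of the projective group is a class \<open>{g, -g}\<close>; both representatives act in the same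
  way when \<open>l1\<close> and \<open>l2\<close> have the same parity.
\<close>

definition PSL2_act :: "real set \<Rightarrow> nat \<Rightarrow> nat \<Rightarrow> real mat set \<Rightarrow> complex mat \<Rightarrow> complex mat" where
  "PSL2_act F l1 l2 X v = the_elem ((\<lambda>g. SL2_act F l1 l2 g v) ` X)"


section \<open>Group cohomology\<close>

text \<open>
  Inhomogeneous cochains of a group \<open>G\<close> with values in a module \<open>M\<close> on which \<open>G\<close> acts by \<open>act\<close>.
  A tuple of group elements is a list.
\<close>

definition tuples :: "('g, 'b) monoid_scheme \<Rightarrow> nat \<Rightarrow> 'g list set" where
  "tuples G q = {xs \<in> lists (carrier G). length xs = q}"

definition cochains ::
    "('g, 'b) monoid_scheme \<Rightarrow> ('k, 'v, 'c) module_scheme \<Rightarrow> nat \<Rightarrow> ('k, 'g list \<Rightarrow> 'v) module" where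
  "cochains G M q = \<lparr>
     carrier = tuples G q \<rightarrow>\<^sub>E carrier M,
     mult = undefined,
     one = undefined,
     zero = (\<lambda>xs\<in>tuples G q. \<zero>\<^bsub>M\<^esub>),
     add = (\<lambda>f g. \<lambda>xs\<in>tuples G q. f xs \<oplus>\<^bsub>M\<^esub> g xs),
     smult = (\<lambda>c f. \<lambda>xs\<in>tuples G q. c \<odot>\<^bsub>M\<^esub> f xs)\<rparr>"

text \<open>Replaces the \<open>i\<close>-th and \<open>(i+1)\<close>-st entries, counted from 1, by their product.\<close>

definition merge_at :: "('g, 'b) monoid_scheme \<Rightarrow> nat \<Rightarrow> 'g list \<Rightarrow> 'g list" where
  "merge_at G i xs = take (i - 1) xs @ [xs ! (i - 1) \<otimes>\<^bsub>G\<^esub> xs ! i] @ drop (i + 1) xs"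

definition coboundary ::
    "('g, 'b) monoid_scheme \<Rightarrow> ('k, 'v, 'c) module_scheme \<Rightarrow> ('g \<Rightarrow> 'v \<Rightarrow> 'v) \<Rightarrow> nat
      \<Rightarrow> ('g list \<Rightarrow> 'v) \<Rightarrow> ('g list \<Rightarrow> 'v)" where
  "coboundary G M act q f = (\<lambda>xs\<in>tuples G (q + 1).
     act (hd xs) (f (tl xs))
     \<oplus>\<^bsub>M\<^esub> (\<Oplus>\<^bsub>M\<^esub>i\<in>{1..q}. [((-1) ^ i :: int)] \<cdot>\<^bsub>M\<^esub> f (merge_at G i xs))
     \<oplus>\<^bsub>M\<^esub> [((-1) ^ (q + 1) :: int)] \<cdot>\<^bsub>M\<^esub> f (butlast xs))"

definition cocycles ::
    "('g, 'b) monoid_scheme \<Rightarrow> ('k, 'v, 'c) module_scheme \<Rightarrow> ('g \<Rightarrow> 'v \<Rightarrow> 'v) \<Rightarrow> nat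
      \<Rightarrow> ('g list \<Rightarrow> 'v) set" where
  "cocycles G M act q =
     {f \<in> carrier (cochains G M q). coboundary G M act q f = \<zero>\<^bsub>cochains G M (q + 1)\<^esub>}"

definition coboundaries ::
    "('g, 'b) monoid_scheme \<Rightarrow> ('k, 'v, 'c) module_scheme \<Rightarrow> ('g \<Rightarrow> 'v \<Rightarrow> 'v) \<Rightarrow> nat
      \<Rightarrow> ('g list \<Rightarrow> 'v) set" where
  "coboundaries G M act q = (case q of
     0 \<Rightarrow> {\<zero>\<^bsub>cochains G M 0\<^esub>}
   | Suc p \<Rightarrow> coboundary G M act p ` carrier (cochains G M p))"

text \<open>
  The quotient of the cocycles by the coboundaries. Operations on classes are computed on
  representatives; adding \<open>B\<close> turns the image of a class under a map preserving \<open>B\<close> into a class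
  again (multiplication by 0 sends all of a class to a single element).
\<close>

definition on_classes ::
    "('k, 'v, 'c) module_scheme \<Rightarrow> 'v set \<Rightarrow> ('v \<Rightarrow> 'v) \<Rightarrow> 'v set \<Rightarrow> 'v set" where
  "on_classes M B \<phi> X = B <+>\<^bsub>M\<^esub> (\<phi> ` X)"

definition cohomology ::
    "('g, 'b) monoid_scheme \<Rightarrow> ('k, 'v, 'c) module_scheme \<Rightarrow> ('g \<Rightarrow> 'v \<Rightarrow> 'v) \<Rightarrow> nat
      \<Rightarrow> ('k, ('g list \<Rightarrow> 'v) set) module" where
  "cohomology G M act q = (let C = cochains G M q; B = coboundaries G M act q in \<lparr>
     carrier = {B +>\<^bsub>C\<^esub> f | f. f \<in> cocycles G M act q},
     mult = undefined,
     one = undefined,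
     zero = B,
     add = set_add C,
     smult = (\<lambda>c. on_classes C B (\<lambda>f. c \<odot>\<^bsub>C\<^esub> f))\<rparr>)"

text \<open>
  For a subgroup \<open>U\<close> of \<open>G\<close> and \<open>t\<close> in its normalizer: the action of \<open>t\<close> on cochains and on the
  cohomology of \<open>U\<close>.
\<close>

definition conj_cochain ::
    "('g, 'b) monoid_scheme \<Rightarrow> 'g set \<Rightarrow> ('g \<Rightarrow> 'v \<Rightarrow> 'v) \<Rightarrow> nat \<Rightarrow> 'g
      \<Rightarrow> ('g list \<Rightarrow> 'v) \<Rightarrow> ('g list \<Rightarrow> 'v)" where
  "conj_cochain G U act q t f = (\<lambda>xs\<in>tuples (G\<lparr>carrier := U\<rparr>) q.
     act (inv\<^bsub>G\<^esub> t) (f (map (\<lambda>n. t \<otimes>\<^bsub>G\<^esub> n \<otimes>\<^bsub>G\<^esub> inv\<^bsub>G\<^esub> t) xs)))"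

definition conj_cohomology ::
    "('g, 'b) monoid_scheme \<Rightarrow> 'g set \<Rightarrow> ('k, 'v, 'c) module_scheme \<Rightarrow> ('g \<Rightarrow> 'v \<Rightarrow> 'v) \<Rightarrow> nat \<Rightarrow> 'g
      \<Rightarrow> ('g list \<Rightarrow> 'v) set \<Rightarrow> ('g list \<Rightarrow> 'v) set" where
  "conj_cohomology G U M act q t =
     on_classes (cochains (G\<lparr>carrier := U\<rparr>) M q) (coboundaries (G\<lparr>carrier := U\<rparr>) M act q)
       (conj_cochain G U act q t)"

end

theory Submission
  imports Defs "Jordan_Normal_Form.Char_Poly"
begin

text \<open>
  The group \<open>U\<close> is isomorphic to \<open>\<O> = \<int> + \<int>\<omega>\<close>, so a 2-cocycle \<open>f\<close> is trivial as soon as lifts of the two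
  generators commute in the extension of \<open>U\<close> by \<open>V\<close> that it defines, i.e. as soon as
  \<open>f(1,\<omega>) - f(\<omega>,1)\<close> vanishes in the coinvariants of \<open>V\<close>. Since \<open>(1,1)\<close> and \<open>(\<omega>,\<omega>')\<close> are linearly
  independent, the two generators see both nilpotent directions of \<open>V\<^sub>1 \<otimes> V\<^sub>2\<close>, and the coinvariants
  are one-dimensional, given by the \<open>(0,0)\<close> entry. The resulting functional on cocycles is not zero:
  it does not vanish on the cup product of the 1-cocycles \<open>x \<mapsto> (x\<^sup>i\<^sup>+\<^sup>1 / (i+1))\<^sub>i\<close> of the two factors.
  Finally the alternation of a scalar cocycle is an alternating form on \<open>\<O>\<close>, on which conjugation by \<open>t\<close>,
  that is multiplication by \<open>\<epsilon>\<^sup>2\<close> on \<open>\<O>\<close>, acts by the norm \<open>N(\<epsilon>)\<^sup>2 = 1\<close>; so only the action of \<open>t\<^sup>-\<^sup>1\<close> on the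
  coinvariants is left, which is \<open>\<epsilon>\<close> to the \<open>l\<^sub>1\<close> times \<open>\<epsilon>'\<close> to the \<open>l\<^sub>2\<close>.
\<close>

section \<open>Integers of a real quadratic field\<close>

text \<open>Duality identifies the second cohomology of a free abelian group of rank two with its
  coinvariants. The computation is therefore arranged around one functional,
  \<open>eval_cocycle\<close>: once its kernel on 2-cocycles is known to be exactly the
  coboundaries, dimension and eigenvalue are questions about a single scalar. The corner entry is
  the invariant functional because row 0 of \<open>sym_rep\<close> holds the coefficients of (a + b
  X)^l, which for a lower unipotent matrix is the constant 1. The obstacle is non-vanishing. The
  corner is a quotient of V, not a submodule: a scalar cocycle placed in the corner is in general no
  cocycle with values in V, since U moves that basis vector into the other entries. It has to be
  lifted, and the cup product is an explicit lift of the scalar cocycle x * \<sigma> y. Its value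
  under the functional is \<sigma> \<omega> - \<omega>, the same determinant that makes the
  coinvariants a line. Since the integers are defined by algebraic integrality alone, that they form
  a ring with basis 1, \<omega> needs a proof of its own.\<close>

lemma real_quadratic_field_generator:
  assumes "real_quadratic_field F"
  obtains s :: real and D :: int
  where "s \<notin> \<rat>" "s\<^sup>2 = of_int D" "F = {a + b * s | a b. a \<in> \<rat> \<and> b \<in> \<rat>}"
proof -
  let ?R = "class_ring :: real ring"
  have sf: "subfield F ?R" and dm: "ring.dimension ?R 2 \<rat> F"
    using assms by (auto simp: real_quadratic_field_def)
  have line: "ring.line_extension ?R K v E = {k * v + e | k e. k \<in> K \<and> e \<in> E}" for K E v
    unfolding ring.line_extension_def[OF class_ring.ring_axioms]
    by (auto simp: set_add_def' r_coset_def; blast)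
  have Fmult: "x * y \<in> F" if "x \<in> F" "y \<in> F" for x y
    using subringE(6)[OF subfieldE(1)[OF sf] that] by simp
  have Finv: "inverse x \<in> F" if "x \<in> F" "x \<noteq> 0" for x
    using ring.subfield_m_inv(1)[OF class_ring.ring_axioms sf, of x] that by (simp add: class_ring_simps)
  note dim_cases = ring.dimension.simps[OF class_ring.ring_axioms, THEN iffD1]
  \<comment> \<open>\<open>ring.dimension\<close> is built from line extensions starting at the zero
    space, so dimension 2 is peeled off twice and leaves a basis \<open>u\<close>,
    \<open>v\<close>.\<close>
  have dm2: "ring.dimension ?R (Suc (Suc 0)) \<rat> F" using dm by (simp add: numeral_2_eq_2)
  obtain v E where vE: "ring.dimension ?R (Suc 0) \<rat> E" "v \<notin> E" "F = ring.line_extension ?R \<rat> v E"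
    using dim_cases[OF dm2] by auto
  obtain u E0 where u0: "ring.dimension ?R 0 \<rat> E0" "u \<notin> E0" "E = ring.line_extension ?R \<rat> u E0"
    using dim_cases[OF vE(1)] by auto
  have "E0 = {0}" using dim_cases[OF u0(1)] by auto
  then have u: "u \<noteq> 0" "E = {k * u | k. k \<in> \<rat>}" using u0(2) unfolding u0(3) line by auto
  have F: "F = {a * u + b * v | a b. a \<in> \<rat> \<and> b \<in> \<rat>}"
    
  proof (intro equalityI subsetI)
    fix x assume "x \<in> F"
    then obtain b a where "b \<in> \<rat>" "a \<in> \<rat>" "x = b * v + a * u" unfolding vE(3) u(2) line by auto
    then show "x \<in> {a * u + b * v | a b. a \<in> \<rat> \<and> b \<in> \<rat>}" by (auto simp: add.commute)
  next
    fix x assume "x \<in> {a * u + b * v | a b. a \<in> \<rat> \<and> b \<in> \<rat>}"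
    then obtain a b where "b \<in> \<rat>" "a \<in> \<rat>" "x = b * v + a * u" by (auto simp: add.commute)
    then show "x \<in> F" unfolding vE(3) u(2) line by blast
  qed
  \<comment> \<open>Dividing by \<open>u\<close>, which is possible inside the field, replaces the
    basis \<open>u\<close>, \<open>v\<close> by 1, \<theta>.\<close>
  define \<theta> where "\<theta> = v / u"
  have \<theta>_irr: "\<theta> \<notin> \<rat>"
  proof
    assume "\<theta> \<in> \<rat>"
    moreover have "v = \<theta> * u" using u by (simp add: \<theta>_def)
    ultimately show False using vE(2) u by blast
  qed
  have uF: "u \<in> F" unfolding F by (rule CollectI, rule exI[of _ 1], rule exI[of _ 0]) auto
  have F\<theta>: "F = {a + b * \<theta> | a b. a \<in> \<rat> \<and> b \<in> \<rat>}"
  proof (intro equalityI subsetI)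
    fix x assume "x \<in> F"
    then have "x * u \<in> F" using Fmult uF by blast
    then obtain a b where "a \<in> \<rat>" "b \<in> \<rat>" "x * u = a * u + b * v" unfolding F by blast
    then have "x = a + b * \<theta>" using u by (simp add: \<theta>_def field_simps)
    then show "x \<in> {a + b * \<theta> | a b. a \<in> \<rat> \<and> b \<in> \<rat>}" using \<open>a \<in> \<rat>\<close> \<open>b \<in> \<rat>\<close> by blast
  next
    fix x assume "x \<in> {a + b * \<theta> | a b. a \<in> \<rat> \<and> b \<in> \<rat>}"
    then obtain a b where ab: "a \<in> \<rat>" "b \<in> \<rat>" "x = a + b * \<theta>" by blast
    then have "a * u + b * v \<in> F" unfolding F by blast
    then have "(a * u + b * v) * inverse u \<in> F" using Fmult Finv uF u by blast
    moreover have "x = (a * u + b * v) * inverse u" using u ab by (simp add: \<theta>_def field_simps)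
    ultimately show "x \<in> F" by simp
  qed
  have "\<theta> \<in> F" unfolding F\<theta> by (rule CollectI, rule exI[of _ 0], rule exI[of _ 1]) auto
  then have "\<theta> * \<theta> \<in> F" using Fmult by blast
  then obtain p q where pq: "p \<in> \<rat>" "q \<in> \<rat>" "\<theta> * \<theta> = p + q * \<theta>" unfolding F\<theta> by blast
  \<comment> \<open>Completing the square: \<theta> - q/2 has the rational square m/n, so
    multiplying it by n gives an element with the integral square n * m.\<close>
  have "p + q\<^sup>2 / 4 \<in> \<rat>" using pq by simp
  then obtain m n :: int where mn: "n > 0" "p + q\<^sup>2 / 4 = of_int m / of_int n"
    by (rule Rats_cases') auto
  define s where "s = of_int n * (\<theta> - q / 2)"
  have \<theta>s: "\<theta> = q / 2 + s / of_int n" using mn by (simp add: s_def)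
  have "(\<theta> - q / 2)\<^sup>2 = of_int m / of_int n"
    unfolding mn(2)[symmetric] using pq(3) by (simp add: power2_eq_square algebra_simps)
  then have s2: "s\<^sup>2 = of_int (n * m)"
    using mn(1) unfolding s_def power_mult_distrib by (simp add: power2_eq_square[of "of_int n"])
  have s_irr: "s \<notin> \<rat>"
  proof
    assume "s \<in> \<rat>"
    then have "q / 2 + s / of_int n \<in> \<rat>" using pq by auto
    then show False using \<theta>_irr \<theta>s by simp
  qed
  have Fs: "F = {a + b * s | a b. a \<in> \<rat> \<and> b \<in> \<rat>}"
    unfolding F\<theta>
  proof (intro equalityI subsetI; elim CollectE exE conjE)
    fix x a b assume h: "x = a + b * \<theta>" "a \<in> \<rat>" "b \<in> \<rat>"
    show "x \<in> {a + b * s | a b. a \<in> \<rat> \<and> b \<in> \<rat>}"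
      by (rule CollectI, rule exI[of _ "a + b * q / 2"], rule exI[of _ "b / of_int n"])
         (use h pq mn in \<open>auto simp: \<theta>s field_simps\<close>)
  next
    fix x a b assume h: "x = a + b * s" "a \<in> \<rat>" "b \<in> \<rat>"
    show "x \<in> {a + b * \<theta> | a b. a \<in> \<rat> \<and> b \<in> \<rat>}"
      by (rule CollectI, rule exI[of _ "a - b * of_int n * q / 2"], rule exI[of _ "b * of_int n"])
         (use h pq mn in \<open>auto simp: s_def field_simps\<close>)
  qed
  show thesis using that s_irr s2 Fs by blast
qed

text \<open>Gauss' lemma: by pseudo-division and multiplicativity of contents, the primitive polynomial
  divides the monic one over the integers.\<close>

lemma algebraic_int_quadratic_lead_coeff:
  fixes x :: real and a b c :: int
  assumes x: "algebraic_int x" "x \<notin> \<rat>" and a: "a \<noteq> 0"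
    and root: "of_int a * x\<^sup>2 + of_int b * x + of_int c = 0"
    and prim: "content [:c, b, a:] = 1"
  shows "\<bar>a\<bar> = 1"
proof -
  obtain p :: "int poly" where p: "lead_coeff p = 1" "poly (of_int_poly p) x = 0"
    using x(1) unfolding algebraic_int_altdef_ipoly by auto
  define q where "q = [:c, b, a:]"
  have q: "q \<noteq> 0" "degree q = 2" "lead_coeff q = a" "poly (of_int_poly q) x = 0" "content q = 1"
    using a root prim by (auto simp: q_def power2_eq_square algebra_simps)
  \<comment> \<open>The remainder has degree at most 1 and vanishes at the irrational number x, so
    it is zero.\<close>
  obtain A r s where As: "A \<noteq> 0" "Polynomial.smult A p = q * s + r" "r = 0 \<or> degree r < degree q"
    using pseudo_mod[OF q(1), of p] by blast
  have rx: "poly (of_int_poly r) x = 0"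
    using arg_cong[OF As(2), of "\<lambda>f. poly (of_int_poly f) x"] p(2) q(4)
    by (simp add: hom_distribs)
  have "degree r \<le> 1" using As(3) q(2) by auto
  then have r_eq: "r = [:Polynomial.coeff r 0, Polynomial.coeff r 1:]"
    by (intro poly_eqI) (auto simp: coeff_pCons split: nat.splits intro: coeff_eq_0)
  have lin: "of_int (Polynomial.coeff r 0) + of_int (Polynomial.coeff r 1) * x = 0"
    using rx by (subst (asm) r_eq) (simp add: hom_distribs mult.commute)
  have "Polynomial.coeff r 1 = 0"
  proof (rule ccontr)
    assume n: "Polynomial.coeff r 1 \<noteq> 0"
    then have "x = - of_int (Polynomial.coeff r 0) / of_int (Polynomial.coeff r 1)"
      using lin by (simp add: field_simps)
    then show False using x(2) by auto
  qed
  then have "r = 0" using lin r_eq by simp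
  then have eq: "Polynomial.smult A p = q * s" using As by simp
  have "content p = 1"
    using content_dvd_coeff[of p "degree p"] p(1) by (metis is_unit_content_iff)
  \<comment> \<open>Both \<open>p\<close> (monic) and \<open>q\<close> (primitive) have content 1,
    so all of \<open>A\<close> is absorbed by \<open>s\<close>. Hence \<open>A\<close> divides the
    leading coefficient of \<open>s\<close>, while that coefficient times \<open>a\<close> equals
    \<open>A\<close>; so \<open>a\<close> is a unit.\<close>
  then have cs: "content s = \<bar>A\<bar>"
    using arg_cong[OF eq, of content] q(5) by (simp add: content_mult)
  have "A = a * lead_coeff s"
    using arg_cong[OF eq, of lead_coeff] p(1) q(3) As(1) by (simp add: lead_coeff_mult)
  moreover obtain k where "lead_coeff s = A * k"
    using content_dvd_coeff[of s "degree s"] cs by (auto elim: dvdE)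
  ultimately have "A * (a * k) = A * 1" by (simp add: ac_simps)
  then have "a * k = 1" using As(1) by (metis mult_left_cancel)
  then show ?thesis by (simp add: zmult_eq_1_iff) auto
qed

section \<open>Conjugation, trace and norm on the field generated by a square root\<close>

locale quadratic_field =
  fixes F :: "real set" and s :: real and D :: int
  assumes s_irrational: "s \<notin> \<rat>"
    and s_square: "s\<^sup>2 = of_int D"
    and field_eq: "F = {a + b * s | a b. a \<in> \<rat> \<and> b \<in> \<rat>}"
begin

abbreviation "\<sigma> \<equiv> galois_conj F"
abbreviation "\<O> \<equiv> ring_of_integers F"

lemma s_mult_s: "s * s = of_int D"
  using s_square by (simp add: power2_eq_square)

lemma field_cases:
  assumes "x \<in> F"
  obtains a b where "a \<in> \<rat>" "b \<in> \<rat>" "x = a + b * s"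
  using assms unfolding field_eq by blast

lemma field_memI: "a \<in> \<rat> \<Longrightarrow> b \<in> \<rat> \<Longrightarrow> a + b * s \<in> F"
  unfolding field_eq by blast

lemma rat_lin_eq_0:
  fixes a b x :: real
  assumes "a \<in> \<rat>" "b \<in> \<rat>" "x \<notin> \<rat>" "a + b * x = 0"
  shows "a = 0 \<and> b = 0"
proof -
  have "b = 0"
  proof (rule ccontr)
    assume "b \<noteq> 0"
    moreover have "b * x = - a" using assms(4) by linarith
    ultimately have "x = - a / b" by (metis nonzero_mult_div_cancel_left)
    moreover have "- a / b \<in> \<rat>" using assms by simp
    ultimately show False using assms by simp
  qed
  then show ?thesis using assms by simp
qed

lemma coords_unique:
  assumes "a \<in> \<rat>" "b \<in> \<rat>" "c \<in> \<rat>" "d \<in> \<rat>" "a + b * s = c + d * s"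
  shows "a = c \<and> b = d"
  using rat_lin_eq_0[of "a - c" "b - d" s] assms s_irrational by (simp add: algebra_simps)

lemma field_add: "x \<in> F \<Longrightarrow> y \<in> F \<Longrightarrow> x + y \<in> F"
proof (elim field_cases)
  fix a b c d assume "a \<in> \<rat>" "b \<in> \<rat>" "x = a + b * s" "c \<in> \<rat>" "d \<in> \<rat>" "y = c + d * s"
  then show ?thesis using field_memI[of "a + c" "b + d"] by (simp add: algebra_simps)
qed

lemma field_mult: "x \<in> F \<Longrightarrow> y \<in> F \<Longrightarrow> x * y \<in> F"
proof (elim field_cases)
  fix a b c d assume "a \<in> \<rat>" "b \<in> \<rat>" "x = a + b * s" "c \<in> \<rat>" "d \<in> \<rat>" "y = c + d * s"
  then show ?thesis using field_memI[of "a * c + b * d * of_int D" "a * d + b * c"]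
    by (simp add: algebra_simps s_mult_s)
qed

lemma Rats_in_field: "q \<in> \<rat> \<Longrightarrow> q \<in> F"
  using field_memI[of q 0] by simp

lemma s_in_field: "s \<in> F"
  using field_memI[of 0 1] by simp

text \<open>Serves the uniqueness half of the definite description in \<open>galois_conj\<close>: an
  automorphism that fixes the rationals is determined by its value at \<open>s\<close>.\<close>

lemma automorphism_fixes_Rats:
  assumes add: "\<And>x y. x \<in> F \<Longrightarrow> y \<in> F \<Longrightarrow> \<tau> (x + y) = \<tau> x + \<tau> y"
    and mult: "\<And>x y. x \<in> F \<Longrightarrow> y \<in> F \<Longrightarrow> \<tau> (x * y) = \<tau> x * \<tau> y"
    and one: "\<tau> 1 = (1::real)"
    and q: "q \<in> \<rat>"
  shows "\<tau> q = q"
proof -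
  have zero: "\<tau> 0 = 0" using add[of 0 0] Rats_in_field[of 0] by simp
  have nat: "\<tau> (of_nat n) = of_nat n" for n
    by (induction n) (auto simp: zero one add Rats_in_field)
  have int: "\<tau> (of_int m) = of_int m" for m
  proof (cases m)
    case (neg n)
    have "\<tau> (of_int m + of_nat (Suc n)) = \<tau> (of_int m) + of_nat (Suc n)"
      by (subst add) (auto simp: Rats_in_field nat simp del: of_nat_Suc)
    moreover have "of_int m + of_nat (Suc n) = (0::real)" using neg by simp
    ultimately show ?thesis using zero by simp
  qed (simp add: nat)
  from q obtain m n :: int where mn: "n > 0" "q = of_int m / of_int n"
    by (rule Rats_cases') auto
  then have "q * of_int n = of_int m" by simp
  then have "\<tau> q * of_int n = of_int m"
    using mult[of q "of_int n"] q by (simp add: Rats_in_field int)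
  then show ?thesis using mn \<open>q * of_int n = of_int m\<close>
    by (metis mult_cancel_right of_int_eq_0_iff less_irrefl)
qed

text \<open>A definite description has a usable value only if exactly one object fits. Existence is
  checked on the map a + b s to a - b s. For uniqueness, the image of \<open>s\<close> has the same
  square as \<open>s\<close>, and the image \<open>s\<close> itself would give the identity.\<close>

lemma galois_conj_eq:
  assumes "a \<in> \<rat>" "b \<in> \<rat>"
  shows "\<sigma> (a + b * s) = a - b * s"
proof -
  \<comment> \<open>By \<open>coords_unique\<close> the inner description has exactly one solution;
    restricting \<open>c\<close> to \<open>F\<close> provides the membership in
    \<open>extensional F\<close> that \<open>galois_conj\<close> asks for.\<close>
  define c where "c = (\<lambda>x\<in>F. THE y. \<exists>a\<in>\<rat>. \<exists>b\<in>\<rat>. x = a + b * s \<and> y = a - b * s)"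
  have c: "c (a + b * s) = a - b * s" if "a \<in> \<rat>" "b \<in> \<rat>" for a b
  proof -
    have "(THE y. \<exists>a'\<in>\<rat>. \<exists>b'\<in>\<rat>. a + b * s = a' + b' * s \<and> y = a' - b' * s) = a - b * s"
    proof (rule the_equality)
      show "\<exists>a'\<in>\<rat>. \<exists>b'\<in>\<rat>. a + b * s = a' + b' * s \<and> a - b * s = a' - b' * s"
        using that by blast
      fix y assume "\<exists>a'\<in>\<rat>. \<exists>b'\<in>\<rat>. a + b * s = a' + b' * s \<and> y = a' - b' * s"
      then show "y = a - b * s" using coords_unique[OF that] by auto
    qed
    then show ?thesis using that field_memI by (simp add: c_def)
  qed
  let ?R = "class_ring\<lparr>carrier := F\<rparr> :: real ring"
  have cF: "c x \<in> F" if "x \<in> F" for x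
    using that
  proof (rule field_cases)
    fix a b assume "a \<in> \<rat>" "b \<in> \<rat>" "x = a + b * s"
    then show ?thesis using field_memI[of a "-b"] c by simp
  qed
  have cc: "c (c x) = x" if "x \<in> F" for x
    using that
  proof (rule field_cases)
    fix a b assume "a \<in> \<rat>" "b \<in> \<rat>" "x = a + b * s"
    then show ?thesis using c[of a b] c[of a "-b"] by simp
  qed
  have c1: "c 1 = 1" using c[of 1 0] by simp
  have cadd: "c (x + y) = c x + c y" if "x \<in> F" "y \<in> F" for x y
    using that
  proof (elim field_cases)
    fix a b a' b' assume h: "a \<in> \<rat>" "b \<in> \<rat>" "x = a + b * s" "a' \<in> \<rat>" "b' \<in> \<rat>" "y = a' + b' * s"
    then show ?thesis using c[of "a + a'" "b + b'"] c[of a b] c[of a' b'] by (simp add: algebra_simps)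
  qed
  have cmult: "c (x * y) = c x * c y" if "x \<in> F" "y \<in> F" for x y
    using that
  proof (elim field_cases)
    fix a b a' b' assume h: "a \<in> \<rat>" "b \<in> \<rat>" "x = a + b * s" "a' \<in> \<rat>" "b' \<in> \<rat>" "y = a' + b' * s"
    have "x * y = (a * a' + b * b' * of_int D) + (a * b' + b * a') * s"
      using h by (simp add: algebra_simps s_mult_s)
    then have "c (x * y) = (a * a' + b * b' * of_int D) - (a * b' + b * a') * s"
      using h by (simp only:) (rule c, auto)
    moreover have "c x = a - b * s" "c y = a' - b' * s" using h c by simp_all
    ultimately show ?thesis by (simp only:) (simp add: algebra_simps s_mult_s)
  qed
  have "bij_betw c F F"
    by (rule bij_betw_byWitness[of F c c F]) (auto simp: cc cF)
  then have iso: "c \<in> ring_iso ?R ?R"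
    by (auto simp: ring_iso_def Ring.ring_hom_def cF cadd cmult c1)
  have "s \<noteq> 0" using s_irrational by auto
  then have "c s \<noteq> s" using c[of 0 1] by simp
  then have nontriv: "\<exists>x\<in>F. c x \<noteq> x" using s_in_field by blast
  have "\<sigma> = c"
    unfolding galois_conj_def
  proof (rule the_equality)
    show "c \<in> extensional F \<and> c \<in> ring_iso ?R ?R \<and> (\<exists>x\<in>F. c x \<noteq> x)"
      using iso nontriv by (auto simp: c_def)
  next
    fix \<tau> assume \<tau>: "\<tau> \<in> extensional F \<and> \<tau> \<in> ring_iso ?R ?R \<and> (\<exists>x\<in>F. \<tau> x \<noteq> x)"
    then have add: "\<And>x y. x \<in> F \<Longrightarrow> y \<in> F \<Longrightarrow> \<tau> (x + y) = \<tau> x + \<tau> y"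
      and mult: "\<And>x y. x \<in> F \<Longrightarrow> y \<in> F \<Longrightarrow> \<tau> (x * y) = \<tau> x * \<tau> y" and one: "\<tau> 1 = 1"
      by (auto simp: ring_iso_def Ring.ring_hom_def)
    note rat = automorphism_fixes_Rats[OF add mult one]
    have lin: "\<tau> (a + b * s) = a + b * \<tau> s" if "a \<in> \<rat>" "b \<in> \<rat>" for a b
      using that by (simp add: add mult rat Rats_in_field s_in_field field_mult)
    have "\<tau> s * \<tau> s = s * s"
      using mult[OF s_in_field s_in_field] rat[of "of_int D"] by (simp add: s_mult_s)
    then have "\<tau> s = s \<or> \<tau> s = - s"
      by (simp add: square_eq_iff)
    moreover have "\<tau> s \<noteq> s"
    proof
      assume ts: "\<tau> s = s"
      have "\<tau> x = x" if "x \<in> F" for x using that by (rule field_cases) (simp add: lin ts)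
      then show False using \<tau> by blast
    qed
    ultimately have ts: "\<tau> s = - s" by blast
    show "\<tau> = c"
    proof (rule extensionalityI[of _ F])
      fix x assume "x \<in> F"
      then show "\<tau> x = c x"
        by (rule field_cases) (simp add: lin c ts)
    qed (use \<tau> in \<open>auto simp: c_def\<close>)
  qed
  then show ?thesis using c assms by simp
qed

lemma conj_closed: "x \<in> F \<Longrightarrow> \<sigma> x \<in> F"
proof (erule field_cases)
  fix a b assume "a \<in> \<rat>" "b \<in> \<rat>" "x = a + b * s"
  then show ?thesis using field_memI[of a "-b"] by (simp add: galois_conj_eq)
qed

lemma conj_rat: "q \<in> \<rat> \<Longrightarrow> \<sigma> q = q"
  using galois_conj_eq[of q 0] by simp

lemma conj_fixed_iff: "x \<in> F \<Longrightarrow> \<sigma> x = x \<longleftrightarrow> x \<in> \<rat>"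
proof (erule field_cases)
  fix a b assume h: "a \<in> \<rat>" "b \<in> \<rat>" "x = a + b * s"
  have "s \<noteq> 0" using s_irrational by auto
  then have "\<sigma> x = x \<longleftrightarrow> b = 0" using h by (auto simp: galois_conj_eq)
  moreover have "b = 0" if "x \<in> \<rat>"
  proof -
    have "a + b * s = x + 0 * s" using h by simp
    from coords_unique[OF h(1,2) that Rats_0 this] show ?thesis by blast
  qed
  moreover have "x \<in> \<rat>" if "b = 0" unfolding h(3) that using h(1) by simp
  ultimately show ?thesis by blast
qed

lemma conj_add:
  assumes "x \<in> F" "y \<in> F" shows "\<sigma> (x + y) = \<sigma> x + \<sigma> y"
proof -
  obtain a b where h1: "a \<in> \<rat>" "b \<in> \<rat>" "x = a + b * s" using assms(1) by (rule field_cases)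
  obtain c d where "c \<in> \<rat>" "d \<in> \<rat>" "y = c + d * s" using assms(2) by (rule field_cases)
  note h = h1 this
  then show ?thesis
    using galois_conj_eq[of "a + c" "b + d"] galois_conj_eq[of a b] galois_conj_eq[of c d]
    by (simp add: algebra_simps)
qed

lemma conj_mult:
  assumes "x \<in> F" "y \<in> F" shows "\<sigma> (x * y) = \<sigma> x * \<sigma> y"
proof -
  obtain a b where h1: "a \<in> \<rat>" "b \<in> \<rat>" "x = a + b * s" using assms(1) by (rule field_cases)
  obtain c d where "c \<in> \<rat>" "d \<in> \<rat>" "y = c + d * s" using assms(2) by (rule field_cases)
  note h = h1 this
  have "x * y = (a * c + b * d * of_int D) + (a * d + b * c) * s"
    using h by (simp add: algebra_simps s_mult_s)
  then have "\<sigma> (x * y) = (a * c + b * d * of_int D) - (a * d + b * c) * s"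
    using h by (simp only:) (rule galois_conj_eq, auto)
  moreover have "\<sigma> x = a - b * s" "\<sigma> y = c - d * s" using h galois_conj_eq by simp_all
  ultimately show ?thesis by (simp only:) (simp add: algebra_simps s_mult_s)
qed

lemma conj_conj:
  assumes "x \<in> F" shows "\<sigma> (\<sigma> x) = x"
proof -
  obtain a b where h: "a \<in> \<rat>" "b \<in> \<rat>" "x = a + b * s"
    using assms by (rule field_cases)
  then show ?thesis
    using galois_conj_eq[of a b] galois_conj_eq[of a "-b"] by simp
qed

lemma conj_minus:
  assumes "x \<in> F" shows "\<sigma> (- x) = - \<sigma> x"
  using conj_mult[of "-1" x] conj_rat[of "-1"] Rats_in_field[of "-1"] assms by simp

lemma quadratic_algebraic_int:
  fixes c :: real
  assumes "A \<in> \<int>" "B \<in> \<int>" "c * c - A * c + B = 0"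
  shows "algebraic_int c"
  by (rule algebraic_int.intros[of "[:B, - A, 1:]"])
    (use assms in \<open>auto simp: coeff_pCons algebra_simps split: nat.splits\<close>)

lemma rational_quadratic_integer:
  fixes c :: real
  assumes "c \<in> \<rat>" "A \<in> \<int>" "B \<in> \<int>" "c * c - A * c + B = 0"
  shows "c \<in> \<int>"
  using assms quadratic_algebraic_int rational_algebraic_int_is_int by blast

text \<open>From right to left, x is a root of X^2 - T X + N with trace T and norm N. In the other
  direction, T and N are fixed by conjugation, hence rational; a primitive integral multiple of this
  polynomial has leading coefficient 1 or -1 by Gauss' lemma, which makes T and N integral.\<close>

lemma algebraic_int_iff:
  assumes x: "x \<in> F"
  shows "algebraic_int x \<longleftrightarrow> x + \<sigma> x \<in> \<int> \<and> x * \<sigma> x \<in> \<int>"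
proof
  assume "x + \<sigma> x \<in> \<int> \<and> x * \<sigma> x \<in> \<int>"
  then show "algebraic_int x"
    by (intro quadratic_algebraic_int[of "x + \<sigma> x" "x * \<sigma> x"]) (auto simp: algebra_simps)
next
  assume ai: "algebraic_int x"
  show "x + \<sigma> x \<in> \<int> \<and> x * \<sigma> x \<in> \<int>"
  proof (cases "x \<in> \<rat>")
    case True
    then have "x \<in> \<int>" using ai by (intro rational_algebraic_int_is_int)
    then show ?thesis using True by (simp add: conj_rat)
  next
    case False
    define T N where "T = x + \<sigma> x" and "N = x * \<sigma> x"
    have "\<sigma> T = T" "\<sigma> N = N" "T \<in> F" "N \<in> F"
      using x by (auto simp: T_def N_def conj_add conj_mult conj_conj conj_closed field_add field_mult)
    then have TN: "T \<in> \<rat>" "N \<in> \<rat>" by (simp_all add: conj_fixed_iff)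
    obtain t1 t2 :: int where t: "t2 > 0" "T = of_int t1 / of_int t2"
      using TN(1) by (rule Rats_cases') auto
    obtain n1 n2 :: int where "n2 > 0" "N = of_int n1 / of_int n2"
      using TN(2) by (rule Rats_cases') auto
    note tn = t this
    have x2: "x * x = T * x - N" by (simp add: T_def N_def algebra_simps)
    \<comment> \<open>This is \<open>t2 * n2\<close> times X^2 - T X + N, with denominators
      cleared.\<close>
    define q where "q = [:n1 * t2, - (t1 * n2), t2 * n2:]"
    define p where "p = primitive_part q"
    have q0: "q \<noteq> 0" "degree q = 2" using tn by (auto simp: q_def)
    then have p: "degree p = 2" "content p = 1" "q = Polynomial.smult (content q) p"
      by (auto simp: p_def)
    define a b c where "a = Polynomial.coeff p 2" and "b = Polynomial.coeff p 1" and "c = Polynomial.coeff p 0"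
    have p_eq: "p = [:c, b, a:]"
    proof (rule poly_eqI)
      fix n show "Polynomial.coeff p n = Polynomial.coeff [:c, b, a:] n"
        using p(1) by (cases "n \<le> 2")
          (auto simp: a_def b_def c_def coeff_pCons numeral_2_eq_2 le_Suc_eq coeff_eq_0 split: nat.splits)
    qed
    have a0: "a \<noteq> 0" 
    proof -
      have "p \<noteq> 0" using p(1) by auto
      then show ?thesis using leading_coeff_0_iff[of p] unfolding a_def p(1) by simp
    qed
    have cq: "content q * c = n1 * t2" "content q * b = - (t1 * n2)" "content q * a = t2 * n2"
      using arg_cong[OF p(3), of "\<lambda>f. Polynomial.coeff f 0"] arg_cong[OF p(3), of "\<lambda>f. Polynomial.coeff f 1"]
        arg_cong[OF p(3), of "\<lambda>f. Polynomial.coeff f 2"]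
      by (simp_all add: q_def a_def b_def c_def numeral_2_eq_2)
    define K where "K = real_of_int (content q)"
    have K0: "K \<noteq> 0" using q0 by (simp add: K_def)
    have Kc: "K * of_int c = of_int n1 * of_int t2" "K * of_int b = - (of_int t1 * of_int n2)"
      "K * of_int a = of_int t2 * of_int n2"
      using cq[THEN arg_cong[of _ _ real_of_int]] by (simp_all add: K_def)
    have "K * (of_int a * T) = of_int t1 * of_int n2" "K * (of_int a * N) = of_int n1 * of_int t2"
      unfolding mult.assoc[symmetric] Kc tn(2,4) using tn(1,3) by simp_all
    then have "K * of_int b = K * - (of_int a * T)" "K * of_int c = K * (of_int a * N)"
      by (simp_all only: Kc mult_minus_right)
    then have eqs: "of_int b = - (of_int a * T)" "of_int c = of_int a * N"
      using K0 mult_left_cancel by blast+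
    have "of_int a * x\<^sup>2 + of_int b * x + of_int c = 0"
      using arg_cong[OF x2, of "\<lambda>y. of_int a * y"] by (simp add: eqs power2_eq_square algebra_simps)
    then have "\<bar>a\<bar> = 1"
      using algebraic_int_quadratic_lead_coeff[OF ai False a0] p(2) p_eq by simp
    \<comment> \<open>As \<open>a\<close> is 1 or -1, it is its own inverse, which solves the two
      equations for T and N.\<close>
    then have "T = of_int (- a * b)" "N = of_int (a * c)"
      using eqs by (auto simp: abs_if split: if_splits)
    then show ?thesis unfolding T_def[symmetric] N_def[symmetric] by (metis Ints_of_int)
  qed
qed

lemma integers_iff: "x \<in> \<O> \<longleftrightarrow> x \<in> F \<and> x + \<sigma> x \<in> \<int> \<and> x * \<sigma> x \<in> \<int>"
  unfolding ring_of_integers_def using algebraic_int_iff by blast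

lemma integers_subset_field: "x \<in> \<O> \<Longrightarrow> x \<in> F"
  by (simp add: integers_iff)

text \<open>This quantity is the defect of the norm under addition and of the trace under
  multiplication, so closure of the integers under both operations rests on it. It is the trace c of
  x * \<sigma> y. Together with the trace d of x * y it has integral sum and product, so c is a
  rational root of a monic integral quadratic.\<close>

lemma mixed_trace_integer:
  assumes "x \<in> \<O>" "y \<in> \<O>"
  shows "x * \<sigma> y + \<sigma> x * y \<in> \<int>"
proof -
  define c d where "c = x * \<sigma> y + \<sigma> x * y" and "d = x * y + \<sigma> x * \<sigma> y"
  have xy: "x \<in> F" "y \<in> F" "x + \<sigma> x \<in> \<int>" "x * \<sigma> x \<in> \<int>" "y + \<sigma> y \<in> \<int>" "y * \<sigma> y \<in> \<int>"
    using assms by (auto simp: integers_iff)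
  have "c \<in> F" "\<sigma> c = c"
    using xy by (auto simp: c_def conj_add conj_mult conj_conj conj_closed field_add field_mult)
  then have cr: "c \<in> \<rat>" by (simp add: conj_fixed_iff)
  have "c + d = (x + \<sigma> x) * (y + \<sigma> y)" by (simp add: c_def d_def algebra_simps)
  then have cd: "c + d \<in> \<int>" by (simp only: Ints_mult xy)
  have "c * d = y * \<sigma> y * ((x + \<sigma> x)\<^sup>2 - 2 * (x * \<sigma> x)) + x * \<sigma> x * ((y + \<sigma> y)\<^sup>2 - 2 * (y * \<sigma> y))"
    by (simp add: c_def d_def algebra_simps power2_eq_square)
  moreover have "\<dots> \<in> \<int>" by (intro Ints_add Ints_mult Ints_diff Ints_power xy) simp_all
  ultimately have cd': "c * d \<in> \<int>" by (simp only:)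
  have "c \<in> \<int>"
    by (rule rational_quadratic_integer[OF cr cd cd']) (simp add: algebra_simps)
  then show ?thesis by (simp add: c_def)
qed

lemma integers_add:
  assumes x: "x \<in> \<O>" and y: "y \<in> \<O>"
  shows "x + y \<in> \<O>"
proof -
  have F: "x \<in> F" "y \<in> F" and T: "x + \<sigma> x \<in> \<int>" "y + \<sigma> y \<in> \<int>" and N: "x * \<sigma> x \<in> \<int>" "y * \<sigma> y \<in> \<int>"
    using x y by (simp_all add: integers_iff)
  have eqs: "x + y + \<sigma> (x + y) = (x + \<sigma> x) + (y + \<sigma> y)"
    "(x + y) * \<sigma> (x + y) = x * \<sigma> x + y * \<sigma> y + (x * \<sigma> y + \<sigma> x * y)"
    using F by (simp_all add: conj_add algebra_simps)
  show ?thesis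
    unfolding integers_iff eqs by (intro conjI Ints_add T N mixed_trace_integer x y field_add F)
qed

lemma integers_mult:
  assumes x: "x \<in> \<O>" and y: "y \<in> \<O>"
  shows "x * y \<in> \<O>"
proof -
  have F: "x \<in> F" "y \<in> F" and T: "x + \<sigma> x \<in> \<int>" "y + \<sigma> y \<in> \<int>" and N: "x * \<sigma> x \<in> \<int>" "y * \<sigma> y \<in> \<int>"
    using x y by (simp_all add: integers_iff)
  have eqs: "x * y + \<sigma> (x * y) = (x + \<sigma> x) * (y + \<sigma> y) - (x * \<sigma> y + \<sigma> x * y)"
    "x * y * \<sigma> (x * y) = (x * \<sigma> x) * (y * \<sigma> y)"
    using F by (simp_all add: conj_mult algebra_simps)
  show ?thesis
    unfolding integers_iff eqs
    by (intro conjI Ints_diff Ints_mult T N mixed_trace_integer x y field_mult F)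
qed

lemma Ints_in_integers: "x \<in> \<int> \<Longrightarrow> x \<in> \<O>"
  unfolding ring_of_integers_def by (auto intro: Rats_in_field int_imp_algebraic_int elim!: Ints_cases)

lemma integers_minus: "x \<in> \<O> \<Longrightarrow> - x \<in> \<O>"
  using integers_mult[of "-1" x] Ints_in_integers[of "-1"] by simp

lemma integers_rat:
  assumes "x \<in> \<O>" "\<sigma> x = x"
  shows "x \<in> \<int>"
proof (rule rational_algebraic_int_is_int)
  show "algebraic_int x" using assms(1) unfolding ring_of_integers_def by blast
  show "x \<in> \<rat>" using conj_fixed_iff[OF integers_subset_field[OF assms(1)]] assms(2) by blast
qed

text \<open>The map x to D (x - \<sigma> x) / s is additive from the integers of F to \<int>, and
  its kernel is \<int>. An element \<omega> with the least positive value generates the rest by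
  division with remainder. This works for any integer D with square root s, squarefree or not, and
  for any residue of D modulo 4.\<close>

lemma integral_basis:
  obtains \<omega> where "\<omega> \<in> \<O>" "\<sigma> \<omega> \<noteq> \<omega>" "\<And>x. x \<in> \<O> \<Longrightarrow> \<exists>m n :: int. x = of_int m + of_int n * \<omega>"
proof -
  have s0: "s \<noteq> 0" using s_irrational by auto
  then have "of_int D > (0::real)" using s_square by (metis zero_less_power2)
  then have D0: "D > 0" by simp
  define P where "P = (\<lambda>x (k::int). x \<in> \<O> \<and> of_int D * (x - \<sigma> x) = of_int k * s)"
  have ex_k: "\<exists>k. P x k" if "x \<in> \<O>" for x
  proof -
    have xF: "x \<in> F" and TN: "x + \<sigma> x \<in> \<int>" "x * \<sigma> x \<in> \<int>" using that by (auto simp: integers_iff)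
    obtain a b where ab: "a \<in> \<rat>" "b \<in> \<rat>" "x = a + b * s" using xF by (rule field_cases)
    then have \<sigma>x: "\<sigma> x = a - b * s" by (simp add: galois_conj_eq)
    \<comment> \<open>This is the value of the map at x. Its square is D times the discriminant of
      x, so it is a rational number with an integral square.\<close>
    define z where "z = 2 * b * of_int D"
    have zz: "z * z = of_int D * ((x + \<sigma> x)\<^sup>2 - 4 * (x * \<sigma> x))"
    proof -
      have "(x + \<sigma> x)\<^sup>2 - 4 * (x * \<sigma> x) = 4 * b * b * (s * s)"
        unfolding \<sigma>x unfolding ab(3) by (simp add: power2_eq_square algebra_simps)
      then show ?thesis by (simp add: z_def s_mult_s algebra_simps)
    qed
    have "z \<in> \<int>"
    proof (rule rational_quadratic_integer[of z 0 "- (of_int D * ((x + \<sigma> x)\<^sup>2 - 4 * (x * \<sigma> x)))"])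
      show "z \<in> \<rat>" using ab by (simp add: z_def)
      show "- (of_int D * ((x + \<sigma> x)\<^sup>2 - 4 * (x * \<sigma> x))) \<in> \<int>"
        by (intro Ints_minus Ints_mult Ints_diff Ints_power TN) simp_all
    qed (simp_all add: zz)
    then obtain k where "z = of_int k" by (rule Ints_cases)
    moreover have "of_int D * (x - \<sigma> x) = z * s"
      unfolding \<sigma>x unfolding ab(3) by (simp add: z_def algebra_simps)
    ultimately have "P x k" using that by (simp add: P_def)
    then show ?thesis by blast
  qed
  have sO: "s \<in> \<O>"
    using s_in_field galois_conj_eq[of 0 1] by (simp add: integers_iff s_mult_s)
  \<comment> \<open>The element \<open>s\<close> itself supplies a positive value, so a least one
    exists.\<close>
  have "P s (2 * D)" using sO galois_conj_eq[of 0 1] by (simp add: P_def algebra_simps)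
  then have ex: "\<exists>n::nat. n > 0 \<and> (\<exists>x. P x (int n))"
    using D0 by (intro exI[of _ "nat (2 * D)"]) auto
  define g where "g = (LEAST n::nat. n > 0 \<and> (\<exists>x. P x (int n)))"
  have g: "g > 0" "\<exists>x. P x (int g)" using LeastI_ex[OF ex] by (auto simp: g_def)
  then obtain \<omega> where \<omega>: "P \<omega> (int g)" by blast
  have \<omega>O: "\<omega> \<in> \<O>" using \<omega> by (simp add: P_def)
  have least: "g \<le> n" if "n > 0" "P x (int n)" for n x
    unfolding g_def by (rule Least_le) (use that in blast)
  show thesis
  proof (rule that)
    show "\<omega> \<in> \<O>" by (fact \<omega>O)
    show "\<sigma> \<omega> \<noteq> \<omega>" using \<omega> g s0 by (auto simp: P_def)
    fix x assume x: "x \<in> \<O>"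
    then obtain k where k: "P x k" using ex_k by blast
    define n where "n = k div int g"
    \<comment> \<open>Removing the multiple of \<omega> leaves an integer of the field whose value
      is the remainder \<open>k mod int g\<close>; minimality of \<open>g\<close> forces it to be
      0.\<close>
    define y where "y = x + of_int (- n) * \<omega>"
    have yO: "y \<in> \<O>" unfolding y_def by (intro integers_add integers_mult x \<omega>O Ints_in_integers) simp
    have \<sigma>y: "\<sigma> y = \<sigma> x - of_int n * \<sigma> \<omega>"
      unfolding y_def using x \<omega>O
      by (subst conj_add) (auto simp: conj_mult conj_rat conj_minus Rats_in_field field_mult integers_subset_field
          simp flip: of_int_minus)
    have "of_int D * (y - \<sigma> y) = of_int D * (x - \<sigma> x) - of_int n * (of_int D * (\<omega> - \<sigma> \<omega>))"
      unfolding \<sigma>y unfolding y_def by (simp add: algebra_simps)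
    also have "\<dots> = of_int (k - n * int g) * s"
      using k \<omega> by (simp add: P_def algebra_simps)
    also have "k - n * int g = k mod int g" by (simp add: n_def minus_div_mult_eq_mod)
    finally have Py: "P y (k mod int g)" using yO by (simp add: P_def)
    have r: "0 \<le> k mod int g" "k mod int g < int g" using g by auto
    have "k mod int g = 0"
    proof (rule ccontr)
      assume "k mod int g \<noteq> 0"
      then have "g \<le> nat (k mod int g)" using r Py by (intro least[of _ y]) auto
      then show False using r by linarith
    qed
    then have "\<sigma> y = y" using Py D0 by (simp add: P_def)
    then have "y \<in> \<int>" using yO integers_rat by blast
    then obtain m where "y = of_int m" by (rule Ints_cases)
    then show "\<exists>m n :: int. x = of_int m + of_int n * \<omega>"
      by (intro exI[of _ m] exI[of _ n]) (simp add: y_def algebra_simps)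
  qed
qed

end

lemma real_quadratic_field_imp_quadratic_field:
  assumes "real_quadratic_field F"
  obtains s D where "quadratic_field F s D"
  by (rule real_quadratic_field_generator[OF assms]) (auto simp: quadratic_field_def intro!: that)

section \<open>Unipotent action on the tensor product\<close>

text \<open>The exponential of u times the nilpotent matrix with entries i at position (i, i - 1).
  Row i lists the coefficients of (u + X)^i, so apart from its size the matrix does not depend on
  l.\<close>

definition unip :: "nat \<Rightarrow> complex \<Rightarrow> complex mat" where
  "unip l u = mat (l + 1) (l + 1) (\<lambda>(i, j). of_nat (i choose j) * u ^ (i - j))"

lemma unip_carrier [simp]: "unip l u \<in> carrier_mat (l + 1) (l + 1)" "unip l u \<in> carrier_mat (Suc l) (Suc l)"
  by (simp_all add: unip_def)

lemma unip_index: "i \<le> l \<Longrightarrow> j \<le> l \<Longrightarrow> unip l u $$ (i, j) = of_nat (i choose j) * u ^ (i - j)"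
  by (simp add: unip_def)

lemma mat2_index [simp]:
  "mat2 a b c d $$ (0, 0) = a" "mat2 a b c d $$ (0, 1) = b"
  "mat2 a b c d $$ (1, 0) = c" "mat2 a b c d $$ (1, 1) = d"
  "mat2 a b c d $$ (0, Suc 0) = b" "mat2 a b c d $$ (Suc 0, 0) = c" "mat2 a b c d $$ (Suc 0, Suc 0) = d"
  by (simp_all add: mat2_def mat_of_rows_list_def)

lemma mat2_carrier [simp]: "mat2 a b c d \<in> carrier_mat 2 2"
  by (simp add: mat2_def mat_of_rows_list_def numeral_2_eq_2)

lemma sym_rep_carrier [simp]:
  "sym_rep l g \<in> carrier_mat (l + 1) (l + 1)" "sym_rep l g \<in> carrier_mat (Suc l) (Suc l)"
  by (simp_all add: sym_rep_def)

lemma sym_rep_lower_unipotent: "sym_rep l (mat2 1 0 u 1) = unip l u"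
proof (rule eq_matI)
  fix i j assume "i < dim_row (unip l u)" "j < dim_col (unip l u)"
  then have ij: "i \<le> l" "j \<le> l" by (auto simp: unip_def)
  have "[:1, 0::complex:] ^ (l - i) = 1" by (simp flip: one_pCons)
  moreover have "Polynomial.coeff ([:u, 1:] ^ i) j = of_nat (i choose j) * u ^ (i - j)"
    using degree_linear_power[of u i]
    by (cases "j \<le> i") (simp_all add: coeff_linear_poly_power coeff_eq_0 binomial_eq_0)
  ultimately have "Polynomial.coeff ([:1, 0:] ^ (l - i) * [:u, 1:] ^ i) j = of_nat (i choose j) * u ^ (i - j)"
    by simp
  then show "sym_rep l (mat2 1 0 u 1) $$ (i, j) = unip l u $$ (i, j)"
    using ij by (simp add: sym_rep_def unip_def del: One_nat_def)
qed (simp_all add: sym_rep_def unip_def)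

lemma sym_rep_diagonal:
  assumes "i \<le> l" "j \<le> l"
  shows "sym_rep l (mat2 a 0 0 d) $$ (i, j) = (if i = j then a ^ (l - i) * d ^ i else 0)"
proof -
  have "[:0, d:] = Polynomial.monom d 1" by (simp add: Polynomial.monom_altdef)
  then have "[:a, 0:] ^ (l - i) * [:0, d:] ^ i = Polynomial.monom (a ^ (l - i) * d ^ i) i"
    by (simp add: Polynomial.monom_power mult_monom flip: Polynomial.monom_0)
  then show ?thesis using assms by (simp add: sym_rep_def)
qed

text \<open>The entries are homogeneous of degree l in the entries of g. Both representatives of a
  projective class act alike on the tensor product once the two signs cancel.\<close>

lemma sym_rep_uminus:
  assumes "g \<in> carrier_mat 2 2"
  shows "sym_rep l (- g) = (- 1) ^ l \<cdot>\<^sub>m sym_rep l g"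
proof (rule eq_matI)
  fix i j assume "i < dim_row ((- 1) ^ l \<cdot>\<^sub>m sym_rep l g)" "j < dim_col ((- 1) ^ l \<cdot>\<^sub>m sym_rep l g)"
  then have ij: "i \<le> l" "j \<le> l" by (auto simp: sym_rep_def)
  have neg: "[:- a, - b:] ^ n = Polynomial.smult ((- 1) ^ n) ([:a, b:] ^ n)" for a b :: complex and n
  proof -
    have "[:- a, - b:] = Polynomial.smult (- 1) [:a, b:]" by simp
    then show ?thesis by (simp only: smult_power)
  qed
  have "(- 1 :: complex) ^ i * (- 1) ^ (l - i) = (- 1) ^ l"
    using ij by (simp flip: power_add)
  moreover have "(- g) $$ (a, b) = - g $$ (a, b)" if "a < 2" "b < 2" for a b
    using assms that by simp
  ultimately show "sym_rep l (- g) $$ (i, j) = ((- 1) ^ l \<cdot>\<^sub>m sym_rep l g) $$ (i, j)"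
    using ij by (simp add: sym_rep_def neg mult.assoc[symmetric])
qed (simp_all add: sym_rep_def)

text \<open>The binomial theorem: since (i choose k) (k choose j) = (i choose j) (i - j choose k -
  j), the sum over k is the expansion of (u + v)^(i - j).\<close>

lemma unip_mult: "unip l u * unip l v = unip l (u + v)"
proof (rule eq_matI)
  fix i j assume "i < dim_row (unip l (u + v))" "j < dim_col (unip l (u + v))"
  then have ij: "i \<le> l" "j \<le> l" by (auto simp: unip_def)
  let ?f = "\<lambda>k. of_nat (i choose k) * u ^ (i - k) * (of_nat (k choose j) * v ^ (k - j)) :: complex"
  have "(unip l u * unip l v) $$ (i, j) = (\<Sum>k\<in>{0..<l + 1}. ?f k)"
    using ij by (simp add: unip_def scalar_prod_def)
  also have "\<dots> = of_nat (i choose j) * (u + v) ^ (i - j)"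
  proof (cases "j \<le> i")
    case True
    have "(\<Sum>k\<in>{0..<l + 1}. ?f k) = (\<Sum>k\<in>{j..i}. ?f k)"
      using ij by (intro sum.mono_neutral_right) (auto simp: not_le binomial_eq_0)
    also have "\<dots> = (\<Sum>k\<in>{j..i}. of_nat (i choose j) * (of_nat ((i - j) choose (k - j)) * v ^ (k - j) * u ^ (i - k)))"
    proof (rule sum.cong[OF refl])
      fix k assume "k \<in> {j..i}"
      then have eq: "of_nat (i choose k) * of_nat (k choose j) = (of_nat (i choose j) * of_nat ((i - j) choose (k - j)) :: complex)"
        using choose_mult[of j k i] by (simp flip: of_nat_mult)
      have "?f k = (of_nat (i choose k) * of_nat (k choose j)) * (v ^ (k - j) * u ^ (i - k))"
        by (simp only: mult_ac)
      then show "?f k = of_nat (i choose j) * (of_nat ((i - j) choose (k - j)) * v ^ (k - j) * u ^ (i - k))"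
        by (simp only: eq mult.assoc)
    qed
    \<comment> \<open>The bounds are spelled out in this way to match the shift of the summation
      index by j.\<close>
    also have "\<dots> = of_nat (i choose j) * (\<Sum>k\<in>{0 + j..(i - j) + j}. of_nat ((i - j) choose (k - j)) * v ^ (k - j) * u ^ (i - k))"
      using True by (simp add: sum_distrib_left)
    also have "(\<Sum>k\<in>{0 + j..(i - j) + j}. of_nat ((i - j) choose (k - j)) * v ^ (k - j) * u ^ (i - k))
      = (\<Sum>k\<in>{0..i - j}. of_nat ((i - j) choose k) * v ^ k * u ^ (i - j - k))"
      by (subst sum.shift_bounds_cl_nat_ivl) (simp add: add.commute)
    also have "\<dots> = (v + u) ^ (i - j)"
      by (simp add: binomial_ring atLeast0AtMost)
    finally show ?thesis by (simp add: add.commute)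
  next
    case False
    then have z: "?f k = 0" for k by (cases "k \<le> i") auto
    show ?thesis unfolding z using False by (simp add: binomial_eq_0)
  qed
  also have "\<dots> = unip l (u + v) $$ (i, j)" using ij by (simp add: unip_def)
  finally show "(unip l u * unip l v) $$ (i, j) = unip l (u + v) $$ (i, j)" .
qed (simp_all add: unip_def)

lemma unip_0: "unip l 0 = 1\<^sub>m (l + 1)"
proof (rule eq_matI)
  fix i j assume "i < dim_row (1\<^sub>m (l + 1) :: complex mat)" "j < dim_col (1\<^sub>m (l + 1) :: complex mat)"
  then show "unip l 0 $$ (i, j) = 1\<^sub>m (l + 1) $$ (i, j)"
    by (cases "i < j"; cases "i = j") (auto simp: unip_def binomial_eq_0)
qed (simp_all add: unip_def)

section \<open>Operators on the tensor product and their coinvariants\<close>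

lemma tensor_op_carrier [simp]:
  "A \<in> carrier_mat m m \<Longrightarrow> B \<in> carrier_mat n n \<Longrightarrow> X \<in> carrier_mat m n \<Longrightarrow> tensor_op A B X \<in> carrier_mat m n"
  by (simp add: tensor_op_def)

lemma tensor_op_dim: "dim_row (tensor_op A B X) = dim_row A" "dim_col (tensor_op A B X) = dim_row B"
  by (simp_all add: tensor_op_def)

lemma tensor_op_index:
  assumes "A \<in> carrier_mat m m" "B \<in> carrier_mat n n" "X \<in> carrier_mat m n" "a < m" "b < n"
  shows "tensor_op A B X $$ (a, b) = (\<Sum>i<m. \<Sum>j<n. A $$ (a, i) * B $$ (b, j) * X $$ (i, j))"
proof -
  have "tensor_op A B X $$ (a, b) = (\<Sum>i<m. A $$ (a, i) * (\<Sum>j<n. X $$ (i, j) * B $$ (b, j)))"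
    using assms by (simp add: tensor_op_def scalar_prod_def atLeast0LessThan)
  also have "\<dots> = (\<Sum>i<m. \<Sum>j<n. A $$ (a, i) * B $$ (b, j) * X $$ (i, j))"
    unfolding sum_distrib_left by (simp add: mult_ac)
  finally show ?thesis .
qed

lemma tensor_op_add:
  assumes "A \<in> carrier_mat m m" "B \<in> carrier_mat n n" "X \<in> carrier_mat m n" "Y \<in> carrier_mat m n"
  shows "tensor_op A B (X + Y) = tensor_op A B X + tensor_op A B Y"
  using assms unfolding tensor_op_def
  by (simp add: mult_add_distrib_mat[of _ m m] add_mult_distrib_mat[of _ m n])

lemma tensor_op_smult:
  assumes "A \<in> carrier_mat m m" "B \<in> carrier_mat n n" "X \<in> carrier_mat m n"
  shows "tensor_op A B (c \<cdot>\<^sub>m X) = c \<cdot>\<^sub>m tensor_op A B X"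
  using assms unfolding tensor_op_def
  by (simp add: mult_smult_distrib[of _ m m] mult_smult_assoc_mat[of _ m n])

lemma tensor_op_mult:
  assumes "A \<in> carrier_mat m m" "B \<in> carrier_mat n n" "A' \<in> carrier_mat m m" "B' \<in> carrier_mat n n"
    "X \<in> carrier_mat m n"
  shows "tensor_op A B (tensor_op A' B' X) = tensor_op (A * A') (B * B') X"
  using assms unfolding tensor_op_def
  by (simp add: transpose_mult[of _ n n] assoc_mult_mat[of _ m m _ m _ n] assoc_mult_mat[of _ m m _ n _ n]
      assoc_mult_mat[of _ m n _ n _ n])

lemma tensor_op_smult_both:
  assumes "A \<in> carrier_mat m m" "B \<in> carrier_mat n n" "X \<in> carrier_mat m n" "c * d = 1"
  shows "tensor_op (c \<cdot>\<^sub>m A) (d \<cdot>\<^sub>m B) X = tensor_op A B X"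
proof (rule eq_matI)
  fix a b assume "a < dim_row (tensor_op A B X)" "b < dim_col (tensor_op A B X)"
  then have ab: "a < m" "b < n" using assms by (auto simp: tensor_op_def)
  have cd: "c * x * (d * y) = x * y" for x y
    using assms(4) by (metis mult.assoc mult.commute mult.left_neutral)
  show "tensor_op (c \<cdot>\<^sub>m A) (d \<cdot>\<^sub>m B) X $$ (a, b) = tensor_op A B X $$ (a, b)"
    using assms(1-3) ab by (simp add: tensor_op_index[where m = m and n = n] cd)
qed (use assms in \<open>auto simp: tensor_op_def\<close>)

text \<open>In total degree at most \<open>k\<close> only the linear part of the unipotent action contributes, i.e. its
  two commuting nilpotent logarithms.\<close>

lemma tensor_unip_leading:
  fixes Y :: "complex mat"
  assumes Y: "Y \<in> carrier_mat (l1 + 1) (l2 + 1)"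
    and low: "\<And>i j. i \<le> l1 \<Longrightarrow> j \<le> l2 \<Longrightarrow> i + j + 1 < k \<Longrightarrow> Y $$ (i, j) = 0"
    and ab: "a \<le> l1" "b \<le> l2" "a + b \<le> k"
  shows "tensor_op (unip l1 p) (unip l2 q) Y $$ (a, b) - Y $$ (a, b)
    = of_nat a * p * Y $$ (a - 1, b) + of_nat b * q * Y $$ (a, b - 1)"
proof -
  let ?t = "\<lambda>i j. of_nat (a choose i) * p ^ (a - i) * (of_nat (b choose j) * q ^ (b - j)) * Y $$ (i, j)"
  \<comment> \<open>Only the pair (a, b) and its two lower neighbours survive: any other pair below
    (a, b) has degree less than a + b - 1, where Y vanishes. For a = 0 the truncated a - 1 is 0
    again, but the factor \<open>of_nat a\<close> removes the spurious term; likewise for b.\<close>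
  have t: "?t i j = (if i = a then if j = b then Y $$ (a, b) else 0 else 0)
      + (if i = a - 1 then if j = b then of_nat a * p * Y $$ (a - 1, b) else 0 else 0)
      + (if i = a then if j = b - 1 then of_nat b * q * Y $$ (a, b - 1) else 0 else 0)"
    if ij: "i \<le> l1" "j \<le> l2" for i j
  proof (cases "i \<le> a \<and> j \<le> b")
    case False
    then show ?thesis by auto
  next
    case True
    then consider "i = a" "j = b" | "a = Suc i" "j = b" | "i = a" "b = Suc j" | "i + j + 1 < a + b"
      by linarith
    then show ?thesis
    proof cases
      case 1 then show ?thesis by (cases a; cases b) auto
    next
      case 2 then show ?thesis by (cases b) (auto simp: binomial_Suc_n)
    next
      case 3 then show ?thesis by (cases a) (auto simp: binomial_Suc_n)
    next
      case 4
      then have "Y $$ (i, j) = 0" using low[of i j] ij ab by linarith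
      then show ?thesis using 4 True by auto
    qed
  qed
  have "tensor_op (unip l1 p) (unip l2 q) Y $$ (a, b) = (\<Sum>i<l1 + 1. \<Sum>j<l2 + 1. ?t i j)"
    using ab Y by (subst tensor_op_index[where m = "l1 + 1" and n = "l2 + 1"])
      (auto simp: unip_index intro!: sum.cong)
  also have "\<dots> = (\<Sum>i<l1 + 1. \<Sum>j<l2 + 1. (if i = a then if j = b then Y $$ (a, b) else 0 else 0)
      + (if i = a - 1 then if j = b then of_nat a * p * Y $$ (a - 1, b) else 0 else 0)
      + (if i = a then if j = b - 1 then of_nat b * q * Y $$ (a, b - 1) else 0 else 0))"
    by (intro sum.cong refl t) auto
  also have "\<dots> = Y $$ (a, b) + of_nat a * p * Y $$ (a - 1, b) + of_nat b * q * Y $$ (a, b - 1)"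
  proof -
    have S: "(\<Sum>i<l1 + 1. \<Sum>j<l2 + 1. if i = a' then if j = b' then c else 0 else 0) = c"
      if "a' \<le> l1" "b' \<le> l2" for a' b' and c :: complex
    proof -
      have "(\<Sum>i<l1 + 1. \<Sum>j<l2 + 1. if i = a' then if j = b' then c else 0 else 0)
        = (\<Sum>i<l1 + 1. if i = a' then c else 0)"
        using that by (intro sum.cong) (auto simp: sum.delta)
      then show ?thesis using that by (simp add: sum.delta)
    qed
    have a1: "a - 1 \<le> l1" and b1: "b - 1 \<le> l2" using ab by simp_all
    show ?thesis
      unfolding sum.distrib S[OF ab(1,2)] S[OF a1 ab(2)] S[OF ab(1) b1] ..
  qed
  finally show ?thesis by simp
qed

text \<open>Successive approximation along the filtration by the total degree i + j. In leading
  order the two unipotent operators minus the identity are combinations of the two nilpotent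
  directions, and the determinant condition makes these combinations invertible. Every entry except
  the corner has a lower neighbour from which it can be reached.\<close>

lemma coinvariants_unip:
  fixes X :: "complex mat"
  assumes d: "p1 * q2 - p2 * q1 \<noteq> 0"
    and X: "X \<in> carrier_mat (l1 + 1) (l2 + 1)" "X $$ (0, 0) = 0"
  obtains Y Z where "Y \<in> carrier_mat (l1 + 1) (l2 + 1)" "Z \<in> carrier_mat (l1 + 1) (l2 + 1)"
    "X = (tensor_op (unip l1 p1) (unip l2 q1) Y - Y) + (tensor_op (unip l1 p2) (unip l2 q2) Z - Z)"
proof -
  let ?V = "carrier_mat (l1 + 1) (l2 + 1) :: complex mat set"
  let ?A = "\<lambda>p q. tensor_op (unip l1 p) (unip l2 q)"
  have "\<exists>Y\<in>?V. \<exists>Z\<in>?V. X = (?A p1 q1 Y - Y) + (?A p2 q2 Z - Z)"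
    if "X \<in> ?V" "1 \<le> k" "\<And>i j. i \<le> l1 \<Longrightarrow> j \<le> l2 \<Longrightarrow> i + j < k \<Longrightarrow> X $$ (i, j) = 0" for k X
    using that
  \<comment> \<open>The measure counts the degrees not yet treated. When it is 0, every entry has
    degree below k, so X is zero.\<close>
  proof (induction "l1 + l2 + 1 - k" arbitrary: k X)
    case 0
    have "X = 0\<^sub>m (l1 + 1) (l2 + 1)"
      using 0 by (intro eq_matI) auto
    moreover have "?A p q (0\<^sub>m (l1 + 1) (l2 + 1)) = 0\<^sub>m (l1 + 1) (l2 + 1)" for p q
      unfolding tensor_op_def by (metis left_mult_zero_mat right_mult_zero_mat transpose_carrier_mat unip_carrier(1))
    ultimately show ?case
      by (intro bexI[of _ "0\<^sub>m (l1 + 1) (l2 + 1)"]) auto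
  next
    case (Suc n)
    \<comment> \<open>Preimages of X under the two directions: P accounts for the entries with
      positive row index, and Q, supported in row 0, for the rest of row 0, so that no entry is
      counted twice.\<close>
    define P where "P = (\<lambda>(i::nat) (j::nat). if i + 1 \<le> l1 then X $$ (i + 1, j) / of_nat (i + 1) else 0)"
    define Q where "Q = (\<lambda>(i::nat) (j::nat). if i = 0 \<and> j + 1 \<le> l2 then X $$ (0, j + 1) / of_nat (j + 1) else 0)"
    define \<delta> where "\<delta> = p1 * q2 - p2 * q1"
    have \<delta>: "\<delta> \<noteq> 0" using d by (simp add: \<delta>_def)
    \<comment> \<open>Cramer's rule for the system p1 Y0 + p2 Z0 = P, q1 Y0 + q2 Z0 = Q.\<close>
    define Y0 where "Y0 = mat (l1 + 1) (l2 + 1) (\<lambda>(i, j). (q2 * P i j - p2 * Q i j) / \<delta>)"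
    define Z0 where "Z0 = mat (l1 + 1) (l2 + 1) (\<lambda>(i, j). (p1 * Q i j - q1 * P i j) / \<delta>)"
    have V0: "Y0 \<in> ?V" "Z0 \<in> ?V" by (simp_all add: Y0_def Z0_def)
    have PQ0: "P i j = 0 \<and> Q i j = 0" if "i \<le> l1" "j \<le> l2" "i + j + 1 < k" for i j
      using that Suc.prems(3)[of "i + 1" j] Suc.prems(3)[of 0 "j + 1"] by (auto simp: P_def Q_def)
    have low: "Y0 $$ (i, j) = 0" "Z0 $$ (i, j) = 0" if "i \<le> l1" "j \<le> l2" "i + j + 1 < k" for i j
      using that PQ0[OF that] by (simp_all add: Y0_def Z0_def)
    have comb: "p1 * Y0 $$ (i, j) + p2 * Z0 $$ (i, j) = P i j"
      "q1 * Y0 $$ (i, j) + q2 * Z0 $$ (i, j) = Q i j" if "i \<le> l1" "j \<le> l2" for i j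
    proof -
      have "p1 * Y0 $$ (i, j) + p2 * Z0 $$ (i, j) = (\<delta> * P i j) / \<delta>"
        "q1 * Y0 $$ (i, j) + q2 * Z0 $$ (i, j) = (\<delta> * Q i j) / \<delta>"
        using that by (simp_all add: Y0_def Z0_def \<delta>_def algebra_simps flip: add_divide_distrib diff_divide_distrib)
      then show "p1 * Y0 $$ (i, j) + p2 * Z0 $$ (i, j) = P i j"
        "q1 * Y0 $$ (i, j) + q2 * Z0 $$ (i, j) = Q i j" using \<delta> by simp_all
    qed
    define W where "W = (?A p1 q1 Y0 - Y0) + (?A p2 q2 Z0 - Z0)"
    have WV: "W \<in> ?V" using V0 by (auto simp: W_def intro!: add_carrier_mat minus_carrier_mat)
    have W: "W $$ (a, b) = X $$ (a, b)" if ab: "a \<le> l1" "b \<le> l2" "a + b \<le> k" for a b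
    proof -
      have "W $$ (a, b) = (?A p1 q1 Y0 $$ (a, b) - Y0 $$ (a, b)) + (?A p2 q2 Z0 $$ (a, b) - Z0 $$ (a, b))"
        using ab V0 by (simp add: W_def tensor_op_def)
      also have "\<dots> = of_nat a * (p1 * Y0 $$ (a - 1, b) + p2 * Z0 $$ (a - 1, b))
          + of_nat b * (q1 * Y0 $$ (a, b - 1) + q2 * Z0 $$ (a, b - 1))"
      proof -
        have "?A p1 q1 Y0 $$ (a, b) - Y0 $$ (a, b)
            = of_nat a * p1 * Y0 $$ (a - 1, b) + of_nat b * q1 * Y0 $$ (a, b - 1)"
          by (rule tensor_unip_leading[OF V0(1) _ ab]) (rule low)
        moreover have "?A p2 q2 Z0 $$ (a, b) - Z0 $$ (a, b)
            = of_nat a * p2 * Z0 $$ (a - 1, b) + of_nat b * q2 * Z0 $$ (a, b - 1)"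
          by (rule tensor_unip_leading[OF V0(2) _ ab]) (rule low)
        ultimately show ?thesis by (simp only:) (simp add: algebra_simps)
      qed
      also have "\<dots> = of_nat a * P (a - 1) b + of_nat b * Q a (b - 1)"
        using ab by (simp add: comb)
      also have "\<dots> = X $$ (a, b)"
      proof (cases a)
        case (Suc a')
        have "of_nat (Suc a') \<noteq> (0 :: complex)" by (rule of_nat_neq_0)
        then show ?thesis using ab Suc by (simp add: P_def Q_def)
      next
        case a0: 0
        show ?thesis
        proof (cases b)
          case 0 then show ?thesis using a0 Suc.prems(2) Suc.prems(3)[of 0 0] by simp
        next
          case (Suc b')
          have "of_nat (Suc b') \<noteq> (0 :: complex)" by (rule of_nat_neq_0)
          then show ?thesis using a0 Suc ab by (simp add: Q_def)
        qed
      qed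
      finally show ?thesis .
    qed
    \<comment> \<open>W matches X in all degrees up to k. Whatever it changes in higher degrees is
      left to the induction hypothesis for k + 1.\<close>
    have XW: "X - W \<in> ?V" using WV by (rule minus_carrier_mat)
    have "\<exists>Y\<in>?V. \<exists>Z\<in>?V. X - W = (?A p1 q1 Y - Y) + (?A p2 q2 Z - Z)"
    proof (rule Suc.hyps(1)[of "Suc k"])
      show "n = l1 + l2 + 1 - Suc k" using Suc.hyps(2) by linarith
      show "(X - W) $$ (i, j) = 0" if "i \<le> l1" "j \<le> l2" "i + j < Suc k" for i j
        using that W[of i j] WV Suc.prems(1) by simp
    qed (use XW in auto)
    then obtain Y Z where YZ: "Y \<in> ?V" "Z \<in> ?V" "X - W = (?A p1 q1 Y - Y) + (?A p2 q2 Z - Z)" by blast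
    have add: "?A p q (Y + Y') = ?A p q Y + ?A p q Y'" if "Y \<in> ?V" "Y' \<in> ?V" for p q Y Y'
      using that by (intro tensor_op_add[where m = "l1 + 1" and n = "l2 + 1"]) simp_all
    have "X = (X - W) + W" using Suc.prems(1) WV by (intro eq_matI) auto
    also have "\<dots> = ((?A p1 q1 Y - Y) + (?A p2 q2 Z - Z)) + ((?A p1 q1 Y0 - Y0) + (?A p2 q2 Z0 - Z0))"
      unfolding YZ(3) by (simp only: W_def)
    also have "\<dots> = (?A p1 q1 (Y + Y0) - (Y + Y0)) + (?A p2 q2 (Z + Z0) - (Z + Z0))"
      unfolding add[OF YZ(1) V0(1)] add[OF YZ(2) V0(2)]
      using YZ(1,2) V0 by (intro eq_matI) (simp_all add: tensor_op_dim unip_def algebra_simps)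
    finally show ?case using YZ V0 by (intro bexI[of _ "Y + Y0"] bexI[of _ "Z + Z0"]) auto
  qed
  from this[of X 1] X that show thesis by auto
qed

lemma unip_row_0: "i \<le> l \<Longrightarrow> i \<noteq> 0 \<Longrightarrow> unip l u $$ (0, i) = 0"
  by (simp add: unip_def binomial_eq_0)

section \<open>Extensions of a free abelian group of rank two\<close>

lemma (in group) commute_int_pow:
  assumes x: "x \<in> carrier G" and y: "y \<in> carrier G" and xy: "x \<otimes> y = y \<otimes> x"
  shows "x [^] (m::int) \<otimes> y = y \<otimes> x [^] m"
proof -
  have nat: "x [^] (n::nat) \<otimes> y = y \<otimes> x [^] n" for n
  proof (induction n)
    case (Suc n)
    have "x [^] Suc n \<otimes> y = x [^] n \<otimes> (y \<otimes> x)" using x y by (simp add: m_assoc xy)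
    also have "\<dots> = y \<otimes> x [^] Suc n" using x y Suc by (simp flip: m_assoc)
    finally show ?case .
  qed (use y in simp)
  have inv: "inv z \<otimes> y = y \<otimes> inv z" if z: "z \<in> carrier G" "z \<otimes> y = y \<otimes> z" for z
  proof -
    have "y \<otimes> inv z = inv z \<otimes> (z \<otimes> y) \<otimes> inv z" using z(1) y by (simp flip: m_assoc)
    also have "\<dots> = inv z \<otimes> y" unfolding z(2) using z(1) y by (simp add: m_assoc)
    finally show ?thesis by simp
  qed
  have "inv (x [^] nat (- m)) \<otimes> y = y \<otimes> inv (x [^] nat (- m))"
    by (rule inv[OF nat_pow_closed[OF x] nat])
  with nat[of "nat m"] show ?thesis
    unfolding int_pow_def2 by (cases "m < 0") (simp_all only: if_True if_False)
qed

text \<open>The cocycle defines an extension of \<open>G\<close> by \<open>M\<close>; it splits as soon as lifts of the two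
  generators of the free abelian group \<open>G\<close> commute.\<close>

lemma cocycle_rank_two_trivial:
  fixes G :: "('g, 'b) monoid_scheme" and M :: "('k, 'v, 'c) module_scheme"
  assumes "group G" and "abelian_group M"
    and act: "\<And>g v. g \<in> carrier G \<Longrightarrow> v \<in> carrier M \<Longrightarrow> act g v \<in> carrier M"
    and act_add: "\<And>g v w. g \<in> carrier G \<Longrightarrow> v \<in> carrier M \<Longrightarrow> w \<in> carrier M
      \<Longrightarrow> act g (v \<oplus>\<^bsub>M\<^esub> w) = act g v \<oplus>\<^bsub>M\<^esub> act g w"
    and act_mult: "\<And>g h v. g \<in> carrier G \<Longrightarrow> h \<in> carrier G \<Longrightarrow> v \<in> carrier M
      \<Longrightarrow> act g (act h v) = act (g \<otimes>\<^bsub>G\<^esub> h) v"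
    and act_one: "\<And>v. v \<in> carrier M \<Longrightarrow> act \<one>\<^bsub>G\<^esub> v = v"
    and f: "\<And>g h. g \<in> carrier G \<Longrightarrow> h \<in> carrier G \<Longrightarrow> f g h \<in> carrier M"
    and cocycle: "\<And>g h k. g \<in> carrier G \<Longrightarrow> h \<in> carrier G \<Longrightarrow> k \<in> carrier G
      \<Longrightarrow> act g (f h k) \<oplus>\<^bsub>M\<^esub> f g (h \<otimes>\<^bsub>G\<^esub> k) = f (g \<otimes>\<^bsub>G\<^esub> h) k \<oplus>\<^bsub>M\<^esub> f g h"
    and e: "e1 \<in> carrier G" "e2 \<in> carrier G" "e1 \<otimes>\<^bsub>G\<^esub> e2 = e2 \<otimes>\<^bsub>G\<^esub> e1"
    and \<mu>: "\<And>g h. g \<in> carrier G \<Longrightarrow> h \<in> carrier G \<Longrightarrow> \<mu> (g \<otimes>\<^bsub>G\<^esub> h) = \<mu> g + (\<mu> h :: int)"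
    and \<nu>: "\<And>g h. g \<in> carrier G \<Longrightarrow> h \<in> carrier G \<Longrightarrow> \<nu> (g \<otimes>\<^bsub>G\<^esub> h) = \<nu> g + (\<nu> h :: int)"
    and basis: "\<And>g. g \<in> carrier G \<Longrightarrow> g = e1 [^]\<^bsub>G\<^esub> \<mu> g \<otimes>\<^bsub>G\<^esub> e2 [^]\<^bsub>G\<^esub> \<nu> g"
    and v: "v1 \<in> carrier M" "v2 \<in> carrier M"
    and comm: "v1 \<oplus>\<^bsub>M\<^esub> act e1 v2 \<oplus>\<^bsub>M\<^esub> f e1 e2 = v2 \<oplus>\<^bsub>M\<^esub> act e2 v1 \<oplus>\<^bsub>M\<^esub> f e2 e1"
  obtains s where "\<And>g. g \<in> carrier G \<Longrightarrow> s g \<in> carrier M"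
    "\<And>g h. g \<in> carrier G \<Longrightarrow> h \<in> carrier G
      \<Longrightarrow> s g \<oplus>\<^bsub>M\<^esub> act g (s h) \<oplus>\<^bsub>M\<^esub> f g h = s (g \<otimes>\<^bsub>G\<^esub> h)"
proof -
  interpret G: group G by fact
  interpret M: abelian_group M by fact
  \<comment> \<open>The cocycle may be unnormalised, so the unit is not (0, 1): its first component
    has to cancel \<open>f\<close> at the pair of units.\<close>
  define E where "E = \<lparr>carrier = carrier M \<times> carrier G,
      monoid.mult = (\<lambda>x y. (fst x \<oplus>\<^bsub>M\<^esub> act (snd x) (fst y) \<oplus>\<^bsub>M\<^esub> f (snd x) (snd y), snd x \<otimes>\<^bsub>G\<^esub> snd y)),
      one = (\<ominus>\<^bsub>M\<^esub> f \<one>\<^bsub>G\<^esub> \<one>\<^bsub>G\<^esub>, \<one>\<^bsub>G\<^esub>)\<rparr>"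
  \<comment> \<open>The cocycle identity at the triple (1, 1, g).\<close>
  have f1: "f \<one>\<^bsub>G\<^esub> g = f \<one>\<^bsub>G\<^esub> \<one>\<^bsub>G\<^esub>" if g: "g \<in> carrier G" for g
    using cocycle[OF G.one_closed G.one_closed g] g f by (simp add: act_one)
  have "group E"
  proof (rule groupI)
    fix x y z assume xyz: "x \<in> carrier E" "y \<in> carrier E" "z \<in> carrier E"
    obtain v a w b u c where eqs: "x = (v, a)" "y = (w, b)" "z = (u, c)" by (metis surj_pair)
    have cl: "v \<in> carrier M" "w \<in> carrier M" "u \<in> carrier M" "a \<in> carrier G" "b \<in> carrier G" "c \<in> carrier G"
      using xyz by (auto simp: E_def eqs)
    note cl' = cl act f
    have "v \<oplus>\<^bsub>M\<^esub> act a w \<oplus>\<^bsub>M\<^esub> f a b \<oplus>\<^bsub>M\<^esub> act (a \<otimes>\<^bsub>G\<^esub> b) u \<oplus>\<^bsub>M\<^esub> f (a \<otimes>\<^bsub>G\<^esub> b) c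
        = v \<oplus>\<^bsub>M\<^esub> act a w \<oplus>\<^bsub>M\<^esub> act (a \<otimes>\<^bsub>G\<^esub> b) u \<oplus>\<^bsub>M\<^esub> (f (a \<otimes>\<^bsub>G\<^esub> b) c \<oplus>\<^bsub>M\<^esub> f a b)"
      using cl' by (simp add: M.a_ac)
    also have "\<dots> = v \<oplus>\<^bsub>M\<^esub> act a (w \<oplus>\<^bsub>M\<^esub> act b u \<oplus>\<^bsub>M\<^esub> f b c) \<oplus>\<^bsub>M\<^esub> f a (b \<otimes>\<^bsub>G\<^esub> c)"
      unfolding cocycle[OF cl(4,5,6), symmetric] using cl' by (simp add: act_add act_mult M.a_ac)
    finally show "x \<otimes>\<^bsub>E\<^esub> y \<otimes>\<^bsub>E\<^esub> z = x \<otimes>\<^bsub>E\<^esub> (y \<otimes>\<^bsub>E\<^esub> z)"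
      using cl by (simp add: E_def eqs G.m_assoc)
  next
    fix x assume x: "x \<in> carrier E"
    obtain w b where eq: "x = (w, b)" and cl: "w \<in> carrier M" "b \<in> carrier G"
      using x by (cases x) (auto simp: E_def)
    have F: "f \<one>\<^bsub>G\<^esub> \<one>\<^bsub>G\<^esub> \<in> carrier M" using f by blast
    have "\<ominus>\<^bsub>M\<^esub> f \<one>\<^bsub>G\<^esub> \<one>\<^bsub>G\<^esub> \<oplus>\<^bsub>M\<^esub> w \<oplus>\<^bsub>M\<^esub> f \<one>\<^bsub>G\<^esub> \<one>\<^bsub>G\<^esub>
        = w \<oplus>\<^bsub>M\<^esub> (f \<one>\<^bsub>G\<^esub> \<one>\<^bsub>G\<^esub> \<oplus>\<^bsub>M\<^esub> \<ominus>\<^bsub>M\<^esub> f \<one>\<^bsub>G\<^esub> \<one>\<^bsub>G\<^esub>)"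
      using F cl by (simp only: M.a_ac M.a_inv_closed M.add.m_closed)
    also have "\<dots> = w" using F cl by (simp only: M.r_neg M.r_zero)
    finally show "\<one>\<^bsub>E\<^esub> \<otimes>\<^bsub>E\<^esub> x = x"
      using cl f1[OF cl(2)] by (simp add: E_def eq act_one)
    let ?b = "inv\<^bsub>G\<^esub> b"
    let ?y = "(\<ominus>\<^bsub>M\<^esub> f \<one>\<^bsub>G\<^esub> \<one>\<^bsub>G\<^esub> \<ominus>\<^bsub>M\<^esub> (act ?b w \<oplus>\<^bsub>M\<^esub> f ?b b), ?b)"
    have "?y \<otimes>\<^bsub>E\<^esub> x = \<one>\<^bsub>E\<^esub>"
      using cl act f by (simp add: E_def eq M.a_assoc M.minus_eq M.l_neg)
    moreover have "?y \<in> carrier E" using cl act f by (simp add: E_def)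
    ultimately show "\<exists>y\<in>carrier E. y \<otimes>\<^bsub>E\<^esub> x = \<one>\<^bsub>E\<^esub>" by blast
  qed (auto simp: E_def act f)
  then interpret E: group E .
  have "snd \<in> hom E G" by (auto simp: hom_def E_def)
  then interpret snd: group_hom E G snd by unfold_locales
  define x1 x2 where "x1 = (v1, e1)" and "x2 = (v2, e2)"
  have x: "x1 \<in> carrier E" "x2 \<in> carrier E" using v e by (auto simp: E_def x1_def x2_def)
  \<comment> \<open>The hypothesis \<open>comm\<close> is the equality of the first components of
    these two products.\<close>
  have "x1 \<otimes>\<^bsub>E\<^esub> x2 = x2 \<otimes>\<^bsub>E\<^esub> x1" using comm e by (simp add: E_def x1_def x2_def)
  then have xc: "x2 [^]\<^bsub>E\<^esub> n \<otimes>\<^bsub>E\<^esub> x1 [^]\<^bsub>E\<^esub> m = x1 [^]\<^bsub>E\<^esub> m \<otimes>\<^bsub>E\<^esub> x2 [^]\<^bsub>E\<^esub> n" for m n :: int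
    using x by (metis E.commute_int_pow E.int_pow_closed)
  \<comment> \<open>Because \<mu> and \<nu> are additive and the lifts commute, this section of the
    extension is a homomorphism. Comparing first components of the product rule gives the required
    relation.\<close>
  define S where "S = (\<lambda>g. x1 [^]\<^bsub>E\<^esub> \<mu> g \<otimes>\<^bsub>E\<^esub> x2 [^]\<^bsub>E\<^esub> \<nu> g)"
  have SE: "S g \<in> carrier E" for g using x by (simp add: S_def)
  have S_mult: "S (g \<otimes>\<^bsub>G\<^esub> h) = S g \<otimes>\<^bsub>E\<^esub> S h" if "g \<in> carrier G" "h \<in> carrier G" for g h
  proof -
    have cl: "x1 [^]\<^bsub>E\<^esub> m \<in> carrier E" "x2 [^]\<^bsub>E\<^esub> m \<in> carrier E" for m :: int using x by simp_all
    have "S (g \<otimes>\<^bsub>G\<^esub> h)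
        = x1 [^]\<^bsub>E\<^esub> \<mu> g \<otimes>\<^bsub>E\<^esub> (x1 [^]\<^bsub>E\<^esub> \<mu> h \<otimes>\<^bsub>E\<^esub> x2 [^]\<^bsub>E\<^esub> \<nu> g) \<otimes>\<^bsub>E\<^esub> x2 [^]\<^bsub>E\<^esub> \<nu> h"
      using that x cl by (simp add: S_def \<mu> \<nu> E.int_pow_mult E.m_assoc)
    also have "\<dots> = S g \<otimes>\<^bsub>E\<^esub> S h"
      unfolding xc[symmetric] using cl by (simp add: S_def E.m_assoc)
    finally show ?thesis .
  qed
  have snd_S: "snd (S g) = g" if "g \<in> carrier G" for g
    using x that basis[OF that] by (simp add: S_def snd.hom_int_pow) (simp add: x1_def x2_def)
  show thesis
  proof (rule that[of "\<lambda>g. fst (S g)"])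
    fix g assume "g \<in> carrier G"
    show "fst (S g) \<in> carrier M" using SE[of g] by (auto simp: E_def)
  next
    fix g h assume gh: "g \<in> carrier G" "h \<in> carrier G"
    then show "fst (S g) \<oplus>\<^bsub>M\<^esub> act g (fst (S h)) \<oplus>\<^bsub>M\<^esub> f g h = fst (S (g \<otimes>\<^bsub>G\<^esub> h))"
      by (simp add: S_mult) (simp add: E_def snd_S)
  qed
qed

text \<open>The classes are exactly the fibres of \<open>\<phi>\<close>.\<close>

lemma quotient_by_kernel_line:
  fixes C :: "('k::field, 'v, 'c) module_scheme" and H :: "('k, 'v set, 'd) module_scheme" and \<phi> :: "'v \<Rightarrow> 'k"
  assumes "Module.module (class_ring :: 'k ring) C"
    and Z: "Z \<subseteq> carrier C"
    and Z_add: "\<And>f g. f \<in> Z \<Longrightarrow> g \<in> Z \<Longrightarrow> f \<oplus>\<^bsub>C\<^esub> g \<in> Z \<and> \<phi> (f \<oplus>\<^bsub>C\<^esub> g) = \<phi> f + \<phi> g"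
    and Z_smult: "\<And>c f. f \<in> Z \<Longrightarrow> c \<odot>\<^bsub>C\<^esub> f \<in> Z \<and> \<phi> (c \<odot>\<^bsub>C\<^esub> f) = c * \<phi> f"
    and B: "B = {f \<in> Z. \<phi> f = 0}"
    and z: "z \<in> Z" "\<phi> z \<noteq> 0"
    and H: "carrier H = {B +>\<^bsub>C\<^esub> f | f. f \<in> Z}" "\<zero>\<^bsub>H\<^esub> = B" "add H = set_add C"
      "Module.smult H = (\<lambda>c. on_classes C B (\<lambda>f. c \<odot>\<^bsub>C\<^esub> f))"
  shows "vectorspace (class_ring :: 'k ring) H" "vectorspace.fin_dim (class_ring :: 'k ring) H"
    "vectorspace.dim (class_ring :: 'k ring) H = 1"
    "\<And>T c X. (\<And>f. f \<in> Z \<Longrightarrow> T f \<in> Z \<and> \<phi> (T f) = c * \<phi> f) \<Longrightarrow> X \<in> carrier H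
      \<Longrightarrow> on_classes C B T X = c \<odot>\<^bsub>H\<^esub> X"
proof -
  interpret C: Module.module "class_ring :: 'k ring" C by fact
  define fib where "fib = (\<lambda>c. {f \<in> Z. \<phi> f = c})"
  have B_fib: "B = fib 0" by (simp add: B fib_def)
  have sub: "\<exists>h\<in>Z. f = h \<oplus>\<^bsub>C\<^esub> g \<and> \<phi> h = \<phi> f - \<phi> g" if "f \<in> Z" "g \<in> Z" for f g
  proof (rule bexI[of _ "f \<oplus>\<^bsub>C\<^esub> (- 1) \<odot>\<^bsub>C\<^esub> g"])
    have "f \<in> carrier C" "g \<in> carrier C" using that Z by auto
    moreover have "(- 1) \<odot>\<^bsub>C\<^esub> g \<oplus>\<^bsub>C\<^esub> g = \<zero>\<^bsub>C\<^esub>"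
      using C.smult_l_distr[of "- 1" 1 g] C.smult_one[of g] C.smult_l_null[of g] \<open>g \<in> carrier C\<close> by simp
    moreover have "(- 1) \<odot>\<^bsub>C\<^esub> g \<in> carrier C" using C.smult_closed[of "- 1" g] \<open>g \<in> carrier C\<close> by simp
    ultimately show "f = f \<oplus>\<^bsub>C\<^esub> (- 1) \<odot>\<^bsub>C\<^esub> g \<oplus>\<^bsub>C\<^esub> g \<and> \<phi> (f \<oplus>\<^bsub>C\<^esub> (- 1) \<odot>\<^bsub>C\<^esub> g) = \<phi> f - \<phi> g"
      using that Z_add Z_smult by (simp add: C.a_assoc)
    show "f \<oplus>\<^bsub>C\<^esub> (- 1) \<odot>\<^bsub>C\<^esub> g \<in> Z" using that Z_add Z_smult by blast
  qed
  \<comment> \<open>A standard representative of each fibre, taken on the line through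
    \<open>z\<close>; in particular no fibre is empty.\<close>
  define w where "w = (\<lambda>c. (c / \<phi> z) \<odot>\<^bsub>C\<^esub> z)"
  have w: "w c \<in> fib c" for c
    using Z_smult[OF z(1)] z(2) by (simp add: w_def fib_def)
  have coset: "B +>\<^bsub>C\<^esub> f = fib (\<phi> f)" if f: "f \<in> Z" for f
  proof (intro equalityI subsetI)
    fix g assume "g \<in> B +>\<^bsub>C\<^esub> f"
    then show "g \<in> fib (\<phi> f)" using f Z_add by (auto simp: a_r_coset_def' B fib_def)
  next
    fix g assume g: "g \<in> fib (\<phi> f)"
    then obtain h where "h \<in> Z" "g = h \<oplus>\<^bsub>C\<^esub> f" "\<phi> h = \<phi> g - \<phi> f"
      using sub[of g f] f by (auto simp: fib_def)
    then show "g \<in> B +>\<^bsub>C\<^esub> f" using g by (auto simp: a_r_coset_def' B fib_def)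
  qed
  have carr: "carrier H = range fib"
  proof (intro equalityI subsetI)
    fix X assume "X \<in> carrier H" then show "X \<in> range fib" by (auto simp: H coset)
  next
    fix X assume "X \<in> range fib"
    then obtain c where "X = fib c" by blast
    then have "X = B +>\<^bsub>C\<^esub> w c" "w c \<in> Z" using w[of c] coset[of "w c"] by (auto simp: fib_def)
    then show "X \<in> carrier H" by (auto simp: H)
  qed
  have add: "fib c <+>\<^bsub>C\<^esub> fib d = fib (c + d)" for c d
  proof (intro equalityI subsetI)
    fix g assume "g \<in> fib c <+>\<^bsub>C\<^esub> fib d"
    then show "g \<in> fib (c + d)" using Z_add by (auto simp: set_add_def' fib_def)
  next
    fix g assume g: "g \<in> fib (c + d)"
    then obtain h where "h \<in> Z" "g = h \<oplus>\<^bsub>C\<^esub> w d" "\<phi> h = \<phi> g - \<phi> (w d)"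
      using sub[of g "w d"] w[of d] by (auto simp: fib_def)
    then have "h \<in> fib c" using g w[of d] by (auto simp: fib_def)
    then show "g \<in> fib c <+>\<^bsub>C\<^esub> fib d" using w[of d] \<open>g = h \<oplus>\<^bsub>C\<^esub> w d\<close> by (auto simp: set_add_def')
  qed
  \<comment> \<open>T need not map a fibre onto a fibre, for instance when it is zero. Adding B
    fills up the fibre, since one image point already reaches all of it by translation.\<close>
  have on_fib: "on_classes C B T (fib d) = fib (c * d)"
    if T: "\<And>f. f \<in> Z \<Longrightarrow> T f \<in> Z \<and> \<phi> (T f) = c * \<phi> f" for T c d
  proof -
    have "B <+>\<^bsub>C\<^esub> T ` fib d = fib 0 <+>\<^bsub>C\<^esub> fib (c * d)"
    proof (intro equalityI subsetI)
      fix g assume "g \<in> B <+>\<^bsub>C\<^esub> T ` fib d"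
      then show "g \<in> fib 0 <+>\<^bsub>C\<^esub> fib (c * d)"
        using T unfolding B_fib by (fastforce simp: set_add_def' fib_def)
    next
      fix g assume "g \<in> fib 0 <+>\<^bsub>C\<^esub> fib (c * d)"
      then have g: "g \<in> Z" "\<phi> g = c * d" unfolding add by (auto simp: fib_def)
      have Tw: "T (w d) \<in> Z" "\<phi> (T (w d)) = c * d" using T[of "w d"] w[of d] by (auto simp: fib_def)
      obtain h where "h \<in> Z" "g = h \<oplus>\<^bsub>C\<^esub> T (w d)" "\<phi> h = \<phi> g - \<phi> (T (w d))"
        using sub[OF g(1) Tw(1)] by blast
      then show "g \<in> B <+>\<^bsub>C\<^esub> T ` fib d"
        using w[of d] g Tw unfolding B_fib by (auto simp: set_add_def' fib_def)
    qed
    then show ?thesis by (simp add: on_classes_def add)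
  qed
  have smult: "c \<odot>\<^bsub>H\<^esub> fib d = fib (c * d)" for c d
    using on_fib[of "\<lambda>f. c \<odot>\<^bsub>C\<^esub> f" c d] Z_smult by (simp add: H)
  have addH: "fib c \<oplus>\<^bsub>H\<^esub> fib d = fib (c + d)" for c d by (simp add: H add)
  have zeroH: "\<zero>\<^bsub>H\<^esub> = fib 0" by (simp add: H B_fib)
  have "abelian_group H"
  proof (rule abelian_groupI)
    fix X assume "X \<in> carrier H"
    then obtain c where "X = fib c" by (auto simp: carr)
    then have "fib (- c) \<oplus>\<^bsub>H\<^esub> X = \<zero>\<^bsub>H\<^esub>" by (simp add: addH zeroH)
    then show "\<exists>Y\<in>carrier H. Y \<oplus>\<^bsub>H\<^esub> X = \<zero>\<^bsub>H\<^esub>" by (auto simp: carr)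
  qed (auto simp: carr addH zeroH ac_simps)
  then have "Module.module (class_ring :: 'k ring) H"
    by (intro Module.moduleI class_cring.cring_axioms)
      (auto simp: carr smult addH class_ring_simps distrib_left distrib_right mult.assoc)
  then show vs: "vectorspace (class_ring :: 'k ring) H"
    using class_field by (simp add: vectorspace_def)
  interpret H: vectorspace "class_ring :: 'k ring" H by (rule vs)
  have fib_carr: "fib c \<in> carrier H" for c by (simp add: carr)
  have "X \<in> H.span {fib 1}" if X: "X \<in> carrier H" for X
  proof -
    obtain c where "X = fib c" using X by (auto simp: carr)
    then have "X = c \<odot>\<^bsub>H\<^esub> fib 1" by (simp add: smult)
    moreover have "submodule (class_ring :: 'k ring) (H.span {fib 1}) H"
      by (rule H.span_is_submodule) (simp add: fib_carr)
    moreover have "fib 1 \<in> H.span {fib 1}"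
      using H.in_own_span[of "{fib 1}"] fib_carr by auto
    ultimately show ?thesis by (simp add: submodule.smult_closed)
  qed
  moreover have "H.span {fib 1} \<subseteq> carrier H"
    by (rule H.span_is_subset2) (simp add: fib_carr)
  ultimately have gen: "H.gen_set {fib 1}" by blast
  then show "H.fin_dim" unfolding H.fin_dim_def using fib_carr by (intro exI[of _ "{fib 1}"]) auto
  show "H.dim = 1"
  proof (rule H.dim1I[OF gen _ fib_carr])
    show "fib 1 \<noteq> \<zero>\<^bsub>H\<^esub>"
    proof
      assume "fib 1 = \<zero>\<^bsub>H\<^esub>"
      then have "w 1 \<in> fib 0" using w[of 1] by (simp add: zeroH)
      then show False using w[of 1] by (simp add: fib_def)
    qed
  qed
  fix T c X assume T: "\<And>f. f \<in> Z \<Longrightarrow> T f \<in> Z \<and> \<phi> (T f) = c * \<phi> f" and "X \<in> carrier H"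
  then obtain d where "X = fib d" by (auto simp: carr)
  moreover have "on_classes C B T (fib d) = fib (c * d)" by (rule on_fib) (rule T)
  ultimately show "on_classes C B T X = c \<odot>\<^bsub>H\<^esub> X" by (simp only: smult)
qed

section \<open>Second cohomology with coefficients in a linear representation\<close>

lemma tuples_1: "xs \<in> tuples G 1 \<longleftrightarrow> (\<exists>g\<in>carrier G. xs = [g])"
  by (auto simp: tuples_def length_Suc_conv)

lemma tuples_2: "xs \<in> tuples G 2 \<longleftrightarrow> (\<exists>g\<in>carrier G. \<exists>h\<in>carrier G. xs = [g, h])"
  by (auto simp: tuples_def length_Suc_conv numeral_2_eq_2)

lemma tuples_3: "xs \<in> tuples G 3 \<longleftrightarrow> (\<exists>g\<in>carrier G. \<exists>h\<in>carrier G. \<exists>k\<in>carrier G. xs = [g, h, k])"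
  by (auto simp: tuples_def length_Suc_conv numeral_3_eq_3)

lemma cochains_module:
  fixes M :: "('k::comm_ring_1, 'v, 'c) module_scheme"
  assumes "Module.module (class_ring :: 'k ring) M"
  shows "Module.module (class_ring :: 'k ring) (cochains G M q)"
proof -
  interpret M: Module.module "class_ring :: 'k ring" M by fact
  let ?C = "cochains G M q"
  have mem: "f \<in> carrier ?C \<longleftrightarrow> f \<in> extensional (tuples G q) \<and> (\<forall>xs\<in>tuples G q. f xs \<in> carrier M)" for f
    by (auto simp: cochains_def PiE_def)
  have ops: "(f \<oplus>\<^bsub>?C\<^esub> g) = (\<lambda>xs\<in>tuples G q. f xs \<oplus>\<^bsub>M\<^esub> g xs)"
    "\<zero>\<^bsub>?C\<^esub> = (\<lambda>xs\<in>tuples G q. \<zero>\<^bsub>M\<^esub>)" "c \<odot>\<^bsub>?C\<^esub> f = (\<lambda>xs\<in>tuples G q. c \<odot>\<^bsub>M\<^esub> f xs)" for f g c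
    by (simp_all add: cochains_def)
  have eqI: "f = g" if "f \<in> extensional (tuples G q)" "g \<in> extensional (tuples G q)"
    "\<And>xs. xs \<in> tuples G q \<Longrightarrow> f xs = g xs" for f g :: "'a list \<Rightarrow> 'v"
    using that by (rule extensionalityI)
  have sm: "c \<odot>\<^bsub>M\<^esub> x \<in> carrier M" if "x \<in> carrier M" for c x using that M.smult_closed[of c x] by simp
  have ab: "abelian_group ?C"
  proof (rule abelian_groupI)
    fix f assume f: "f \<in> carrier ?C"
    show "\<exists>g\<in>carrier ?C. g \<oplus>\<^bsub>?C\<^esub> f = \<zero>\<^bsub>?C\<^esub>"
      by (rule bexI[of _ "\<lambda>xs\<in>tuples G q. \<ominus>\<^bsub>M\<^esub> f xs"])
        (use f in \<open>auto simp: mem ops M.l_neg intro!: eqI\<close>)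
  qed (auto simp: mem ops M.a_ac intro!: eqI)
  show ?thesis
    by (rule Module.moduleI[OF class_cring.cring_axioms ab])
      (auto simp: mem ops sm M.smult_l_distr[simplified] M.smult_r_distr[simplified] M.smult_assoc1[simplified]
        M.smult_one[simplified] intro!: eqI)
qed

locale linear_action = group G + M: Module.module "class_ring :: 'k::field ring" M
  for G :: "('g, 'b) monoid_scheme" (structure) and M :: "('k::field, 'v, 'c) module_scheme" +
  fixes act :: "'g \<Rightarrow> 'v \<Rightarrow> 'v"
  assumes act_closed: "g \<in> carrier G \<Longrightarrow> v \<in> carrier M \<Longrightarrow> act g v \<in> carrier M"
    and act_add: "g \<in> carrier G \<Longrightarrow> v \<in> carrier M \<Longrightarrow> w \<in> carrier M
      \<Longrightarrow> act g (v \<oplus>\<^bsub>M\<^esub> w) = act g v \<oplus>\<^bsub>M\<^esub> act g w"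
    and act_smult: "g \<in> carrier G \<Longrightarrow> v \<in> carrier M \<Longrightarrow> act g (c \<odot>\<^bsub>M\<^esub> v) = c \<odot>\<^bsub>M\<^esub> act g v"
    and act_mult: "g \<in> carrier G \<Longrightarrow> h \<in> carrier G \<Longrightarrow> v \<in> carrier M \<Longrightarrow> act g (act h v) = act (g \<otimes> h) v"
    and act_one: "v \<in> carrier M \<Longrightarrow> act \<one> v = v"
begin

lemma act_minus:
  assumes "g \<in> carrier G" "v \<in> carrier M"
  shows "act g (\<ominus>\<^bsub>M\<^esub> v) = \<ominus>\<^bsub>M\<^esub> act g v"
proof -
  have "\<ominus>\<^bsub>M\<^esub> w = (- 1) \<odot>\<^bsub>M\<^esub> w" if "w \<in> carrier M" for w
    using M.smult_l_minus[of 1 w] M.smult_one[of w] that by (simp add: class_ring_simps)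
  then show ?thesis using assms by (simp add: act_smult act_closed)
qed

lemma coboundary_1:
  assumes f: "\<And>g. g \<in> carrier G \<Longrightarrow> f [g] \<in> carrier M" and gh: "g \<in> carrier G" "h \<in> carrier G"
  shows "coboundary G M act 1 f [g, h] = act g (f [h]) \<ominus>\<^bsub>M\<^esub> f [g \<otimes> h] \<oplus>\<^bsub>M\<^esub> f [g]"
proof -
  have "[g, h] \<in> tuples G (1 + 1)" using gh by (simp add: tuples_def)
  then have "coboundary G M act 1 f [g, h] = act g (f [h])
      \<oplus>\<^bsub>M\<^esub> (\<Oplus>\<^bsub>M\<^esub>i\<in>{1..1}. [((-1) ^ i :: int)] \<cdot>\<^bsub>M\<^esub> f (merge_at G i [g, h]))
      \<oplus>\<^bsub>M\<^esub> [((-1) ^ (1 + 1) :: int)] \<cdot>\<^bsub>M\<^esub> f [g]"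
    by (simp add: coboundary_def)
  also have "(\<Oplus>\<^bsub>M\<^esub>i\<in>{1..1}. [((-1) ^ i :: int)] \<cdot>\<^bsub>M\<^esub> f (merge_at G i [g, h])) = \<ominus>\<^bsub>M\<^esub> f [g \<otimes> h]"
    using f gh by (simp add: merge_at_def add_pow_int_lt)
  also have "[((-1) ^ (1 + 1) :: int)] \<cdot>\<^bsub>M\<^esub> f [g] = f [g]"
    using f gh by (simp add: add_pow_int_ge)
  finally show ?thesis by (simp add: M.minus_eq)
qed

lemma coboundary_2:
  assumes f: "\<And>g h. g \<in> carrier G \<Longrightarrow> h \<in> carrier G \<Longrightarrow> f [g, h] \<in> carrier M"
    and ghk: "g \<in> carrier G" "h \<in> carrier G" "k \<in> carrier G"
  shows "coboundary G M act 2 f [g, h, k]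
    = act g (f [h, k]) \<oplus>\<^bsub>M\<^esub> (\<ominus>\<^bsub>M\<^esub> f [g \<otimes> h, k] \<oplus>\<^bsub>M\<^esub> f [g, h \<otimes> k]) \<ominus>\<^bsub>M\<^esub> f [g, h]"
proof -
  have "[g, h, k] \<in> tuples G (2 + 1)" using ghk by (simp add: tuples_def)
  then have "coboundary G M act 2 f [g, h, k] = act g (f [h, k])
      \<oplus>\<^bsub>M\<^esub> (\<Oplus>\<^bsub>M\<^esub>i\<in>{1..2}. [((-1) ^ i :: int)] \<cdot>\<^bsub>M\<^esub> f (merge_at G i [g, h, k]))
      \<oplus>\<^bsub>M\<^esub> [((-1) ^ (2 + 1) :: int)] \<cdot>\<^bsub>M\<^esub> f [g, h]"
    by (simp add: coboundary_def)
  also have "(\<Oplus>\<^bsub>M\<^esub>i\<in>{1..2}. [((-1) ^ i :: int)] \<cdot>\<^bsub>M\<^esub> f (merge_at G i [g, h, k]))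
      = \<ominus>\<^bsub>M\<^esub> f [g \<otimes> h, k] \<oplus>\<^bsub>M\<^esub> f [g, h \<otimes> k]"
  proof -
    have 12: "{1..2} = {1, 2 :: nat}" by auto
    have t1: "[((-1) ^ 1 :: int)] \<cdot>\<^bsub>M\<^esub> f (merge_at G 1 [g, h, k]) = \<ominus>\<^bsub>M\<^esub> f [g \<otimes> h, k]"
      using f ghk by (simp add: merge_at_def add_pow_int_lt)
    have t2: "[((-1) ^ 2 :: int)] \<cdot>\<^bsub>M\<^esub> f (merge_at G 2 [g, h, k]) = f [g, h \<otimes> k]"
      using f ghk by (simp add: merge_at_def add_pow_int_ge)
    show ?thesis
      unfolding 12 using f ghk t1 t2 by (subst M.finsum_insert) (auto simp del: One_nat_def)
  qed
  also have "[((-1) ^ (2 + 1) :: int)] \<cdot>\<^bsub>M\<^esub> f [g, h] = \<ominus>\<^bsub>M\<^esub> f [g, h]"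
    using f ghk by (simp add: add_pow_int_lt)
  finally show ?thesis by (simp add: M.minus_eq)
qed

section \<open>Cocycles and coboundaries in degree two\<close>

lemma cochain_1_iff:
  "f \<in> carrier (cochains G M 1) \<longleftrightarrow> f \<in> extensional (tuples G 1) \<and> (\<forall>g\<in>carrier G. f [g] \<in> carrier M)"
  by (auto simp: cochains_def PiE_def tuples_1 simp del: One_nat_def)

lemma cochain_2_iff:
  "f \<in> carrier (cochains G M 2) \<longleftrightarrow>
    f \<in> extensional (tuples G 2) \<and> (\<forall>g\<in>carrier G. \<forall>h\<in>carrier G. f [g, h] \<in> carrier M)"
  by (auto simp: cochains_def PiE_def tuples_2)

text \<open>Moving the negative terms to the other side gives the identity without subtraction, the
  form in which it expresses associativity of the extension defined by f.\<close>

lemma cocycle_2_iff: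
  "f \<in> cocycles G M act 2 \<longleftrightarrow> f \<in> carrier (cochains G M 2) \<and>
    (\<forall>g\<in>carrier G. \<forall>h\<in>carrier G. \<forall>k\<in>carrier G.
      act g (f [h, k]) \<oplus>\<^bsub>M\<^esub> f [g, h \<otimes> k] = f [g \<otimes> h, k] \<oplus>\<^bsub>M\<^esub> f [g, h])"
proof -
  have key: "coboundary G M act 2 f [g, h, k] = \<zero>\<^bsub>M\<^esub> \<longleftrightarrow>
      act g (f [h, k]) \<oplus>\<^bsub>M\<^esub> f [g, h \<otimes> k] = f [g \<otimes> h, k] \<oplus>\<^bsub>M\<^esub> f [g, h]"
    if f: "f \<in> carrier (cochains G M 2)" and ghk: "g \<in> carrier G" "h \<in> carrier G" "k \<in> carrier G" for g h k
  proof -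
    have fc: "\<And>g h. g \<in> carrier G \<Longrightarrow> h \<in> carrier G \<Longrightarrow> f [g, h] \<in> carrier M"
      using f by (simp add: cochain_2_iff)
    have cl: "act g (f [h, k]) \<in> carrier M" "f [g, h \<otimes> k] \<in> carrier M" "f [g \<otimes> h, k] \<in> carrier M" "f [g, h] \<in> carrier M"
      using fc ghk act_closed by auto
    have "coboundary G M act 2 f [g, h, k]
        = (act g (f [h, k]) \<oplus>\<^bsub>M\<^esub> f [g, h \<otimes> k]) \<ominus>\<^bsub>M\<^esub> (f [g \<otimes> h, k] \<oplus>\<^bsub>M\<^esub> f [g, h])"
      using coboundary_2[of f, OF fc ghk] cl by (simp add: M.minus_eq M.minus_add M.a_ac)
    then show ?thesis using cl by simp
  qed
  have "coboundary G M act 2 f = \<zero>\<^bsub>cochains G M (2 + 1)\<^esub> \<longleftrightarrow>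
      (\<forall>g\<in>carrier G. \<forall>h\<in>carrier G. \<forall>k\<in>carrier G. coboundary G M act 2 f [g, h, k] = \<zero>\<^bsub>M\<^esub>)"
    (is "?l \<longleftrightarrow> ?r")
  proof
    assume ?l
    then show ?r by (auto simp: cochains_def tuples_3)
  next
    assume r: ?r
    show ?l
    proof (rule extensionalityI[of _ "tuples G (2 + 1)"])
      fix xs assume "xs \<in> tuples G (2 + 1)"
      then show "coboundary G M act 2 f xs = \<zero>\<^bsub>cochains G M (2 + 1)\<^esub> xs"
        using r by (auto simp: cochains_def tuples_3)
    qed (auto simp: coboundary_def cochains_def)
  qed
  then show ?thesis using key by (auto simp: cocycles_def)
qed

lemma coboundaries_2: "coboundaries G M act 2 = coboundary G M act 1 ` carrier (cochains G M 1)"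
  by (simp add: coboundaries_def numeral_2_eq_2)

text \<open>Allows a plain function on group elements, such as the one coming from a split
  extension, to serve as a 1-cochain without the list encoding and extensionality.\<close>

lemma coboundaries_2_iff:
  "f \<in> coboundaries G M act 2 \<longleftrightarrow> f \<in> extensional (tuples G 2) \<and>
    (\<exists>s. (\<forall>g\<in>carrier G. s g \<in> carrier M) \<and>
      (\<forall>g\<in>carrier G. \<forall>h\<in>carrier G. f [g, h] = act g (s h) \<ominus>\<^bsub>M\<^esub> s (g \<otimes> h) \<oplus>\<^bsub>M\<^esub> s g))"
  (is "?l \<longleftrightarrow> ?r")
proof
  assume ?l
  then obtain u where u: "u \<in> carrier (cochains G M 1)" "f = coboundary G M act 1 u"
    unfolding coboundaries_2 by blast
  then have uc: "\<And>g. g \<in> carrier G \<Longrightarrow> u [g] \<in> carrier M" unfolding cochain_1_iff by blast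
  have "f \<in> extensional (tuples G 2)" unfolding u(2) by (simp add: coboundary_def numeral_2_eq_2)
  then show ?r using uc coboundary_1[of u, OF uc] unfolding u(2)
    by (intro conjI exI[of _ "\<lambda>g. u [g]"]) auto
next
  assume ?r
  then obtain s where f: "f \<in> extensional (tuples G 2)" and s: "\<And>g. g \<in> carrier G \<Longrightarrow> s g \<in> carrier M"
    and fs: "\<And>g h. g \<in> carrier G \<Longrightarrow> h \<in> carrier G \<Longrightarrow> f [g, h] = act g (s h) \<ominus>\<^bsub>M\<^esub> s (g \<otimes> h) \<oplus>\<^bsub>M\<^esub> s g"
    by blast
  define u where "u = (\<lambda>xs\<in>tuples G 1. s (hd xs))"
  have ug: "u [g] = s g" if "g \<in> carrier G" for g using that tuples_1[of "[g]" G] by (simp add: u_def)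
  have "u \<in> extensional (tuples G 1)" by (simp add: u_def)
  then have "u \<in> carrier (cochains G M 1)" unfolding cochain_1_iff using s ug by simp
  moreover have "f = coboundary G M act 1 u"
  proof (rule extensionalityI[OF f])
    show "coboundary G M act 1 u \<in> extensional (tuples G 2)" by (simp add: coboundary_def numeral_2_eq_2)
    fix xs assume "xs \<in> tuples G 2"
    then obtain g h where "xs = [g, h]" "g \<in> carrier G" "h \<in> carrier G" by (auto simp: tuples_2)
    then show "f xs = coboundary G M act 1 u xs"
      using fs s ug coboundary_1[of u g h] by simp
  qed
  ultimately show ?l unfolding coboundaries_2 by blast
qed

lemma coboundaries_2_subset: "coboundaries G M act 2 \<subseteq> cocycles G M act 2"
proof
  fix f assume "f \<in> coboundaries G M act 2"
  then obtain s where f: "f \<in> extensional (tuples G 2)" and s: "\<And>g. g \<in> carrier G \<Longrightarrow> s g \<in> carrier M"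
    and fs: "\<And>g h. g \<in> carrier G \<Longrightarrow> h \<in> carrier G \<Longrightarrow> f [g, h] = act g (s h) \<ominus>\<^bsub>M\<^esub> s (g \<otimes> h) \<oplus>\<^bsub>M\<^esub> s g"
    unfolding coboundaries_2_iff by blast
  show "f \<in> cocycles G M act 2"
    unfolding cocycle_2_iff cochain_2_iff
  proof (intro conjI ballI f)
    fix g h assume "g \<in> carrier G" "h \<in> carrier G"
    then show "f [g, h] \<in> carrier M" using s act_closed by (simp add: fs)
  next
    fix g h k assume ghk: "g \<in> carrier G" "h \<in> carrier G" "k \<in> carrier G"
    define a b c d p q where "a = act (g \<otimes> h) (s k)" "b = act g (s h)" "c = s (g \<otimes> h \<otimes> k)" "d = s g"
      "p = act g (s (h \<otimes> k))" "q = s (g \<otimes> h)"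
    note defs = this
    have cl: "a \<in> carrier M" "b \<in> carrier M" "c \<in> carrier M" "d \<in> carrier M" "p \<in> carrier M" "q \<in> carrier M"
      using ghk s act_closed by (auto simp: defs)
    \<comment> \<open>The identity telescopes: \<open>p\<close> cancels between the two terms of one
      side, and \<open>q\<close> is inserted to separate the two terms of the other.\<close>
    have "act g (f [h, k]) \<oplus>\<^bsub>M\<^esub> f [g, h \<otimes> k] = (a \<ominus>\<^bsub>M\<^esub> p \<oplus>\<^bsub>M\<^esub> b) \<oplus>\<^bsub>M\<^esub> (p \<ominus>\<^bsub>M\<^esub> c \<oplus>\<^bsub>M\<^esub> d)"
      using ghk s act_closed by (simp add: fs defs act_add act_minus act_mult M.minus_eq m_assoc)
    also have "\<dots> = (a \<ominus>\<^bsub>M\<^esub> c \<oplus>\<^bsub>M\<^esub> b \<oplus>\<^bsub>M\<^esub> d) \<oplus>\<^bsub>M\<^esub> (p \<ominus>\<^bsub>M\<^esub> p)"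
      using cl by (simp only: M.minus_eq M.a_ac M.a_inv_closed M.add.m_closed)
    also have "\<dots> = (a \<ominus>\<^bsub>M\<^esub> c \<oplus>\<^bsub>M\<^esub> b \<oplus>\<^bsub>M\<^esub> d) \<oplus>\<^bsub>M\<^esub> (q \<ominus>\<^bsub>M\<^esub> q)"
      using cl by (simp add: M.minus_eq M.r_neg)
    also have "\<dots> = (a \<ominus>\<^bsub>M\<^esub> c \<oplus>\<^bsub>M\<^esub> q) \<oplus>\<^bsub>M\<^esub> (b \<ominus>\<^bsub>M\<^esub> q \<oplus>\<^bsub>M\<^esub> d)"
      using cl by (simp only: M.minus_eq M.a_ac M.a_inv_closed M.add.m_closed)
    also have "\<dots> = f [g \<otimes> h, k] \<oplus>\<^bsub>M\<^esub> f [g, h]"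
      using ghk by (simp add: fs defs)
    finally show "act g (f [h, k]) \<oplus>\<^bsub>M\<^esub> f [g, h \<otimes> k] = f [g \<otimes> h, k] \<oplus>\<^bsub>M\<^esub> f [g, h]" .
  qed
qed

lemma cochain_2_add:
  "g \<in> carrier G \<Longrightarrow> h \<in> carrier G \<Longrightarrow> (f \<oplus>\<^bsub>cochains G M 2\<^esub> f') [g, h] = f [g, h] \<oplus>\<^bsub>M\<^esub> f' [g, h]"
  using tuples_2[of "[g, h]" G] by (simp add: cochains_def)

lemma cochain_2_smult:
  "g \<in> carrier G \<Longrightarrow> h \<in> carrier G \<Longrightarrow> (c \<odot>\<^bsub>cochains G M 2\<^esub> f) [g, h] = c \<odot>\<^bsub>M\<^esub> f [g, h]"
  using tuples_2[of "[g, h]" G] by (simp add: cochains_def)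

lemma cocycles_2_add:
  assumes f: "f \<in> cocycles G M act 2" and f': "f' \<in> cocycles G M act 2"
  shows "f \<oplus>\<^bsub>cochains G M 2\<^esub> f' \<in> cocycles G M act 2"
  unfolding cocycle_2_iff
proof (intro conjI ballI)
  interpret C: Module.module "class_ring :: 'k ring" "cochains G M 2"
    by (rule cochains_module) (rule M.module_axioms)
  show "f \<oplus>\<^bsub>cochains G M 2\<^esub> f' \<in> carrier (cochains G M 2)"
    using f f' by (simp add: cocycle_2_iff)
  fix g h k assume ghk: "g \<in> carrier G" "h \<in> carrier G" "k \<in> carrier G"
  have c: "\<And>g h. g \<in> carrier G \<Longrightarrow> h \<in> carrier G \<Longrightarrow> f [g, h] \<in> carrier M"
    "\<And>g h. g \<in> carrier G \<Longrightarrow> h \<in> carrier G \<Longrightarrow> f' [g, h] \<in> carrier M"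
    using f f' by (auto simp: cocycle_2_iff cochain_2_iff)
  have e: "act g (f [h, k]) \<oplus>\<^bsub>M\<^esub> f [g, h \<otimes> k] = f [g \<otimes> h, k] \<oplus>\<^bsub>M\<^esub> f [g, h]"
    "act g (f' [h, k]) \<oplus>\<^bsub>M\<^esub> f' [g, h \<otimes> k] = f' [g \<otimes> h, k] \<oplus>\<^bsub>M\<^esub> f' [g, h]"
    using f f' ghk by (auto simp: cocycle_2_iff)
  have "act g (f [h, k] \<oplus>\<^bsub>M\<^esub> f' [h, k]) \<oplus>\<^bsub>M\<^esub> (f [g, h \<otimes> k] \<oplus>\<^bsub>M\<^esub> f' [g, h \<otimes> k])
      = (act g (f [h, k]) \<oplus>\<^bsub>M\<^esub> f [g, h \<otimes> k]) \<oplus>\<^bsub>M\<^esub> (act g (f' [h, k]) \<oplus>\<^bsub>M\<^esub> f' [g, h \<otimes> k])"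
    using ghk c act_closed by (simp add: act_add M.a_ac)
  also have "\<dots> = (f [g \<otimes> h, k] \<oplus>\<^bsub>M\<^esub> f' [g \<otimes> h, k]) \<oplus>\<^bsub>M\<^esub> (f [g, h] \<oplus>\<^bsub>M\<^esub> f' [g, h])"
    unfolding e using ghk c by (simp add: M.a_ac)
  finally show "act g ((f \<oplus>\<^bsub>cochains G M 2\<^esub> f') [h, k]) \<oplus>\<^bsub>M\<^esub> (f \<oplus>\<^bsub>cochains G M 2\<^esub> f') [g, h \<otimes> k]
      = (f \<oplus>\<^bsub>cochains G M 2\<^esub> f') [g \<otimes> h, k] \<oplus>\<^bsub>M\<^esub> (f \<oplus>\<^bsub>cochains G M 2\<^esub> f') [g, h]"
    using ghk by (simp add: cochain_2_add)
qed

lemma cocycles_2_smult: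
  assumes f: "f \<in> cocycles G M act 2"
  shows "c \<odot>\<^bsub>cochains G M 2\<^esub> f \<in> cocycles G M act 2"
  unfolding cocycle_2_iff
proof (intro conjI ballI)
  interpret C: Module.module "class_ring :: 'k ring" "cochains G M 2"
    by (rule cochains_module) (rule M.module_axioms)
  show "c \<odot>\<^bsub>cochains G M 2\<^esub> f \<in> carrier (cochains G M 2)"
    using f C.smult_closed[of c f] by (simp add: cocycle_2_iff)
  fix g h k assume ghk: "g \<in> carrier G" "h \<in> carrier G" "k \<in> carrier G"
  have fc: "\<And>g h. g \<in> carrier G \<Longrightarrow> h \<in> carrier G \<Longrightarrow> f [g, h] \<in> carrier M"
    using f by (auto simp: cocycle_2_iff cochain_2_iff)
  have e: "act g (f [h, k]) \<oplus>\<^bsub>M\<^esub> f [g, h \<otimes> k] = f [g \<otimes> h, k] \<oplus>\<^bsub>M\<^esub> f [g, h]"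
    using f ghk by (auto simp: cocycle_2_iff)
  have r: "c \<odot>\<^bsub>M\<^esub> (x \<oplus>\<^bsub>M\<^esub> y) = c \<odot>\<^bsub>M\<^esub> x \<oplus>\<^bsub>M\<^esub> c \<odot>\<^bsub>M\<^esub> y" if "x \<in> carrier M" "y \<in> carrier M" for x y
    using M.smult_r_distr[of c x y] that by simp
  have "act g (c \<odot>\<^bsub>M\<^esub> f [h, k]) \<oplus>\<^bsub>M\<^esub> c \<odot>\<^bsub>M\<^esub> f [g, h \<otimes> k] = c \<odot>\<^bsub>M\<^esub> (act g (f [h, k]) \<oplus>\<^bsub>M\<^esub> f [g, h \<otimes> k])"
    using ghk fc act_closed by (simp add: act_smult r)
  also have "\<dots> = c \<odot>\<^bsub>M\<^esub> f [g \<otimes> h, k] \<oplus>\<^bsub>M\<^esub> c \<odot>\<^bsub>M\<^esub> f [g, h]"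
    unfolding e using ghk fc by (simp add: r)
  finally show "act g ((c \<odot>\<^bsub>cochains G M 2\<^esub> f) [h, k]) \<oplus>\<^bsub>M\<^esub> (c \<odot>\<^bsub>cochains G M 2\<^esub> f) [g, h \<otimes> k]
      = (c \<odot>\<^bsub>cochains G M 2\<^esub> f) [g \<otimes> h, k] \<oplus>\<^bsub>M\<^esub> (c \<odot>\<^bsub>cochains G M 2\<^esub> f) [g, h]"
    using ghk by (simp add: cochain_2_smult)
qed

text \<open>The functional is evaluation on the fundamental class of the torus, followed by the projection
  to the coinvariants.\<close>

lemma coboundaries_2_eq_kernel:
  assumes p_add: "\<And>v w. v \<in> carrier M \<Longrightarrow> w \<in> carrier M \<Longrightarrow> p (v \<oplus>\<^bsub>M\<^esub> w) = p v + (p w :: 'k)"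
    and p_inv: "\<And>g v. g \<in> carrier G \<Longrightarrow> v \<in> carrier M \<Longrightarrow> p (act g v) = p v"
    and p_ker: "\<And>v. v \<in> carrier M \<Longrightarrow> p v = 0
      \<Longrightarrow> \<exists>y\<in>carrier M. \<exists>z\<in>carrier M. v \<oplus>\<^bsub>M\<^esub> act e1 y \<oplus>\<^bsub>M\<^esub> z = y \<oplus>\<^bsub>M\<^esub> act e2 z"
    and e: "e1 \<in> carrier G" "e2 \<in> carrier G" "e1 \<otimes> e2 = e2 \<otimes> e1"
    and \<mu>: "\<And>g h. g \<in> carrier G \<Longrightarrow> h \<in> carrier G \<Longrightarrow> \<mu> (g \<otimes> h) = \<mu> g + (\<mu> h :: int)"
    and \<nu>: "\<And>g h. g \<in> carrier G \<Longrightarrow> h \<in> carrier G \<Longrightarrow> \<nu> (g \<otimes> h) = \<nu> g + (\<nu> h :: int)"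
    and basis: "\<And>g. g \<in> carrier G \<Longrightarrow> g = e1 [^] \<mu> g \<otimes> e2 [^] \<nu> g"
  shows "coboundaries G M act 2 = {f \<in> cocycles G M act 2. p (f [e1, e2]) - p (f [e2, e1]) = 0}"
proof (intro equalityI subsetI)
  have p_minus: "p (\<ominus>\<^bsub>M\<^esub> v) = - p v" if "v \<in> carrier M" for v
  proof -
    have "p \<zero>\<^bsub>M\<^esub> + p \<zero>\<^bsub>M\<^esub> = p \<zero>\<^bsub>M\<^esub> + 0"
      using p_add[OF M.zero_closed M.zero_closed] M.l_zero[OF M.zero_closed] by (metis add.right_neutral)
    then have "p \<zero>\<^bsub>M\<^esub> = 0" by (rule add_left_imp_eq)
    then show ?thesis using p_add[of v "\<ominus>\<^bsub>M\<^esub> v"] that by (simp add: M.r_neg eq_neg_iff_add_eq_0 add.commute)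
  qed
  fix f
  {
    assume f: "f \<in> coboundaries G M act 2"
    then obtain s where s: "\<And>g. g \<in> carrier G \<Longrightarrow> s g \<in> carrier M"
      and fs: "\<And>g h. g \<in> carrier G \<Longrightarrow> h \<in> carrier G \<Longrightarrow> f [g, h] = act g (s h) \<ominus>\<^bsub>M\<^esub> s (g \<otimes> h) \<oplus>\<^bsub>M\<^esub> s g"
      unfolding coboundaries_2_iff by blast
    \<comment> \<open>Invariance of \<open>p\<close> removes the action, and the result is symmetric
      in g and h as soon as these commute.\<close>
    have "p (f [g, h]) = p (s h) - p (s (g \<otimes> h)) + p (s g)" if "g \<in> carrier G" "h \<in> carrier G" for g h
      using that s act_closed by (simp add: fs M.minus_eq p_add p_minus p_inv)
    then have "p (f [e1, e2]) - p (f [e2, e1]) = 0" using e by simp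
    then show "f \<in> {f \<in> cocycles G M act 2. p (f [e1, e2]) - p (f [e2, e1]) = 0}"
      using f coboundaries_2_subset by blast
  next
    assume "f \<in> {f \<in> cocycles G M act 2. p (f [e1, e2]) - p (f [e2, e1]) = 0}"
    then have f: "f \<in> cocycles G M act 2" and pf: "p (f [e1, e2]) - p (f [e2, e1]) = 0" by auto
    have ext: "f \<in> extensional (tuples G 2)"
      and fc: "\<And>g h. g \<in> carrier G \<Longrightarrow> h \<in> carrier G \<Longrightarrow> f [g, h] \<in> carrier M"
      and co: "\<And>g h k. g \<in> carrier G \<Longrightarrow> h \<in> carrier G \<Longrightarrow> k \<in> carrier G
        \<Longrightarrow> act g (f [h, k]) \<oplus>\<^bsub>M\<^esub> f [g, h \<otimes> k] = f [g \<otimes> h, k] \<oplus>\<^bsub>M\<^esub> f [g, h]"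
      using f by (auto simp: cocycle_2_iff cochain_2_iff)
    have f12: "f [e1, e2] \<in> carrier M" "f [e2, e1] \<in> carrier M" using fc e by auto
    have "p (f [e1, e2] \<ominus>\<^bsub>M\<^esub> f [e2, e1]) = 0"
      using pf f12 by (simp add: M.minus_eq p_add p_minus)
    then obtain y z where yz: "y \<in> carrier M" "z \<in> carrier M"
      "(f [e1, e2] \<ominus>\<^bsub>M\<^esub> f [e2, e1]) \<oplus>\<^bsub>M\<^esub> act e1 y \<oplus>\<^bsub>M\<^esub> z = y \<oplus>\<^bsub>M\<^esub> act e2 z"
      using p_ker[of "f [e1, e2] \<ominus>\<^bsub>M\<^esub> f [e2, e1]"] f12 by auto
    have ac: "act e1 y \<in> carrier M" "act e2 z \<in> carrier M" using yz e act_closed by auto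
    \<comment> \<open>The vectors solving the coinvariant equation are the components of the lifts:
      \<open>z\<close> lies over \<open>e1\<close> and \<open>y\<close> over \<open>e2\<close>, and
      the equation says that these lifts commute.\<close>
    have "y \<oplus>\<^bsub>M\<^esub> act e2 z \<oplus>\<^bsub>M\<^esub> f [e2, e1]
        = (z \<oplus>\<^bsub>M\<^esub> act e1 y \<oplus>\<^bsub>M\<^esub> f [e1, e2]) \<oplus>\<^bsub>M\<^esub> (f [e2, e1] \<oplus>\<^bsub>M\<^esub> \<ominus>\<^bsub>M\<^esub> f [e2, e1])"
      unfolding yz(3)[symmetric] using yz(1,2) ac f12
      by (simp only: M.minus_eq M.a_ac M.a_inv_closed M.add.m_closed)
    also have "\<dots> = z \<oplus>\<^bsub>M\<^esub> act e1 y \<oplus>\<^bsub>M\<^esub> f [e1, e2]"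
      using yz(1,2) ac f12 by (simp add: M.r_neg)
    finally have comm: "z \<oplus>\<^bsub>M\<^esub> act e1 y \<oplus>\<^bsub>M\<^esub> f [e1, e2] = y \<oplus>\<^bsub>M\<^esub> act e2 z \<oplus>\<^bsub>M\<^esub> f [e2, e1]" by simp
    obtain s where s: "\<And>g. g \<in> carrier G \<Longrightarrow> s g \<in> carrier M"
      and ss: "\<And>g h. g \<in> carrier G \<Longrightarrow> h \<in> carrier G \<Longrightarrow> s g \<oplus>\<^bsub>M\<^esub> act g (s h) \<oplus>\<^bsub>M\<^esub> f [g, h] = s (g \<otimes> h)"
      by (rule cocycle_rank_two_trivial[of G M act "\<lambda>g h. f [g, h]" e1 e2 \<mu> \<nu> z y])
        (assumption | rule group_axioms M.abelian_group_axioms act_closed act_add act_mult act_one fc co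
          e \<mu> \<nu> basis yz(1,2) comm that)+
    \<comment> \<open>The section satisfies the coboundary relation with the opposite sign, so f is
      the coboundary of the negative of s.\<close>
    have "f [g, h] = act g (\<ominus>\<^bsub>M\<^esub> s h) \<ominus>\<^bsub>M\<^esub> (\<ominus>\<^bsub>M\<^esub> s (g \<otimes> h)) \<oplus>\<^bsub>M\<^esub> \<ominus>\<^bsub>M\<^esub> s g"
      if gh: "g \<in> carrier G" "h \<in> carrier G" for g h
    proof -
      define a b c where "a = act g (s h)" "b = s g" "c = f [g, h]"
      note defs = this
      have cl: "a \<in> carrier M" "b \<in> carrier M" "c \<in> carrier M" using gh s fc act_closed by (auto simp: defs)
      have "act g (\<ominus>\<^bsub>M\<^esub> s h) \<ominus>\<^bsub>M\<^esub> (\<ominus>\<^bsub>M\<^esub> s (g \<otimes> h)) \<oplus>\<^bsub>M\<^esub> \<ominus>\<^bsub>M\<^esub> s g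
          = \<ominus>\<^bsub>M\<^esub> a \<oplus>\<^bsub>M\<^esub> (b \<oplus>\<^bsub>M\<^esub> a \<oplus>\<^bsub>M\<^esub> c) \<oplus>\<^bsub>M\<^esub> \<ominus>\<^bsub>M\<^esub> b"
        using gh s fc act_closed unfolding ss[OF gh, symmetric] by (simp add: defs act_minus M.minus_eq)
      also have "\<dots> = c \<oplus>\<^bsub>M\<^esub> ((a \<oplus>\<^bsub>M\<^esub> \<ominus>\<^bsub>M\<^esub> a) \<oplus>\<^bsub>M\<^esub> (b \<oplus>\<^bsub>M\<^esub> \<ominus>\<^bsub>M\<^esub> b))"
        using cl by (simp only: M.minus_eq M.a_ac M.a_inv_closed M.add.m_closed)
      also have "\<dots> = c" using cl by (simp add: M.r_neg)
      finally show ?thesis by (simp add: defs)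
    qed
    then show "f \<in> coboundaries G M act 2"
      unfolding coboundaries_2_iff using ext s by (intro conjI exI[of _ "\<lambda>g. \<ominus>\<^bsub>M\<^esub> s g"]) auto
  }
qed

end

section \<open>The groups SL(2) and PSL(2)\<close>

lemma less_2_cases_nat: "(i::nat) < 2 \<longleftrightarrow> i = 0 \<or> i = 1"
  by auto

lemma mat2_dim [simp]: "dim_row (mat2 a b c d) = 2" "dim_col (mat2 a b c d) = 2"
  using mat2_carrier[of a b c d] by (auto simp del: mat2_carrier)

lemma mat2_eqI:
  assumes "A \<in> carrier_mat 2 2" "A $$ (0, 0) = a" "A $$ (0, 1) = b" "A $$ (1, 0) = c" "A $$ (1, 1) = d"
  shows "A = mat2 a b c d"
  by (rule eq_matI) (use assms in \<open>auto simp: less_2_cases_nat\<close>)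

lemma mat2_cases:
  assumes "A \<in> carrier_mat 2 2"
  obtains a b c d where "A = mat2 a b c d"
  using mat2_eqI[OF assms refl refl refl refl] by blast

lemma mat2_inject: "mat2 a b c d = mat2 a' b' c' d' \<longleftrightarrow> a = a' \<and> b = b' \<and> c = c' \<and> d = d'"
  by (metis mat2_index(1-4))

lemma mat2_mult:
  fixes a b c d :: "'a::comm_ring_1"
  shows "mat2 a b c d * mat2 a' b' c' d'
    = mat2 (a * a' + b * c') (a * b' + b * d') (c * a' + d * c') (c * b' + d * d')"
proof -
  have S: "(\<Sum>i\<in>{0..<2}. f i) = f 0 + f (Suc 0)" for f :: "nat \<Rightarrow> 'a"
    by (simp add: numeral_2_eq_2)
  show ?thesis
    by (rule mat2_eqI[OF mult_carrier_mat[OF mat2_carrier mat2_carrier]]) (simp_all add: scalar_prod_def S)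
qed

lemma mat2_uminus: "- mat2 a b c d = mat2 (- a) (- b) (- c) (- (d :: 'a::comm_ring_1))"
  by (rule mat2_eqI) auto

lemma one_mat2: "1\<^sub>m 2 = mat2 1 0 0 (1 :: 'a::comm_ring_1)"
  by (rule mat2_eqI) auto

lemma map_mat_mat2: "map_mat f (mat2 a b c d) = mat2 (f a) (f b) (f c) (f d)"
  by (rule mat2_eqI) auto

lemma elements_mat2: "elements_mat (mat2 a b c d) = {a, b, c, d}"
  by (auto simp: elements_mat_def numeral_2_eq_2)

lemma det_mat2: "det (mat2 a b c d) = a * d - b * (c :: 'a::comm_ring_1)"
proof -
  have 2: "{..<2::nat} = {0, 1}" by auto
  have del: "det (mat_delete (mat2 a b c d) 0 0) = d" "det (mat_delete (mat2 a b c d) 0 1) = c"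
    by (subst det_single; simp add: mat_delete_def)+
  have "det (mat2 a b c d) = (\<Sum>j<2. mat2 a b c d $$ (0, j) * cofactor (mat2 a b c d) 0 j)"
    by (rule laplace_expansion_row) simp_all
  also have "\<dots> = a * d - b * c"
    unfolding 2 cofactor_def by (simp add: del del: One_nat_def)
  finally show ?thesis .
qed

lemma SL2_carrier_iff:
  "g \<in> carrier (SL2 A) \<longleftrightarrow>
    (\<exists>a\<in>A. \<exists>b\<in>A. \<exists>c\<in>A. \<exists>d\<in>A. g = mat2 a b c d \<and> a * d - b * c = (1 :: 'a::comm_ring_1))"
proof
  assume g: "g \<in> carrier (SL2 A)"
  then have "g \<in> carrier_mat 2 2" by (simp add: SL2_def)
  then obtain a b c d where "g = mat2 a b c d" by (rule mat2_cases)
  then show "\<exists>a\<in>A. \<exists>b\<in>A. \<exists>c\<in>A. \<exists>d\<in>A. g = mat2 a b c d \<and> a * d - b * c = 1"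
    using g by (auto simp: SL2_def elements_mat2 det_mat2 mat2_inject)
next
  assume "\<exists>a\<in>A. \<exists>b\<in>A. \<exists>c\<in>A. \<exists>d\<in>A. g = mat2 a b c d \<and> a * d - b * c = 1"
  then show "g \<in> carrier (SL2 A)" by (auto simp: SL2_def elements_mat2 det_mat2)
qed

lemma SL2_cases:
  assumes "g \<in> carrier (SL2 A)"
  obtains a b c d where "a \<in> A" "b \<in> A" "c \<in> A" "d \<in> A" "g = mat2 a b c d" "a * d - b * c = 1"
  using assms unfolding SL2_carrier_iff by blast

lemma SL2_memI:
  assumes "a \<in> A" "b \<in> A" "c \<in> A" "d \<in> A" "a * d - b * c = 1"
  shows "mat2 a b c d \<in> carrier (SL2 A)"
  unfolding SL2_carrier_iff using assms by blast

lemma SL2_simps: "x \<otimes>\<^bsub>SL2 A\<^esub> y = x * y" "\<one>\<^bsub>SL2 A\<^esub> = 1\<^sub>m 2"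
  by (simp_all add: SL2_def)

lemma proj_class_eq:
  assumes "g \<in> carrier_mat 2 2"
  shows "proj_class A g = {g, - g}"
proof -
  have "- 1\<^sub>m 2 * g = - g" using assms uminus_mult_left_mat[of "1\<^sub>m 2" g] by simp
  then show ?thesis
    using assms by (auto simp: proj_class_def r_coset_def pm_one_def SL2_simps)
qed

lemma proj_class_one: "\<one>\<^bsub>PSL2 A\<^esub> = proj_class A (1\<^sub>m 2)"
  by (simp add: PSL2_def FactGroup_def proj_class_eq pm_one_def)

lemma proj_class_carrier: "g \<in> carrier (SL2 A) \<Longrightarrow> proj_class A g \<in> carrier (PSL2 A)"
  by (auto simp: PSL2_def FactGroup_def RCOSETS_def proj_class_def)

locale unital_subring =
  fixes A :: "'a::comm_ring_1 set"
  assumes A_one: "1 \<in> A" and A_add: "x \<in> A \<Longrightarrow> y \<in> A \<Longrightarrow> x + y \<in> A"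
    and A_mult: "x \<in> A \<Longrightarrow> y \<in> A \<Longrightarrow> x * y \<in> A" and A_minus: "x \<in> A \<Longrightarrow> - x \<in> A"
begin

lemma A_zero: "0 \<in> A"
  using A_add[OF A_one A_minus[OF A_one]] by simp

lemma SL2_group: "group (SL2 A)"
proof (rule groupI)
  fix x y assume x: "x \<in> carrier (SL2 A)" and y: "y \<in> carrier (SL2 A)"
  obtain a b c d where 1: "a \<in> A" "b \<in> A" "c \<in> A" "d \<in> A" "x = mat2 a b c d" "a * d - b * c = 1"
    using x by (rule SL2_cases)
  obtain a' b' c' d' where 2: "a' \<in> A" "b' \<in> A" "c' \<in> A" "d' \<in> A" "y = mat2 a' b' c' d'" "a' * d' - b' * c' = 1"
    using y by (rule SL2_cases)
  have "(a * a' + b * c') * (c * b' + d * d') - (a * b' + b * d') * (c * a' + d * c')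
      = (a * d - b * c) * (a' * d' - b' * c')"
    by (simp add: algebra_simps)
  then have det: "(a * a' + b * c') * (c * b' + d * d') - (a * b' + b * d') * (c * a' + d * c') = 1"
    by (simp only: 1(6) 2(6) mult_1_left)
  show "x \<otimes>\<^bsub>SL2 A\<^esub> y \<in> carrier (SL2 A)"
    unfolding SL2_simps 1(5) 2(5) mat2_mult
    by (intro SL2_memI det A_add A_mult 1 2)
next
  show "\<one>\<^bsub>SL2 A\<^esub> \<in> carrier (SL2 A)"
    unfolding SL2_simps one_mat2 by (intro SL2_memI A_one A_zero) simp
next
  fix x y z assume "x \<in> carrier (SL2 A)" "y \<in> carrier (SL2 A)" "z \<in> carrier (SL2 A)"
  then have "x \<in> carrier_mat 2 2" "y \<in> carrier_mat 2 2" "z \<in> carrier_mat 2 2" by (simp_all add: SL2_def)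
  then show "x \<otimes>\<^bsub>SL2 A\<^esub> y \<otimes>\<^bsub>SL2 A\<^esub> z = x \<otimes>\<^bsub>SL2 A\<^esub> (y \<otimes>\<^bsub>SL2 A\<^esub> z)"
    unfolding SL2_simps by (rule assoc_mult_mat)
next
  fix x assume x: "x \<in> carrier (SL2 A)"
  then show "\<one>\<^bsub>SL2 A\<^esub> \<otimes>\<^bsub>SL2 A\<^esub> x = x" by (auto simp: SL2_def)
  obtain a b c d where h: "a \<in> A" "b \<in> A" "c \<in> A" "d \<in> A" "x = mat2 a b c d" "a * d - b * c = 1"
    using x by (rule SL2_cases)
  have "mat2 d (- b) (- c) a \<in> carrier (SL2 A)"
    by (intro SL2_memI A_minus h(1-4)) (use h(6) in \<open>simp add: mult.commute\<close>)
  moreover have "mat2 d (- b) (- c) a \<otimes>\<^bsub>SL2 A\<^esub> x = \<one>\<^bsub>SL2 A\<^esub>"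
    unfolding SL2_simps h(5) mat2_mult one_mat2 mat2_inject
    using h(6) by (simp add: mult.commute)
  ultimately show "\<exists>y\<in>carrier (SL2 A). y \<otimes>\<^bsub>SL2 A\<^esub> x = \<one>\<^bsub>SL2 A\<^esub>" by blast
qed

lemma pm_one_normal: "pm_one \<lhd> SL2 A"
proof -
  interpret group "SL2 A" by (rule SL2_group)
  have mone: "- 1\<^sub>m 2 \<in> carrier (SL2 A)" "- 1\<^sub>m 2 * - 1\<^sub>m 2 = (1\<^sub>m 2 :: 'a mat)"
    using A_one A_zero A_minus[OF A_one] by (simp_all add: one_mat2 mat2_uminus mat2_mult SL2_memI)
  have sub: "pm_one \<subseteq> carrier (SL2 A)"
    using mone one_closed by (auto simp: pm_one_def SL2_simps)
  have inv_mone: "inv\<^bsub>SL2 A\<^esub> (- 1\<^sub>m 2) = - 1\<^sub>m 2" "inv\<^bsub>SL2 A\<^esub> (1\<^sub>m 2) = 1\<^sub>m 2"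
    using inv_equality[of "- 1\<^sub>m 2" "- 1\<^sub>m 2"] mone inv_one by (simp_all add: SL2_simps)
  have "subgroup pm_one (SL2 A)"
  proof
    fix x y :: "'a mat" assume "x \<in> pm_one" "y \<in> (pm_one :: 'a mat set)"
    then show "x \<otimes>\<^bsub>SL2 A\<^esub> y \<in> pm_one" using mone(2) by (auto simp: pm_one_def SL2_simps)
  next
    fix x assume "x \<in> (pm_one :: 'a mat set)"
    then show "inv\<^bsub>SL2 A\<^esub> x \<in> pm_one" using inv_mone by (auto simp: pm_one_def)
  qed (use sub in \<open>auto simp: pm_one_def SL2_simps\<close>)
  moreover have "pm_one #>\<^bsub>SL2 A\<^esub> x = x <#\<^bsub>SL2 A\<^esub> pm_one" if "x \<in> carrier (SL2 A)" for x
  proof -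
    have x: "x \<in> carrier_mat 2 2" using that by (simp add: SL2_def)
    have "x * - 1\<^sub>m 2 = - x" using x uminus_mult_right_mat[of x "1\<^sub>m 2"] by simp
    then have "x <#\<^bsub>SL2 A\<^esub> pm_one = {x, - x}"
      using x by (auto simp: l_coset_def pm_one_def SL2_simps)
    then show ?thesis using proj_class_eq[OF x] by (simp add: proj_class_def)
  qed
  ultimately show ?thesis by (intro normalI) auto
qed

lemma PSL2_group: "group (PSL2 A)"
  unfolding PSL2_def by (rule normal.factorgroup_is_group[OF pm_one_normal])

lemma proj_class_mult:
  assumes "g \<in> carrier (SL2 A)" "h \<in> carrier (SL2 A)"
  shows "proj_class A g \<otimes>\<^bsub>PSL2 A\<^esub> proj_class A h = proj_class A (g * h)"
  using normal.rcos_sum[OF pm_one_normal assms] by (simp add: PSL2_def proj_class_def FactGroup_def SL2_simps)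

text \<open>Modulo signs the diagonal can be normalised to 1, at the cost of replacing u by -u; this
  identifies U with the additive group of A.\<close>

lemma lower_unipotents_eq: "lower_unipotents A = (\<lambda>u. proj_class A (mat2 1 0 u 1)) ` A"
proof -
  have "proj_class A (mat2 (- 1) 0 u (- 1)) = proj_class A (mat2 1 0 (- u) 1)" for u
    using mat2_uminus[of "- 1" 0 u "- 1"] mat2_uminus[of 1 0 "- u" 1] by (auto simp: proj_class_eq)
  then show ?thesis
    by (auto simp: lower_unipotents_def intro: A_minus)
qed

end

section \<open>Diagonal and unipotent operators\<close>

lemma neg_one_power_parity:
  assumes "m mod 2 = n mod (2::nat)"
  shows "(- 1 :: complex) ^ m * (- 1) ^ n = 1"
  using assms by (cases "even m"; cases "even n") (auto simp: odd_iff_mod_2_eq_one even_iff_mod_2_eq_zero)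

text \<open>The symmetric power of the relation n(x) t^(-1) = t^(-1) n(e^2 x) for t^(-1) = diag(e,
  1/e). On entries it amounts to e^(l - 2j) = e^(l - 2i) e^(2(i - j)).\<close>

lemma sym_rep_diagonal_unip:
  assumes "e \<noteq> 0"
  shows "unip l x * sym_rep l (mat2 e 0 0 (inverse e)) = sym_rep l (mat2 e 0 0 (inverse e)) * unip l (e * e * x)"
proof (rule eq_matI)
  let ?D = "sym_rep l (mat2 e 0 0 (inverse e))"
  fix i j assume "i < dim_row (?D * unip l (e * e * x))" "j < dim_col (?D * unip l (e * e * x))"
  then have ij: "i \<le> l" "j \<le> l" by (simp_all add: sym_rep_def unip_def)
  have D: "?D \<in> carrier_mat (Suc l) (Suc l)" by simp
  have U: "unip l y \<in> carrier_mat (Suc l) (Suc l)" for y by simp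
  have prod: "(A * B) $$ (i, j) = (\<Sum>k\<in>{0..<Suc l}. A $$ (i, k) * B $$ (k, j))"
    if "A \<in> carrier_mat (Suc l) (Suc l)" "B \<in> carrier_mat (Suc l) (Suc l)" for A B :: "complex mat"
    using that ij by (simp add: scalar_prod_def)
  have "(unip l x * ?D) $$ (i, j) = (\<Sum>k\<in>{0..<Suc l}. unip l x $$ (i, k) * ?D $$ (k, j))"
    by (rule prod[OF U D])
  also have "\<dots> = (\<Sum>k\<in>{0..<Suc l}. if k = j then unip l x $$ (i, j) * ?D $$ (j, j) else 0)"
    using ij by (intro sum.cong) (auto simp: sym_rep_diagonal)
  also have "\<dots> = unip l x $$ (i, j) * ?D $$ (j, j)" using ij by (simp add: sum.delta)
  also have "\<dots> = ?D $$ (i, i) * unip l (e * e * x) $$ (i, j)"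
  proof (cases "j \<le> i")
    case True
    \<comment> \<open>With exponents in the natural numbers, the factor
      \<open>(inverse e * e) ^ (i - j)\<close>, which is 1, is inserted to carry i - j powers
      across.\<close>
    have "e ^ (l - j) * inverse e ^ j = (e ^ (l - i) * e ^ (i - j)) * inverse e ^ j * (inverse e * e) ^ (i - j)"
      using True ij assms by (simp flip: power_add)
    also have "\<dots> = e ^ (l - i) * (inverse e ^ j * inverse e ^ (i - j)) * (e * e) ^ (i - j)"
      by (simp only: power_mult_distrib mult_ac)
    also have "inverse e ^ j * inverse e ^ (i - j) = inverse e ^ i"
      using True by (simp flip: power_add)
    finally show ?thesis
      using ij by (simp add: sym_rep_diagonal unip_index power_mult_distrib)
  next
    case False
    then show ?thesis using ij by (simp add: unip_index binomial_eq_0)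
  qed
  also have "\<dots> = (\<Sum>k\<in>{0..<Suc l}. if k = i then ?D $$ (i, i) * unip l (e * e * x) $$ (i, j) else 0)"
    using ij by (simp add: sum.delta)
  also have "\<dots> = (\<Sum>k\<in>{0..<Suc l}. ?D $$ (i, k) * unip l (e * e * x) $$ (k, j))"
    using ij by (intro sum.cong) (auto simp: sym_rep_diagonal)
  also have "\<dots> = (?D * unip l (e * e * x)) $$ (i, j)"
    by (rule prod[OF D U, symmetric])
  finally show "(unip l x * ?D) $$ (i, j) = (?D * unip l (e * e * x)) $$ (i, j)" .
qed (simp_all add: sym_rep_def unip_def)

text \<open>If row 0 of both matrices is concentrated on the diagonal, the corner is an
  eigenfunctional. This covers both its invariance under U and its scaling by the diagonal
  element.\<close>

lemma tensor_op_corner: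
  assumes A: "A \<in> carrier_mat (Suc m) (Suc m)" and B: "B \<in> carrier_mat (Suc n) (Suc n)"
    and X: "X \<in> carrier_mat (Suc m) (Suc n)"
    and row: "\<And>i. i \<le> m \<Longrightarrow> i \<noteq> 0 \<Longrightarrow> A $$ (0, i) = 0" "\<And>j. j \<le> n \<Longrightarrow> j \<noteq> 0 \<Longrightarrow> B $$ (0, j) = 0"
  shows "tensor_op A B X $$ (0, 0) = A $$ (0, 0) * B $$ (0, 0) * X $$ (0, 0)"
proof -
  have "tensor_op A B X $$ (0, 0) = (\<Sum>i<Suc m. \<Sum>j<Suc n. A $$ (0, i) * B $$ (0, j) * X $$ (i, j))"
    by (rule tensor_op_index[OF A B X]) auto
  also have "\<dots> = (\<Sum>i\<in>{0}. \<Sum>j<Suc n. A $$ (0, i) * B $$ (0, j) * X $$ (i, j))"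
    by (rule sum.mono_neutral_right) (auto simp: row)
  also have "\<dots> = (\<Sum>i\<in>{0}. \<Sum>j\<in>{0}. A $$ (0, i) * B $$ (0, j) * X $$ (i, j))"
    by (intro sum.cong refl sum.mono_neutral_right) (auto simp: row)
  also have "\<dots> = A $$ (0, 0) * B $$ (0, 0) * X $$ (0, 0)" by simp
  finally show ?thesis .
qed

text \<open>The antiderivative of the orbit of the first basis vector under the unipotent group; its
  coboundary relation is the additivity of the integral.\<close>

definition unip_cocycle :: "nat \<Rightarrow> complex \<Rightarrow> complex vec" where
  "unip_cocycle l u = vec (l + 1) (\<lambda>i. u ^ Suc i / of_nat (Suc i))"

lemma unip_cocycle_carrier [simp]: "unip_cocycle l u \<in> carrier_vec (Suc l)"
  by (simp add: unip_cocycle_def)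

text \<open>Entry i is the integral of X^i from u to u + v, expanded at u. The coefficients agree
  because (i choose j) / (j + 1) = (i + 1 choose j + 1) / (i + 1).\<close>

lemma unip_mult_cocycle: "unip l u *\<^sub>v unip_cocycle l v = unip_cocycle l (u + v) - unip_cocycle l u"
proof (rule eq_vecI)
  fix i assume "i < dim_vec (unip_cocycle l (u + v) - unip_cocycle l u)"
  then have i: "i \<le> l" by (simp add: unip_cocycle_def)
  have "(unip l u *\<^sub>v unip_cocycle l v) $ i
      = (\<Sum>j\<in>{0..<Suc l}. of_nat (i choose j) * u ^ (i - j) * (v ^ Suc j / of_nat (Suc j)))"
    using i by (simp add: unip_def unip_cocycle_def scalar_prod_def)
  also have "\<dots> = (\<Sum>j\<le>i. of_nat (i choose j) * u ^ (i - j) * (v ^ Suc j / of_nat (Suc j)))"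
    using i by (intro sum.mono_neutral_right) (auto simp: binomial_eq_0)
  also have "\<dots> = (\<Sum>j\<le>i. of_nat (Suc i choose Suc j) * v ^ Suc j * u ^ (Suc i - Suc j)) / of_nat (Suc i)"
    unfolding sum_divide_distrib
  proof (rule sum.cong[OF refl])
    fix j
    have "of_nat (Suc j) * of_nat (Suc i choose Suc j) = (of_nat (Suc i) * of_nat (i choose j) :: complex)"
      using Suc_times_binomial_eq[of i j] by (simp only: mult.commute flip: of_nat_mult)
    moreover have "of_nat (Suc i) \<noteq> (0 :: complex)" "of_nat (Suc j) \<noteq> (0 :: complex)"
      by (rule of_nat_neq_0)+
    moreover have "p / m = q / n" if "m * q = n * p" "n \<noteq> 0" "m \<noteq> 0" for m n p q :: complex
      using that by (simp add: frac_eq_eq ac_simps)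
    ultimately have eq: "of_nat (i choose j) / of_nat (Suc j) = (of_nat (Suc i choose Suc j) / of_nat (Suc i) :: complex)"
      by blast
    have "of_nat (i choose j) * u ^ (i - j) * (v ^ Suc j / of_nat (Suc j))
        = (of_nat (i choose j) / of_nat (Suc j)) * (v ^ Suc j * u ^ (i - j))"
      by (simp only: divide_inverse mult_ac)
    also have "\<dots> = of_nat (Suc i choose Suc j) * v ^ Suc j * u ^ (Suc i - Suc j) / of_nat (Suc i)"
      unfolding eq by (simp only: diff_Suc_Suc divide_inverse mult_ac)
    finally show "of_nat (i choose j) * u ^ (i - j) * (v ^ Suc j / of_nat (Suc j))
        = of_nat (Suc i choose Suc j) * v ^ Suc j * u ^ (Suc i - Suc j) / of_nat (Suc i)" .
  qed
  also have "(\<Sum>j\<le>i. of_nat (Suc i choose Suc j) * v ^ Suc j * u ^ (Suc i - Suc j)) = (v + u) ^ Suc i - u ^ Suc i"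
    unfolding binomial_ring[of v u "Suc i"] by (subst sum.atMost_Suc_shift) simp
  finally show "(unip l u *\<^sub>v unip_cocycle l v) $ i = (unip_cocycle l (u + v) - unip_cocycle l u) $ i"
    using i by (simp add: unip_cocycle_def diff_divide_distrib add.commute)
qed (simp add: unip_def unip_cocycle_def)

section \<open>Alternating forms and units on the ring of integers\<close>

context quadratic_field
begin

sublocale integers: unital_subring \<O>
  by unfold_locales (auto intro: integers_add integers_mult integers_minus Ints_in_integers)

lemma integers_of_int_mult: "x \<in> \<O> \<Longrightarrow> of_int k * x \<in> \<O>"
  by (rule integers_mult[OF Ints_in_integers]) simp_all

text \<open>An alternating biadditive form on a lattice of rank two scales by the determinant of an
  endomorphism, and multiplication by \<eta> has determinant \<eta> * \<sigma> \<eta>. The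
  hypothesis is the cocycle identity for trivial coefficients.\<close>

lemma alternation_invariant:
  fixes c :: "real \<Rightarrow> real \<Rightarrow> complex"
  assumes cocycle: "\<And>x y z. x \<in> \<O> \<Longrightarrow> y \<in> \<O> \<Longrightarrow> z \<in> \<O> \<Longrightarrow> c y z + c x (y + z) = c (x + y) z + c x y"
    and \<omega>: "\<omega> \<in> \<O>" "\<sigma> \<omega> \<noteq> \<omega>" "\<And>x. x \<in> \<O> \<Longrightarrow> \<exists>m n :: int. x = of_int m + of_int n * \<omega>"
    and \<eta>: "\<eta> \<in> \<O>" "\<eta> * \<sigma> \<eta> = 1"
  shows "c \<eta> (\<eta> * \<omega>) - c (\<eta> * \<omega>) \<eta> = c 1 \<omega> - c \<omega> 1"
proof -
  define a where "a = (\<lambda>x y. c x y - c y x)"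
  \<comment> \<open>Three instances of the cocycle identity, with z in each of the three positions;
    all terms with a sum in an argument cancel after alternation.\<close>
  have add1: "a (x + y) z = a x z + a y z" if "x \<in> \<O>" "y \<in> \<O>" "z \<in> \<O>" for x y z
  proof -
    have 1: "c (x + y) z = c y z + c x (y + z) - c x y" using cocycle[OF that] by (simp add: algebra_simps)
    have 2: "c x (y + z) = c (x + z) y + c x z - c z y"
      using cocycle[OF that(1,3,2)] by (simp add: algebra_simps)
    have 3: "c z (x + y) = c (x + z) y + c z x - c x y"
      using cocycle[OF that(3,1,2)] by (simp add: algebra_simps)
    show ?thesis unfolding a_def 1 2 3 by simp
  qed
  have anti: "a x y = - a y x" for x y by (simp add: a_def)
  have zero: "a 0 z = 0" if "z \<in> \<O>" for z
    using add1[of 0 0 z] that Ints_in_integers[of 0] by simp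
  have nat: "a (of_nat n * x) z = of_nat n * a x z" if "x \<in> \<O>" "z \<in> \<O>" for n x z
  proof (induction n)
    case (Suc n)
    have "of_nat n * x \<in> \<O>" using integers_of_int_mult[of x "int n"] that by simp
    then have "a (of_nat n * x + x) z = a (of_nat n * x) z + a x z" using that add1 by blast
    moreover have "of_nat (Suc n) * x = of_nat n * x + x" by (simp add: algebra_simps)
    ultimately show ?case using Suc by (simp add: algebra_simps)
  qed (use that zero in simp)
  have int: "a (of_int m * x) z = of_int m * a x z" if "x \<in> \<O>" "z \<in> \<O>" for m x z
  proof (cases m)
    case (nonneg n) then show ?thesis using nat[OF that] by simp
  next
    case (neg n)
    have O: "of_int k * x \<in> \<O>" for k using that(1) by (rule integers_of_int_mult)
    have "a (of_int m * x + of_int (int (Suc n)) * x) z = a (of_int m * x) z + a (of_int (int (Suc n)) * x) z"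
      by (rule add1[OF O O that(2)])
    moreover have "of_int m * x + of_int (int (Suc n)) * x = 0" unfolding neg by (simp del: of_nat_Suc)
    moreover have "a (of_int (int (Suc n)) * x) z = of_nat (Suc n) * a x z" using nat[OF that, of "Suc n"] by simp
    ultimately have "a (of_int m * x) z = - (of_nat (Suc n) * a x z)"
      using zero[OF that(2)] by (simp add: eq_neg_iff_add_eq_0)
    then show ?thesis unfolding neg by (simp del: of_nat_Suc)
  qed
  have one: "1 \<in> \<O>" by (rule integers.A_one)
  obtain m1 n1 :: int where e1: "\<eta> = of_int m1 + of_int n1 * \<omega>" using \<omega>(3) \<eta> by blast
  obtain m2 n2 :: int where e2: "\<eta> * \<omega> = of_int m2 + of_int n2 * \<omega>"
    using \<omega>(3) integers_mult[OF \<eta>(1) \<omega>(1)] by blast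
  have lin: "a (of_int m + of_int n * \<omega>) z = of_int m * a 1 z + of_int n * a \<omega> z" if "z \<in> \<O>" for m n z
  proof -
    have O: "of_int m * 1 \<in> \<O>" "of_int n * \<omega> \<in> \<O>"
      by (rule integers_of_int_mult[OF one] integers_of_int_mult[OF \<omega>(1)])+
    show ?thesis using add1[OF O that] int[OF one that] int[OF \<omega>(1) that] by simp
  qed
  have lin2: "a z (of_int m + of_int n * \<omega>) = of_int m * a z 1 + of_int n * a z \<omega>" if "z \<in> \<O>" for m n z
  proof -
    have h: "a z (of_int m + of_int n * \<omega>) = - a (of_int m + of_int n * \<omega>) z" "a z 1 = - a 1 z" "a z \<omega> = - a \<omega> z"
      by (rule anti)+
    show ?thesis unfolding h lin[OF that] by simp
  qed
  have "of_int m2 + of_int n2 * \<omega> \<in> \<O>" using integers_mult[OF \<eta>(1) \<omega>(1)] e2 by simp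
  then have "a (of_int m1 + of_int n1 * \<omega>) (of_int m2 + of_int n2 * \<omega>)
      = of_int m1 * (of_int m2 * a 1 1 + of_int n2 * a 1 \<omega>) + of_int n1 * (of_int m2 * a \<omega> 1 + of_int n2 * a \<omega> \<omega>)"
    by (simp only: lin lin2[OF one] lin2[OF \<omega>(1)])
  moreover have "a 1 1 = 0" "a \<omega> \<omega> = 0" "a \<omega> 1 = - a 1 \<omega>" by (simp_all add: a_def)
  ultimately have "a (of_int m1 + of_int n1 * \<omega>) (of_int m2 + of_int n2 * \<omega>)
      = (of_int m1 * of_int n2 - of_int n1 * of_int m2) * a 1 \<omega>"
    by (simp add: algebra_simps)
  then have a_eq: "a \<eta> (\<eta> * \<omega>) = (of_int m1 * of_int n2 - of_int n1 * of_int m2) * a 1 \<omega>"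
    by (simp only: e2) (simp only: e1)
  have F: "\<omega> \<in> F" "\<eta> \<in> F" using \<omega> \<eta> integers_subset_field by auto
  have \<sigma>_lin: "\<sigma> (of_int m + of_int n * \<omega>) = of_int m + of_int n * \<sigma> \<omega>" for m n
    using F by (simp add: conj_add conj_mult conj_rat Rats_in_field field_mult)
  have \<sigma>e: "\<sigma> \<eta> = of_int m1 + of_int n1 * \<sigma> \<omega>" "\<sigma> (\<eta> * \<omega>) = of_int m2 + of_int n2 * \<sigma> \<omega>"
    using \<sigma>_lin[of m1 n1] \<sigma>_lin[of m2 n2] e1 e2 by simp_all
  \<comment> \<open>The determinant is identified through the covolume: the lattice determinant of
    \<eta>, \<eta> * \<omega> is computed once by pulling out the norm of \<eta> and once from
    coordinates in the basis 1, \<omega>.\<close>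
  have "\<eta> * \<sigma> (\<eta> * \<omega>) - \<sigma> \<eta> * (\<eta> * \<omega>) = \<eta> * \<sigma> \<eta> * (\<sigma> \<omega> - \<omega>)"
    using F by (simp add: conj_mult algebra_simps)
  also have "\<dots> = \<sigma> \<omega> - \<omega>" by (simp only: \<eta>(2) mult_1_left)
  finally have "\<sigma> \<omega> - \<omega> = (of_int m1 + of_int n1 * \<omega>) * (of_int m2 + of_int n2 * \<sigma> \<omega>)
      - (of_int m1 + of_int n1 * \<sigma> \<omega>) * (of_int m2 + of_int n2 * \<omega>)"
    by (simp only: \<sigma>_lin \<sigma>e e2) (simp only: e1[symmetric])
  then have "\<sigma> \<omega> - \<omega> = of_int (m1 * n2 - n1 * m2) * (\<sigma> \<omega> - \<omega>)" by (simp add: algebra_simps)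
  then have "real_of_int (m1 * n2 - n1 * m2) = 1" using \<omega>(2) by simp
  then have "m1 * n2 - n1 * m2 = 1" by linarith
  then have "of_int m1 * of_int n2 - of_int n1 * of_int m2 = (1 :: complex)"
    by (metis of_int_1 of_int_diff of_int_mult)
  then show ?thesis using a_eq by (simp add: a_def)
qed

text \<open>The norm of a unit is an integer dividing 1, hence 1 or -1. Conjugation by t multiplies
  by the square of \<epsilon>, so this sign disappears.\<close>

lemma unit_norm_square:
  assumes "\<epsilon> \<in> integer_units F"
  shows "\<epsilon> * \<epsilon> \<in> \<O>" "\<epsilon> * \<epsilon> * \<sigma> (\<epsilon> * \<epsilon>) = 1"
proof -
  obtain y where y: "\<epsilon> \<in> \<O>" "y \<in> \<O>" "\<epsilon> * y = 1" using assms by (auto simp: integer_units_def)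
  then have F: "\<epsilon> \<in> F" "y \<in> F" by (auto intro: integers_subset_field)
  obtain m n :: int where mn: "\<epsilon> * \<sigma> \<epsilon> = of_int m" "y * \<sigma> y = of_int n"
    using y unfolding integers_iff by (metis Ints_cases)
  have "(\<epsilon> * \<sigma> \<epsilon>) * (y * \<sigma> y) = (\<epsilon> * y) * \<sigma> (\<epsilon> * y)"
    using F by (simp only: conj_mult mult_ac)
  also have "\<dots> = 1" using y(3) conj_rat[of 1] by simp
  finally have "of_int (m * n) = (1 :: real)" unfolding mn by simp
  then have "m * n = 1" by linarith
  then have "m * m = 1" by (auto simp: zmult_eq_1_iff)
  have "\<epsilon> * \<epsilon> * \<sigma> (\<epsilon> * \<epsilon>) = (\<epsilon> * \<sigma> \<epsilon>) * (\<epsilon> * \<sigma> \<epsilon>)" using F by (simp only: conj_mult mult_ac)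
  also have "\<dots> = of_int (m * m)" unfolding mn by simp
  finally show "\<epsilon> * \<epsilon> * \<sigma> (\<epsilon> * \<epsilon>) = 1" using \<open>m * m = 1\<close> by simp
  show "\<epsilon> * \<epsilon> \<in> \<O>" using y integers_mult by blast
qed

end

section \<open>The cohomology of the lower unipotents\<close>

locale quadratic_rep = quadratic_field F s D
  for F :: "real set" and s :: real and D :: int +
  fixes l1 l2 :: nat and \<omega> :: real
  assumes parity: "l1 mod 2 = l2 mod 2"
    and \<omega>_int: "\<omega> \<in> \<O>" and \<omega>_conj: "\<sigma> \<omega> \<noteq> \<omega>"
    and \<omega>_basis: "x \<in> \<O> \<Longrightarrow> \<exists>m n :: int. x = of_int m + of_int n * \<omega>"
begin

abbreviation "\<iota> x \<equiv> proj_class \<O> (mat2 1 0 x 1)"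
abbreviation "UG \<equiv> (PSL2 \<O>)\<lparr>carrier := lower_unipotents \<O>\<rparr>"
abbreviation "V \<equiv> rep_space l1 l2"
abbreviation "act \<equiv> PSL2_act F l1 l2"

lemma rep_space_simps:
  "carrier V = carrier_mat (Suc l1) (Suc l2)" "v \<oplus>\<^bsub>V\<^esub> w = v + w" "c \<odot>\<^bsub>V\<^esub> v = c \<cdot>\<^sub>m v"
  "\<zero>\<^bsub>V\<^esub> = 0\<^sub>m (Suc l1) (Suc l2)"
  by (simp_all add: rep_space_def module_mat_simps)

lemma integers_consts: "0 \<in> \<O>" "1 \<in> \<O>"
  by (rule integers.A_zero integers.A_one)+

lemma iota_SL2: "x \<in> \<O> \<Longrightarrow> mat2 1 0 x 1 \<in> carrier (SL2 \<O>)"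
  by (intro SL2_memI integers_consts) simp_all

lemma iota_mult: "x \<in> \<O> \<Longrightarrow> y \<in> \<O> \<Longrightarrow> \<iota> x \<otimes>\<^bsub>PSL2 \<O>\<^esub> \<iota> y = \<iota> (x + y)"
  by (simp add: integers.proj_class_mult iota_SL2 mat2_mult)

lemma carrier_UG: "carrier UG = \<iota> ` \<O>"
  by (simp add: integers.lower_unipotents_eq)

lemma iota_inj: "\<iota> x = \<iota> y \<Longrightarrow> x = y"
  by (auto simp: proj_class_eq mat2_uminus mat2_inject doubleton_eq_iff)

lemma UG_group: "group UG"
proof (rule groupI)
  show "\<one>\<^bsub>UG\<^esub> \<in> carrier UG"
    unfolding carrier_UG using integers_consts by (auto simp: proj_class_one one_mat2)
  fix x assume "x \<in> carrier UG"
  then obtain a where a: "a \<in> \<O>" "x = \<iota> a" unfolding carrier_UG by blast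
  show "\<one>\<^bsub>UG\<^esub> \<otimes>\<^bsub>UG\<^esub> x = x"
    using iota_mult[OF integers_consts(1) a(1)] a(2) by (simp add: proj_class_one one_mat2)
  have "\<iota> (- a) \<otimes>\<^bsub>UG\<^esub> x = \<one>\<^bsub>UG\<^esub>"
    using iota_mult[OF integers_minus[OF a(1)] a(1)] a(2) by (simp add: proj_class_one one_mat2)
  moreover have "\<iota> (- a) \<in> carrier UG" unfolding carrier_UG using a integers_minus by blast
  ultimately show "\<exists>y\<in>carrier UG. y \<otimes>\<^bsub>UG\<^esub> x = \<one>\<^bsub>UG\<^esub>" by blast
next
  fix x y assume "x \<in> carrier UG" "y \<in> carrier UG"
  then show "x \<otimes>\<^bsub>UG\<^esub> y \<in> carrier UG"
    unfolding carrier_UG by (auto simp: iota_mult intro: integers_add)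
next
  fix x y z assume "x \<in> carrier UG" "y \<in> carrier UG" "z \<in> carrier UG"
  then show "x \<otimes>\<^bsub>UG\<^esub> y \<otimes>\<^bsub>UG\<^esub> z = x \<otimes>\<^bsub>UG\<^esub> (y \<otimes>\<^bsub>UG\<^esub> z)"
    unfolding carrier_UG by (auto simp: iota_mult integers_add add.assoc)
qed

lemma iota_int_pow:
  assumes x: "x \<in> \<O>"
  shows "\<iota> x [^]\<^bsub>UG\<^esub> (k::int) = \<iota> (of_int k * x)"
proof -
  interpret G: group UG by (rule UG_group)
  have nat: "\<iota> x [^]\<^bsub>UG\<^esub> (n::nat) = \<iota> (of_nat n * x)" for n
  proof (induction n)
    case 0 then show ?case by (simp add: proj_class_one one_mat2)
  next
    case (Suc n)
    have "of_nat n * x \<in> \<O>" using integers_of_int_mult[OF x, of "int n"] by simp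
    then show ?case using Suc iota_mult[of "of_nat n * x" x] x by (simp add: algebra_simps)
  qed
  have inv: "inv\<^bsub>UG\<^esub> \<iota> y = \<iota> (- y)" if "y \<in> \<O>" for y
  proof (rule G.inv_equality)
    show "\<iota> (- y) \<otimes>\<^bsub>UG\<^esub> \<iota> y = \<one>\<^bsub>UG\<^esub>"
      using iota_mult[OF integers_minus[OF that] that] by (simp add: proj_class_one one_mat2)
  qed (use that integers_minus in \<open>auto simp del: partial_object.simps simp: carrier_UG\<close>)
  show ?thesis
  proof (cases "k < 0")
    case True
    have "of_nat (nat (- k)) * x \<in> \<O>" using integers_of_int_mult[OF x, of "- k"] True by simp
    then have "\<iota> x [^]\<^bsub>UG\<^esub> k = \<iota> (- (of_nat (nat (- k)) * x))"
      unfolding int_pow_def2 by (simp only: True if_True nat inv)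
    also have "- (of_nat (nat (- k)) * x) = of_int k * x" using True by simp
    finally show ?thesis .
  next
    case False
    then have "\<iota> x [^]\<^bsub>UG\<^esub> k = \<iota> (of_nat (nat k) * x)"
      unfolding int_pow_def2 by (simp only: False if_False nat)
    also have "of_nat (nat k) * x = of_int k * x" using False by simp
    finally show ?thesis .
  qed
qed

text \<open>Equal parity enters here: the signs from the two tensor factors cancel, so the set
  inside \<open>the_elem\<close> is a singleton.\<close>

lemma act_proj_class:
  assumes g: "g \<in> carrier (SL2 \<O>)" and v: "v \<in> carrier V"
  shows "act (proj_class \<O> g) v = SL2_act F l1 l2 g v"
proof -
  obtain a b c d where h: "a \<in> \<O>" "b \<in> \<O>" "c \<in> \<O>" "d \<in> \<O>" "g = mat2 a b c d" "a * d - b * c = 1"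
    using g by (rule SL2_cases)
  have F: "a \<in> F" "b \<in> F" "c \<in> F" "d \<in> F" using h integers_subset_field by auto
  have "SL2_act F l1 l2 (- g) v = SL2_act F l1 l2 g v"
  proof -
    have 1: "map_mat complex_of_real (- g) = - map_mat complex_of_real g"
      unfolding h(5) mat2_uminus map_mat_mat2 by simp
    have 2: "map_mat complex_of_real (map_mat \<sigma> (- g)) = - map_mat complex_of_real (map_mat \<sigma> g)"
      unfolding h(5) mat2_uminus map_mat_mat2 using F by (simp add: conj_minus)
    have C: "map_mat complex_of_real g \<in> carrier_mat 2 2" "map_mat complex_of_real (map_mat \<sigma> g) \<in> carrier_mat 2 2"
      unfolding h(5) map_mat_mat2 by simp_all
    show ?thesis
      unfolding SL2_act_def 1 2 sym_rep_uminus[OF C(1)] sym_rep_uminus[OF C(2)]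
      by (rule tensor_op_smult_both[OF sym_rep_carrier(2) sym_rep_carrier(2) _ neg_one_power_parity[OF parity]])
        (use v in \<open>simp add: rep_space_simps\<close>)
  qed
  moreover have "proj_class \<O> g = {g, - g}" by (rule proj_class_eq) (simp add: h(5))
  ultimately show ?thesis by (simp add: PSL2_act_def)
qed

lemma act_iota:
  assumes "x \<in> \<O>" "v \<in> carrier V"
  shows "act (\<iota> x) v = tensor_op (unip l1 (of_real x)) (unip l2 (of_real (\<sigma> x))) v"
proof -
  have "act (\<iota> x) v = SL2_act F l1 l2 (mat2 1 0 x 1) v"
    by (rule act_proj_class[OF iota_SL2]) fact+
  then show ?thesis
    by (simp add: SL2_act_def map_mat_mat2 conj_rat sym_rep_lower_unipotent)
qed

sublocale linear_action UG V act
proof (intro linear_action.intro linear_action_axioms.intro UG_group)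
  show "Module.module (class_ring :: complex ring) V"
    using matrix_vs[where 'a = complex] unfolding vectorspace_def rep_space_def by blast
next
  fix g v assume "g \<in> carrier UG" "v \<in> carrier V"
  then show "act g v \<in> carrier V" unfolding carrier_UG
    by (auto simp: act_iota) (simp add: rep_space_simps)
next
  fix g v w assume g: "g \<in> carrier UG" and v: "v \<in> carrier V" and w: "w \<in> carrier V"
  obtain x where x: "x \<in> \<O>" "g = \<iota> x" using g unfolding carrier_UG by blast
  have "v + w \<in> carrier V" using v w by (simp add: rep_space_simps)
  then show "act g (v \<oplus>\<^bsub>V\<^esub> w) = act g v \<oplus>\<^bsub>V\<^esub> act g w"
    using x v w by (simp add: act_iota) (simp add: rep_space_simps act_iota tensor_op_add[where m = "Suc l1" and n = "Suc l2"])
next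
  fix g v c assume g: "g \<in> carrier UG" and v: "v \<in> carrier V"
  obtain x where x: "x \<in> \<O>" "g = \<iota> x" using g unfolding carrier_UG by blast
  have "c \<cdot>\<^sub>m v \<in> carrier V" using v by (simp add: rep_space_simps)
  then show "act g (c \<odot>\<^bsub>V\<^esub> v) = c \<odot>\<^bsub>V\<^esub> act g v"
    using x v by (simp add: act_iota) (simp add: rep_space_simps act_iota tensor_op_smult[where m = "Suc l1" and n = "Suc l2"])
next
  fix g h v assume g: "g \<in> carrier UG" and h: "h \<in> carrier UG" and v: "v \<in> carrier V"
  obtain x where x: "x \<in> \<O>" "g = \<iota> x" using g unfolding carrier_UG by blast
  obtain y where y: "y \<in> \<O>" "h = \<iota> y" using h unfolding carrier_UG by blast
  have hv: "act h v \<in> carrier V" unfolding y(2) act_iota[OF y(1) v] using v by (simp add: rep_space_simps)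
  have "act g (act h v) = tensor_op (unip l1 (of_real x) * unip l1 (of_real y)) (unip l2 (of_real (\<sigma> x)) * unip l2 (of_real (\<sigma> y))) v"
    unfolding x(2) act_iota[OF x(1) hv] unfolding y(2) act_iota[OF y(1) v]
    by (rule tensor_op_mult) (use v in \<open>simp_all add: rep_space_simps\<close>)
  also have "\<dots> = act (\<iota> (x + y)) v"
    unfolding act_iota[OF integers_add[OF x(1) y(1)] v] unip_mult
    using x y by (simp add: conj_add integers_subset_field)
  also have "\<iota> (x + y) = g \<otimes>\<^bsub>UG\<^esub> h" using x y iota_mult by simp
  finally show "act g (act h v) = act (g \<otimes>\<^bsub>UG\<^esub> h) v" .
next
  fix v assume v: "v \<in> carrier V"
  have "act \<one>\<^bsub>UG\<^esub> v = act (\<iota> 0) v" by (simp add: proj_class_one one_mat2)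
  also have "\<dots> = v"
    unfolding act_iota[OF integers_consts(1) v] using v
    by (simp add: conj_rat unip_0 tensor_op_def rep_space_simps)
  finally show "act \<one>\<^bsub>UG\<^esub> v = v" .
qed

text \<open>The bar cycle [1 | \<omega>] - [\<omega> | 1] represents the fundamental class; its
  value is followed by the corner entry.\<close>

definition eval_cocycle :: "(real mat set list \<Rightarrow> complex mat) \<Rightarrow> complex" where
  "eval_cocycle f = f [\<iota> 1, \<iota> \<omega>] $$ (0, 0) - f [\<iota> \<omega>, \<iota> 1] $$ (0, 0)"

lemma iota_carrier: "x \<in> \<O> \<Longrightarrow> \<iota> x \<in> carrier UG"
  unfolding carrier_UG by blast

lemma corner_invariant:
  assumes "g \<in> carrier UG" "v \<in> carrier V"
  shows "act g v $$ (0, 0) = v $$ (0, 0)"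
proof -
  obtain x where x: "x \<in> \<O>" "g = \<iota> x" using assms(1) unfolding carrier_UG by blast
  have "tensor_op (unip l1 (of_real x)) (unip l2 (of_real (\<sigma> x))) v $$ (0, 0)
    = unip l1 (of_real x) $$ (0, 0) * unip l2 (of_real (\<sigma> x)) $$ (0, 0) * v $$ (0, 0)"
    by (rule tensor_op_corner[OF unip_carrier(2) unip_carrier(2) _ unip_row_0 unip_row_0])
      (use assms(2) in \<open>simp_all add: rep_space_simps\<close>)
  then show ?thesis unfolding x(2) act_iota[OF x(1) assms(2)] by (simp add: unip_def)
qed

lemma corner_kernel:
  assumes v: "v \<in> carrier V" "v $$ (0, 0) = 0"
  shows "\<exists>y\<in>carrier V. \<exists>z\<in>carrier V. v \<oplus>\<^bsub>V\<^esub> act (\<iota> 1) y \<oplus>\<^bsub>V\<^esub> z = y \<oplus>\<^bsub>V\<^esub> act (\<iota> \<omega>) z"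
proof -
  \<comment> \<open>The generators 1 and \<omega> have the coordinates (1, 1) and (\<omega>,
    \<sigma> \<omega>) in the two nilpotent directions, with determinant \<sigma> \<omega> -
    \<omega>.\<close>
  have d: "1 * of_real (\<sigma> \<omega>) - of_real \<omega> * 1 \<noteq> (0 :: complex)" using \<omega>_conj by simp
  have vV: "v \<in> carrier_mat (l1 + 1) (l2 + 1)" using v(1) by (simp add: rep_space_simps)
  obtain Y Z where YZ: "Y \<in> carrier_mat (l1 + 1) (l2 + 1)" "Z \<in> carrier_mat (l1 + 1) (l2 + 1)"
    "v = (tensor_op (unip l1 1) (unip l2 1) Y - Y)
      + (tensor_op (unip l1 (of_real \<omega>)) (unip l2 (of_real (\<sigma> \<omega>))) Z - Z)"
    by (rule coinvariants_unip[OF d vV v(2)])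
  \<comment> \<open>The two lifts enter the commutation equation with opposite signs, so the first
    vector is taken as -Y.\<close>
  have V: "Y \<in> carrier V" "Z \<in> carrier V" "- 1 \<cdot>\<^sub>m Y \<in> carrier V" using YZ by (simp_all add: rep_space_simps)
  have "v = (act (\<iota> 1) Y - Y) + (act (\<iota> \<omega>) Z - Z)"
    using YZ(3) act_iota[OF integers_consts(2) V(1)] act_iota[OF \<omega>_int V(2)] by (simp add: conj_rat)
  moreover have "act (\<iota> 1) (- 1 \<cdot>\<^sub>m Y) = - 1 \<cdot>\<^sub>m act (\<iota> 1) Y"
    using act_smult[OF iota_carrier[OF integers_consts(2)] V(1), of "- 1"] by (simp add: rep_space_simps)
  moreover have "act (\<iota> 1) Y \<in> carrier_mat (Suc l1) (Suc l2)" "act (\<iota> \<omega>) Z \<in> carrier_mat (Suc l1) (Suc l2)"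
    using act_closed[OF iota_carrier[OF integers_consts(2)] V(1)] act_closed[OF iota_carrier[OF \<omega>_int] V(2)]
    by (simp_all add: rep_space_simps)
  ultimately have "v + act (\<iota> 1) (- 1 \<cdot>\<^sub>m Y) + Z = - 1 \<cdot>\<^sub>m Y + act (\<iota> \<omega>) Z"
    using YZ(1,2) by (intro eq_matI) auto
  then show ?thesis unfolding rep_space_simps(2) using V(2,3) by blast
qed

lemma coboundaries_eq: "coboundaries UG V act 2 = {f \<in> cocycles UG V act 2. eval_cocycle f = 0}"
proof -
  obtain m where m: "\<forall>x\<in>\<O>. \<exists>n :: int. x = of_int (m x) + of_int n * \<omega>"
    using \<omega>_basis by metis
  then obtain n where mn: "\<And>x. x \<in> \<O> \<Longrightarrow> x = of_int (m x) + of_int (n x) * \<omega>" by metis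
  \<comment> \<open>The coordinates were obtained by choice; their additivity follows from
    uniqueness, that is, from irrationality of \<omega>.\<close>
  have uniq: "a = a' \<and> b = b'" if "of_int a + of_int b * \<omega> = of_int a' + of_int b' * \<omega>" for a b a' b' :: int
  proof -
    have \<omega>F: "\<omega> \<in> F" using \<omega>_int by (rule integers_subset_field)
    have "\<omega> \<notin> \<rat>" using \<omega>_conj conj_rat by blast
    then have "real_of_int (a - a') = 0 \<and> real_of_int (b - b') = 0"
      by (rule rat_lin_eq_0[rotated 2]) (use that in \<open>simp_all add: algebra_simps\<close>)
    then show ?thesis by simp
  qed
  have mn_add: "m (x + y) = m x + m y \<and> n (x + y) = n x + n y" if "x \<in> \<O>" "y \<in> \<O>" for x y
  proof (rule uniq)
    have "of_int (m (x + y)) + of_int (n (x + y)) * \<omega> = x + y"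
      using mn[OF integers_add[OF that]] by simp
    also have "\<dots> = (of_int (m x) + of_int (n x) * \<omega>) + (of_int (m y) + of_int (n y) * \<omega>)"
      using mn[OF that(1)] mn[OF that(2)] by simp
    finally show "of_int (m (x + y)) + of_int (n (x + y)) * \<omega> = of_int (m x + m y) + of_int (n x + n y) * \<omega>"
      by (simp add: algebra_simps)
  qed
  define \<kappa> where "\<kappa> = inv_into \<O> (\<lambda>x. \<iota> x)"
  have \<kappa>: "\<kappa> (\<iota> x) = x" if "x \<in> \<O>" for x
    unfolding \<kappa>_def using that iota_inj by (intro inv_into_f_f inj_onI) auto
  have "coboundaries UG V act 2
      = {f \<in> cocycles UG V act 2. f [\<iota> 1, \<iota> \<omega>] $$ (0, 0) - f [\<iota> \<omega>, \<iota> 1] $$ (0, 0) = 0}"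
  proof (rule coboundaries_2_eq_kernel[where p = "\<lambda>v. v $$ (0, 0)" and \<mu> = "\<lambda>g. m (\<kappa> g)" and \<nu> = "\<lambda>g. n (\<kappa> g)"])
    show "(v \<oplus>\<^bsub>V\<^esub> w) $$ (0, 0) = v $$ (0, 0) + w $$ (0, 0)" if "v \<in> carrier V" "w \<in> carrier V" for v w
      using that by (simp add: rep_space_simps)
    show "act g v $$ (0, 0) = v $$ (0, 0)" if "g \<in> carrier UG" "v \<in> carrier V" for g v
      using that by (rule corner_invariant)
    show "\<exists>y\<in>carrier V. \<exists>z\<in>carrier V. v \<oplus>\<^bsub>V\<^esub> act (\<iota> 1) y \<oplus>\<^bsub>V\<^esub> z = y \<oplus>\<^bsub>V\<^esub> act (\<iota> \<omega>) z"
      if "v \<in> carrier V" "v $$ (0, 0) = 0" for v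
      using that by (rule corner_kernel)
    show "\<iota> 1 \<in> carrier UG" "\<iota> \<omega> \<in> carrier UG"
      by (rule iota_carrier integers_consts \<omega>_int)+
    show "\<iota> 1 \<otimes>\<^bsub>UG\<^esub> \<iota> \<omega> = \<iota> \<omega> \<otimes>\<^bsub>UG\<^esub> \<iota> 1"
      using iota_mult[OF integers_consts(2) \<omega>_int] iota_mult[OF \<omega>_int integers_consts(2)] by (simp add: add.commute)
  next
    fix g h assume "g \<in> carrier UG" "h \<in> carrier UG"
    then obtain x y where xy: "x \<in> \<O>" "y \<in> \<O>" "g = \<iota> x" "h = \<iota> y" unfolding carrier_UG by blast
    have "g \<otimes>\<^bsub>UG\<^esub> h = \<iota> (x + y)" using xy iota_mult by simp
    then show "m (\<kappa> (g \<otimes>\<^bsub>UG\<^esub> h)) = m (\<kappa> g) + m (\<kappa> h)" "n (\<kappa> (g \<otimes>\<^bsub>UG\<^esub> h)) = n (\<kappa> g) + n (\<kappa> h)"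
      using xy mn_add[of x y] by (simp_all add: \<kappa> integers_add)
  next
    fix g assume "g \<in> carrier UG"
    then obtain x where x: "x \<in> \<O>" "g = \<iota> x" unfolding carrier_UG by blast
    have "\<iota> 1 [^]\<^bsub>UG\<^esub> m x \<otimes>\<^bsub>UG\<^esub> \<iota> \<omega> [^]\<^bsub>UG\<^esub> n x = \<iota> (of_int (m x) * 1 + of_int (n x) * \<omega>)"
      unfolding iota_int_pow[OF integers_consts(2)] iota_int_pow[OF \<omega>_int]
      using iota_mult[OF integers_of_int_mult[OF integers_consts(2)] integers_of_int_mult[OF \<omega>_int]] by simp
    also have "\<dots> = g" using mn[OF x(1)] x(2) by simp
    finally show "g = \<iota> 1 [^]\<^bsub>UG\<^esub> m (\<kappa> g) \<otimes>\<^bsub>UG\<^esub> \<iota> \<omega> [^]\<^bsub>UG\<^esub> n (\<kappa> g)"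
      using x by (simp add: \<kappa>)
  qed
  then show ?thesis by (simp add: eval_cocycle_def)
qed

end

text \<open>The cocycle identity of the cup product below, for a, b = \<alpha> (x + y), \<alpha> x
  and c, d, e = \<beta> (x + y + z), \<beta> (x + y), \<beta> x.\<close>

lemma tensor_vec_cup_identity:
  assumes "a \<in> carrier_vec m" "b \<in> carrier_vec m" "c \<in> carrier_vec n" "d \<in> carrier_vec n" "e \<in> carrier_vec n"
  shows "tensor_vec (a - b) ((c - e) - (d - e)) + tensor_vec b (c - e)
    = tensor_vec a (c - d) + tensor_vec b (d - e)"
  by (rule eq_matI) (use assms in \<open>auto simp: tensor_vec_def algebra_simps\<close>)

lemma tensor_vec_carrier: "a \<in> carrier_vec m \<Longrightarrow> b \<in> carrier_vec n \<Longrightarrow> tensor_vec a b \<in> carrier_mat m n"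
  by (simp add: tensor_vec_def)

section \<open>A generator of the cohomology and the action of the diagonal element\<close>

context quadratic_rep
begin

text \<open>The cup product of the two antiderivative 1-cocycles, one for each tensor factor.\<close>

lemma nontrivial_cocycle: "\<exists>f\<in>cocycles UG V act 2. eval_cocycle f \<noteq> 0"
proof -
  define \<kappa> where "\<kappa> = inv_into \<O> (\<lambda>x. \<iota> x)"
  have \<kappa>: "\<kappa> (\<iota> x) = x" if "x \<in> \<O>" for x
    unfolding \<kappa>_def using that iota_inj by (intro inv_into_f_f inj_onI) auto
  define \<alpha> where "\<alpha> = (\<lambda>x. unip_cocycle l1 (of_real x))"
  define \<beta> where "\<beta> = (\<lambda>x. unip_cocycle l2 (of_real (\<sigma> x)))"
  \<comment> \<open>The cup product takes the pair (x, y) to \<alpha> x tensor the translate of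
    \<beta> y by x; the 1-cocycle relation turns this translate into \<beta> (x + y) - \<beta>
    x.\<close>
  define W where "W = (\<lambda>x y. tensor_vec (\<alpha> x) (\<beta> (x + y) - \<beta> x))"
  define f where "f = (\<lambda>xs\<in>tuples UG 2. W (\<kappa> (xs ! 0)) (\<kappa> (xs ! 1)))"
  have ab: "\<alpha> x \<in> carrier_vec (Suc l1)" "\<beta> x \<in> carrier_vec (Suc l2)" for x
    by (simp_all add: \<alpha>_def \<beta>_def)
  have fW: "f [\<iota> x, \<iota> y] = W x y" if "x \<in> \<O>" "y \<in> \<O>" for x y
  proof -
    have "[\<iota> x, \<iota> y] \<in> tuples UG 2" using that iota_carrier tuples_2[of _ UG] by blast
    then show ?thesis using that by (simp add: f_def \<kappa>)
  qed
  have WV: "W x y \<in> carrier V" for x y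
    unfolding W_def rep_space_simps using ab by (intro tensor_vec_carrier) auto
  have "f \<in> cocycles UG V act 2"
    unfolding cocycle_2_iff cochain_2_iff
  proof (intro conjI ballI)
    show "f \<in> extensional (tuples UG 2)" by (simp add: f_def)
    show "f [g, h] \<in> carrier V" if "g \<in> carrier UG" "h \<in> carrier UG" for g h
      using that WV fW unfolding carrier_UG by auto
    fix g h k assume "g \<in> carrier UG" "h \<in> carrier UG" "k \<in> carrier UG"
    then obtain x y z where xyz: "x \<in> \<O>" "y \<in> \<O>" "z \<in> \<O>" "g = \<iota> x" "h = \<iota> y" "k = \<iota> z"
      unfolding carrier_UG by blast
    have F: "x \<in> F" "y \<in> F" "z \<in> F" using xyz integers_subset_field by auto
    have \<alpha>x: "unip l1 (of_real x) *\<^sub>v \<alpha> y = \<alpha> (x + y) - \<alpha> x"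
      by (simp add: \<alpha>_def unip_mult_cocycle)
    have \<beta>x: "unip l2 (of_real (\<sigma> x)) *\<^sub>v \<beta> u = \<beta> (x + u) - \<beta> x" if "u \<in> F" for u
      using F that by (simp add: \<beta>_def unip_mult_cocycle conj_add)
    have "act (\<iota> x) (W y z) = tensor_vec (unip l1 (of_real x) *\<^sub>v \<alpha> y) (unip l2 (of_real (\<sigma> x)) *\<^sub>v (\<beta> (y + z) - \<beta> y))"
      unfolding act_iota[OF xyz(1) WV] unfolding W_def
      by (rule tensor_op_tensor_vec[OF unip_carrier(2) unip_carrier(2)]) (use ab in auto)
    also have "unip l2 (of_real (\<sigma> x)) *\<^sub>v (\<beta> (y + z) - \<beta> y) = (\<beta> (x + y + z) - \<beta> x) - (\<beta> (x + y) - \<beta> x)"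
      unfolding mult_minus_distrib_mat_vec[OF unip_carrier(2) ab(2) ab(2)] \<beta>x[OF field_add[OF F(2,3)]] \<beta>x[OF F(2)]
      by (simp only: add.assoc)
    finally have "act (\<iota> x) (W y z) + W x (y + z) = W (x + y) z + W x y"
      unfolding \<alpha>x W_def add.assoc[symmetric]
      using tensor_vec_cup_identity[of "\<alpha> (x + y)" "Suc l1" "\<alpha> x" "\<beta> (x + y + z)" "Suc l2" "\<beta> (x + y)" "\<beta> x",
        OF ab(1) ab(1) ab(2) ab(2) ab(2)]
      by (simp only:)
    then show "act g (f [h, k]) \<oplus>\<^bsub>V\<^esub> f [g, h \<otimes>\<^bsub>UG\<^esub> k] = f [g \<otimes>\<^bsub>UG\<^esub> h, k] \<oplus>\<^bsub>V\<^esub> f [g, h]"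
      using xyz by (simp add: iota_mult fW integers_add rep_space_simps)
  qed
  moreover have "eval_cocycle f = of_real (\<sigma> \<omega> - \<omega>)"
  proof -
    \<comment> \<open>In the corner the antiderivatives are x and \<sigma> x themselves, so on the
      integers this is the scalar cocycle x * \<sigma> y, whose alternation at (1, \<omega>) is
      \<sigma> \<omega> - \<omega>.\<close>
    have "W x y $$ (0, 0) = of_real (x * (\<sigma> (x + y) - \<sigma> x))" for x y
      by (simp add: W_def \<alpha>_def \<beta>_def tensor_vec_def unip_cocycle_def)
    moreover have "\<sigma> (1 + \<omega>) = 1 + \<sigma> \<omega>" "\<sigma> (\<omega> + 1) = \<sigma> \<omega> + 1" "\<sigma> 1 = 1"
      using conj_add[of 1 \<omega>] conj_add[of \<omega> 1] conj_rat[of 1] integers_subset_field[OF \<omega>_int] Rats_in_field[of 1]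
      by simp_all
    ultimately show ?thesis
      by (simp add: eval_cocycle_def fW integers_consts \<omega>_int)
  qed
  ultimately show ?thesis using \<omega>_conj by (intro bexI[of _ f]) simp_all
qed

text \<open>The operator substitutes \<epsilon>^2 x for x and applies D1 tensor D2. The relation
  \<open>comm\<close> lets U pass through D1 tensor D2 at the price of exactly this substitution, so
  the cocycle identity at (x, y, z) becomes that of f at the scaled triple.\<close>

lemma conj_cochain_cocycle:
  assumes \<epsilon>: "\<epsilon> \<in> integer_units F" and f: "f \<in> cocycles UG V act 2"
  defines "T \<equiv> conj_cochain (PSL2 \<O>) (lower_unipotents \<O>) act 2 (proj_class \<O> (mat2 (inverse \<epsilon>) 0 0 \<epsilon>))"
  shows "T f \<in> cocycles UG V act 2"
    and "eval_cocycle (T f) = of_real (\<epsilon> ^ l1 * \<sigma> \<epsilon> ^ l2) * eval_cocycle f"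
proof -
  obtain y where y: "\<epsilon> \<in> \<O>" "y \<in> \<O>" "\<epsilon> * y = 1" using \<epsilon> by (auto simp: integer_units_def)
  then have \<epsilon>0: "\<epsilon> \<noteq> 0" by auto
  have inv\<epsilon>: "inverse \<epsilon> \<in> \<O>" using y inverse_unique[OF y(3)] by simp
  have \<epsilon>F: "\<epsilon> \<in> F" "inverse \<epsilon> \<in> F" using y inv\<epsilon> integers_subset_field by auto
  have "\<sigma> \<epsilon> * \<sigma> (inverse \<epsilon>) = 1" using conj_mult[OF \<epsilon>F] conj_rat[of 1] \<epsilon>0 by simp
  then have \<sigma>inv: "\<sigma> (inverse \<epsilon>) = inverse (\<sigma> \<epsilon>)" and \<sigma>0: "\<sigma> \<epsilon> \<noteq> 0"
    using inverse_unique by (fastforce, auto)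
  let ?t = "proj_class \<O> (mat2 (inverse \<epsilon>) 0 0 \<epsilon>)" and ?t' = "proj_class \<O> (mat2 \<epsilon> 0 0 (inverse \<epsilon>))"
  have tS: "mat2 (inverse \<epsilon>) 0 0 \<epsilon> \<in> carrier (SL2 \<O>)" "mat2 \<epsilon> 0 0 (inverse \<epsilon>) \<in> carrier (SL2 \<O>)"
    using \<epsilon>0 by (auto intro!: SL2_memI integers_consts y(1) inv\<epsilon>)
  have inv_t: "inv\<^bsub>PSL2 \<O>\<^esub> ?t = ?t'"
  proof (rule group.inv_equality[OF integers.PSL2_group])
    show "?t' \<otimes>\<^bsub>PSL2 \<O>\<^esub> ?t = \<one>\<^bsub>PSL2 \<O>\<^esub>"
      using tS \<epsilon>0 by (simp add: integers.proj_class_mult mat2_mult proj_class_one one_mat2)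
  qed (use tS proj_class_carrier in auto)
  have t_conj: "?t \<otimes>\<^bsub>PSL2 \<O>\<^esub> \<iota> x \<otimes>\<^bsub>PSL2 \<O>\<^esub> ?t' = \<iota> (\<epsilon> * \<epsilon> * x)" if x: "x \<in> \<O>" for x
  proof -
    have "mat2 (inverse \<epsilon>) 0 0 \<epsilon> * mat2 1 0 x 1 \<in> carrier (SL2 \<O>)"
      using monoid.m_closed[OF group.is_monoid[OF integers.SL2_group] tS(1) iota_SL2[OF x]] by (simp add: SL2_simps)
    then have "?t \<otimes>\<^bsub>PSL2 \<O>\<^esub> \<iota> x \<otimes>\<^bsub>PSL2 \<O>\<^esub> ?t'
        = proj_class \<O> (mat2 (inverse \<epsilon>) 0 0 \<epsilon> * mat2 1 0 x 1 * mat2 \<epsilon> 0 0 (inverse \<epsilon>))"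
      using tS iota_SL2[OF x] by (simp only: integers.proj_class_mult)
    also have "mat2 (inverse \<epsilon>) 0 0 \<epsilon> * mat2 1 0 x 1 * mat2 \<epsilon> 0 0 (inverse \<epsilon>) = mat2 1 0 (\<epsilon> * \<epsilon> * x) 1"
      unfolding mat2_mult mat2_inject using \<epsilon>0 by simp
    finally show ?thesis .
  qed
  let ?\<eta> = "\<epsilon> * \<epsilon>"
  have \<eta>: "?\<eta> \<in> \<O>" "?\<eta> * \<sigma> ?\<eta> = 1" using unit_norm_square[OF \<epsilon>] by blast+
  have \<eta>x: "?\<eta> * x \<in> \<O>" if "x \<in> \<O>" for x using \<eta>(1) that by (rule integers_mult)
  \<comment> \<open>The inverse of t is diag(\<epsilon>, 1/\<epsilon>) in one embedding and its
    conjugate in the other; the corner picks out the pure powers of the first diagonal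
    entries.\<close>
  define D1 where "D1 = sym_rep l1 (mat2 (of_real \<epsilon>) 0 0 (inverse (of_real \<epsilon>)))"
  define D2 where "D2 = sym_rep l2 (mat2 (of_real (\<sigma> \<epsilon>)) 0 0 (inverse (of_real (\<sigma> \<epsilon>))))"
  have DC: "D1 \<in> carrier_mat (Suc l1) (Suc l1)" "D2 \<in> carrier_mat (Suc l2) (Suc l2)"
    by (simp_all add: D1_def D2_def)
  have act_t': "act ?t' v = tensor_op D1 D2 v" if "v \<in> carrier V" for v
    unfolding act_proj_class[OF tS(2) that] SL2_act_def map_mat_mat2 D1_def D2_def
    by (simp add: conj_rat \<sigma>inv)
  have tC: "tensor_op D1 D2 v \<in> carrier V" if "v \<in> carrier V" for v
    using that DC by (simp add: rep_space_simps)
  have t_add: "tensor_op D1 D2 (v + w) = tensor_op D1 D2 v + tensor_op D1 D2 w"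
    if "v \<in> carrier V" "w \<in> carrier V" for v w
    by (rule tensor_op_add[OF DC]) (use that in \<open>simp_all add: rep_space_simps\<close>)
  have comm: "act (\<iota> x) (tensor_op D1 D2 v) = tensor_op D1 D2 (act (\<iota> (?\<eta> * x)) v)"
    if x: "x \<in> \<O>" and v: "v \<in> carrier V" for x v
  proof -
    have vC: "v \<in> carrier_mat (Suc l1) (Suc l2)" using v by (simp add: rep_space_simps)
    have \<sigma>\<eta>x: "\<sigma> (?\<eta> * x) = \<sigma> \<epsilon> * \<sigma> \<epsilon> * \<sigma> x"
      using \<epsilon>F x by (simp add: conj_mult field_mult integers_subset_field)
    have 1: "unip l1 (of_real x) * D1 = D1 * unip l1 (of_real (?\<eta> * x))"
      unfolding D1_def using sym_rep_diagonal_unip[of "of_real \<epsilon>"] \<epsilon>0 by simp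
    have 2: "unip l2 (of_real (\<sigma> x)) * D2 = D2 * unip l2 (of_real (\<sigma> (?\<eta> * x)))"
      unfolding D2_def \<sigma>\<eta>x using sym_rep_diagonal_unip[of "of_real (\<sigma> \<epsilon>)"] \<sigma>0 by simp
    show ?thesis
      unfolding act_iota[OF x tC[OF v]] act_iota[OF \<eta>x[OF x] v]
        tensor_op_mult[OF unip_carrier(2) unip_carrier(2) DC vC]
        tensor_op_mult[OF DC unip_carrier(2) unip_carrier(2) vC] 1 2 ..
  qed
  have fV: "f [\<iota> x, \<iota> y] \<in> carrier V" if "x \<in> \<O>" "y \<in> \<O>" for x y
    using f that iota_carrier unfolding cocycle_2_iff cochain_2_iff by blast
  have fco: "act (\<iota> x) (f [\<iota> y, \<iota> z]) + f [\<iota> x, \<iota> (y + z)] = f [\<iota> (x + y), \<iota> z] + f [\<iota> x, \<iota> y]"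
    if "x \<in> \<O>" "y \<in> \<O>" "z \<in> \<O>" for x y z
  proof -
    have "act (\<iota> x) (f [\<iota> y, \<iota> z]) \<oplus>\<^bsub>V\<^esub> f [\<iota> x, \<iota> y \<otimes>\<^bsub>UG\<^esub> \<iota> z]
        = f [\<iota> x \<otimes>\<^bsub>UG\<^esub> \<iota> y, \<iota> z] \<oplus>\<^bsub>V\<^esub> f [\<iota> x, \<iota> y]"
      using f that iota_carrier unfolding cocycle_2_iff by blast
    then show ?thesis using that by (simp add: iota_mult rep_space_simps)
  qed
  have Tf: "T f [\<iota> x, \<iota> y] = tensor_op D1 D2 (f [\<iota> (?\<eta> * x), \<iota> (?\<eta> * y)])" if xy: "x \<in> \<O>" "y \<in> \<O>" for x y
  proof -
    have "[\<iota> x, \<iota> y] \<in> tuples UG 2" using xy iota_carrier tuples_2[of _ UG] by blast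
    then have "T f [\<iota> x, \<iota> y] = act ?t' (f [\<iota> (?\<eta> * x), \<iota> (?\<eta> * y)])"
      unfolding T_def conj_cochain_def inv_t by (simp add: t_conj xy)
    then show ?thesis using act_t'[OF fV[OF \<eta>x[OF xy(1)] \<eta>x[OF xy(2)]]] by simp
  qed
  show "T f \<in> cocycles UG V act 2"
    unfolding cocycle_2_iff cochain_2_iff
  proof (intro conjI ballI)
    show "T f \<in> extensional (tuples UG 2)" by (simp add: T_def conj_cochain_def)
    show "T f [g, h] \<in> carrier V" if gh: "g \<in> carrier UG" "h \<in> carrier UG" for g h
    proof -
      obtain x y where "x \<in> \<O>" "y \<in> \<O>" "g = \<iota> x" "h = \<iota> y" using gh unfolding carrier_UG by blast
      then show ?thesis using Tf tC fV \<eta>x by simp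
    qed
    fix g h k assume "g \<in> carrier UG" "h \<in> carrier UG" "k \<in> carrier UG"
    then obtain x y z where xyz: "x \<in> \<O>" "y \<in> \<O>" "z \<in> \<O>" "g = \<iota> x" "h = \<iota> y" "k = \<iota> z"
      unfolding carrier_UG by blast
    define x' y' z' where "x' = ?\<eta> * x" and "y' = ?\<eta> * y" and "z' = ?\<eta> * z"
    have O: "x' \<in> \<O>" "y' \<in> \<O>" "z' \<in> \<O>" using xyz \<eta>x by (auto simp: x'_def y'_def z'_def)
    have sums: "?\<eta> * (x + y) = x' + y'" "?\<eta> * (y + z) = y' + z'"
      by (simp_all add: x'_def y'_def z'_def algebra_simps)
    have aV: "act (\<iota> x') (f [\<iota> y', \<iota> z']) \<in> carrier V"
      using act_closed[OF iota_carrier[OF O(1)] fV[OF O(2,3)]] .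
    have "act (\<iota> x) (T f [\<iota> y, \<iota> z]) + T f [\<iota> x, \<iota> (y + z)]
        = tensor_op D1 D2 (act (\<iota> x') (f [\<iota> y', \<iota> z'])) + tensor_op D1 D2 (f [\<iota> x', \<iota> (y' + z')])"
      unfolding Tf[OF xyz(2,3)] Tf[OF xyz(1) integers_add[OF xyz(2,3)]] sums
      unfolding x'_def[symmetric] y'_def[symmetric] z'_def[symmetric]
      using comm[OF xyz(1) fV[OF O(2,3)]] by (simp only: x'_def)
    also have "\<dots> = tensor_op D1 D2 (f [\<iota> (x' + y'), \<iota> z'] + f [\<iota> x', \<iota> y'])"
      unfolding t_add[OF aV fV[OF O(1) integers_add[OF O(2,3)]], symmetric] fco[OF O] ..
    also have "\<dots> = T f [\<iota> (x + y), \<iota> z] + T f [\<iota> x, \<iota> y]"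
      unfolding Tf[OF xyz(1,2)] Tf[OF integers_add[OF xyz(1,2)] xyz(3)] sums
      unfolding x'_def[symmetric] y'_def[symmetric] z'_def[symmetric]
      by (rule t_add[OF fV[OF integers_add[OF O(1,2)] O(3)] fV[OF O(1,2)]])
    finally show "act g (T f [h, k]) \<oplus>\<^bsub>V\<^esub> T f [g, h \<otimes>\<^bsub>UG\<^esub> k] = T f [g \<otimes>\<^bsub>UG\<^esub> h, k] \<oplus>\<^bsub>V\<^esub> T f [g, h]"
      using xyz by (simp add: iota_mult rep_space_simps)
  qed
  have corner: "tensor_op D1 D2 v $$ (0, 0) = of_real (\<epsilon> ^ l1 * \<sigma> \<epsilon> ^ l2) * v $$ (0, 0)" if "v \<in> carrier V" for v
  proof -
    have "tensor_op D1 D2 v $$ (0, 0) = D1 $$ (0, 0) * D2 $$ (0, 0) * v $$ (0, 0)"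
      by (rule tensor_op_corner[OF DC])
        (use that in \<open>simp_all add: rep_space_simps D1_def D2_def sym_rep_diagonal\<close>)
    then show ?thesis by (simp add: D1_def D2_def sym_rep_diagonal)
  qed
  \<comment> \<open>Since U fixes the corner functional, this scalar function satisfies the cocycle
    identity with trivial coefficients.\<close>
  define c where "c = (\<lambda>x y. f [\<iota> x, \<iota> y] $$ (0, 0))"
  have c_cocycle: "c y z + c x (y + z) = c (x + y) z + c x y" if xyz: "x \<in> \<O>" "y \<in> \<O>" "z \<in> \<O>" for x y z
  proof -
    note V' = fV[OF xyz(1) integers_add[OF xyz(2,3)]] fV[OF integers_add[OF xyz(1,2)] xyz(3)] fV[OF xyz(1,2)]
    have "(act (\<iota> x) (f [\<iota> y, \<iota> z]) + f [\<iota> x, \<iota> (y + z)]) $$ (0, 0) = (f [\<iota> (x + y), \<iota> z] + f [\<iota> x, \<iota> y]) $$ (0, 0)"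
      using fco[OF xyz] by simp
    then show ?thesis
      using V' corner_invariant[OF iota_carrier[OF xyz(1)] fV[OF xyz(2,3)]]
      by (simp add: c_def rep_space_simps)
  qed
  have "eval_cocycle (T f) = of_real (\<epsilon> ^ l1 * \<sigma> \<epsilon> ^ l2) * (c ?\<eta> (?\<eta> * \<omega>) - c (?\<eta> * \<omega>) ?\<eta>)"
    unfolding eval_cocycle_def Tf[OF integers_consts(2) \<omega>_int] Tf[OF \<omega>_int integers_consts(2)] mult_1_right
      corner[OF fV[OF \<eta>(1) \<eta>x[OF \<omega>_int]]] corner[OF fV[OF \<eta>x[OF \<omega>_int] \<eta>(1)]] c_def
    by (rule right_diff_distrib[symmetric])
  also have "c ?\<eta> (?\<eta> * \<omega>) - c (?\<eta> * \<omega>) ?\<eta> = c 1 \<omega> - c \<omega> 1"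
    by (rule alternation_invariant[where c = c, OF c_cocycle \<omega>_int \<omega>_conj \<omega>_basis \<eta>])
  finally show "eval_cocycle (T f) = of_real (\<epsilon> ^ l1 * \<sigma> \<epsilon> ^ l2) * eval_cocycle f"
    by (simp only: c_def eval_cocycle_def)
qed

lemma cohomology_rank_one:
  assumes \<epsilon>: "\<epsilon> \<in> integer_units F"
  defines "H \<equiv> cohomology UG V act 2"
  shows "vectorspace (class_ring :: complex ring) H" "vectorspace.fin_dim (class_ring :: complex ring) H"
    "vectorspace.dim (class_ring :: complex ring) H = 1"
    "X \<in> carrier H \<Longrightarrow> conj_cohomology (PSL2 \<O>) (lower_unipotents \<O>) V act 2
        (proj_class \<O> (mat2 (inverse \<epsilon>) 0 0 \<epsilon>)) X
      = of_real (\<epsilon> ^ l1 * \<sigma> \<epsilon> ^ l2) \<odot>\<^bsub>H\<^esub> X"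
proof -
  let ?C = "cochains UG V 2" and ?Z = "cocycles UG V act 2" and ?B = "coboundaries UG V act 2"
  obtain z where z: "z \<in> ?Z" "eval_cocycle z \<noteq> 0" using nontrivial_cocycle by blast
  have val: "f [g, h] \<in> carrier_mat (Suc l1) (Suc l2)" if "f \<in> ?Z" "g \<in> carrier UG" "h \<in> carrier UG" for f g h
    using that unfolding cocycle_2_iff cochain_2_iff rep_space_simps by blast
  note i1 = iota_carrier[OF integers_consts(2)] and i\<omega> = iota_carrier[OF \<omega>_int]
  have add: "f \<oplus>\<^bsub>?C\<^esub> g \<in> ?Z \<and> eval_cocycle (f \<oplus>\<^bsub>?C\<^esub> g) = eval_cocycle f + eval_cocycle g"
    if f: "f \<in> ?Z" and g: "g \<in> ?Z" for f g
    using cocycles_2_add[OF f g] val[OF f i1 i\<omega>] val[OF f i\<omega> i1] val[OF g i1 i\<omega>] val[OF g i\<omega> i1]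
    unfolding eval_cocycle_def cochain_2_add[OF i1 i\<omega>] cochain_2_add[OF i\<omega> i1] rep_space_simps by simp
  have smult: "c \<odot>\<^bsub>?C\<^esub> f \<in> ?Z \<and> eval_cocycle (c \<odot>\<^bsub>?C\<^esub> f) = c * eval_cocycle f" if f: "f \<in> ?Z" for c f
    using cocycles_2_smult[OF f] val[OF f i1 i\<omega>] val[OF f i\<omega> i1]
    unfolding eval_cocycle_def cochain_2_smult[OF i1 i\<omega>] cochain_2_smult[OF i\<omega> i1] rep_space_simps
    by (simp add: right_diff_distrib)
  have sub: "?Z \<subseteq> carrier ?C" by (auto simp: cocycles_def)
  have H: "carrier H = {?B +>\<^bsub>?C\<^esub> f | f. f \<in> ?Z}" "\<zero>\<^bsub>H\<^esub> = ?B" "add H = set_add ?C"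
    "Module.smult H = (\<lambda>c. on_classes ?C ?B (\<lambda>f. c \<odot>\<^bsub>?C\<^esub> f))"
    by (simp_all add: H_def cohomology_def Let_def)
  note line = quotient_by_kernel_line[OF cochains_module[OF M.module_axioms] sub add smult coboundaries_eq z H]
  show "vectorspace (class_ring :: complex ring) H" "vectorspace.fin_dim (class_ring :: complex ring) H"
    "vectorspace.dim (class_ring :: complex ring) H = 1"
    by (rule line; assumption)+
  show "conj_cohomology (PSL2 \<O>) (lower_unipotents \<O>) V act 2 (proj_class \<O> (mat2 (inverse \<epsilon>) 0 0 \<epsilon>)) X
      = of_real (\<epsilon> ^ l1 * \<sigma> \<epsilon> ^ l2) \<odot>\<^bsub>H\<^esub> X" if "X \<in> carrier H"
    unfolding conj_cohomology_def
    by (rule line(4)[OF _ _ _ _ that]) (use conj_cochain_cocycle[OF \<epsilon>] in blast)+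
qed

end

theorem theorem3p8:
  fixes F :: "real set" and \<epsilon> :: real and l1 l2 :: nat
  assumes "real_quadratic_field F"
    and "fundamental_unit F \<epsilon>"
    and "l2 \<le> l1"
    and "l1 mod 2 = l2 mod 2"
  shows
    "let \<O> = ring_of_integers F;
         \<Gamma> = PSL2 \<O>;
         U = lower_unipotents \<O>;
         t = proj_class \<O> (mat2 (inverse \<epsilon>) 0 0 \<epsilon>);
         V = rep_space l1 l2;
         act = PSL2_act F l1 l2;
         H2 = cohomology (\<Gamma>\<lparr>carrier := U\<rparr>) V act 2
     in vectorspace (class_ring :: complex ring) H2
        \<and> vectorspace.fin_dim (class_ring :: complex ring) H2
        \<and> vectorspace.dim (class_ring :: complex ring) H2 = 1
        \<and> (\<forall>x\<in>carrier H2. conj_cohomology \<Gamma> U V act 2 t x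
              = complex_of_real (\<epsilon> ^ l1 * galois_conj F \<epsilon> ^ l2) \<odot>\<^bsub>H2\<^esub> x)"
proof -
  obtain s D where "quadratic_field F s D"
    using assms(1) by (rule real_quadratic_field_imp_quadratic_field)
  then interpret quadratic_field F s D .
  obtain \<omega> where "\<omega> \<in> \<O>" "\<sigma> \<omega> \<noteq> \<omega>" "\<And>x. x \<in> \<O> \<Longrightarrow> \<exists>m n :: int. x = of_int m + of_int n * \<omega>"
    by (rule integral_basis) blast
  then interpret quadratic_rep F s D l1 l2 \<omega>
    using assms(4) by unfold_locales
  have \<epsilon>: "\<epsilon> \<in> integer_units F" using assms(2) by (simp add: fundamental_unit_def)
  show ?thesis
    unfolding Let_def using cohomology_rank_one[OF \<epsilon>] by (intro conjI ballI)
qed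

end
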